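(* Let $V^*=\Delta+U$. Then $\mathcal X_{V^*}\subseteq\{\mathbf 0,\mathbf 1\}$, where $\mathbf 0$ is the empty configuration and $\mathbf 1$ is the configuration that is full in $\Lambda^-$ and empty in $\Lambda\setminus\Lambda^-$; and for any $\epsilon>0$ and sufficiently large $\beta$, the function $$\beta\mapsto\sup_{\sigma\in\mathcal X}\mathbb P_\sigma\big(\tau_{\mathcal X_{V^*}}>e^{\beta(V^*+\epsilon)}\big)$$ is super-exponentially small (SES).
   Context: Model. $\mathbb H^2$ is the discrete hexagonal lattice, with dual the triangular lattice $\mathbb T^2$; each site of $\mathbb H^2$ is the center of a triangular face of $\mathbb T^2$ (edge length of $\mathbb{T}^2$ taken as unit of length), two sites are nearest neighbors if they share an edge of $\mathbb H^2$, and $|x-y|$ is the lattice distance. Fix an integer $L\ge 1$ and a regular hexagon of radius (side length) $L$ with sides along $\mathbb T^2$; it contains $6L^2$ sites. $\Lambda\subset\mathbb H^2$ is the union of this hexagon and all sites not in it at lattice distance one from it. Put $\partial^-\Lambda=\{x\in\Lambda:\exists y\notin\Lambda,\ |y-x|=1\}$ and $\Lambda^-=\Lambda\setminus\partial^-\Lambda$ (so $\Lambda^-$ is the hexagon of radius $L$). Configurations: $\eta\in\mathcal X=\{0,1\}^\Lambda$ ($\eta(x)=1$: occupied by a particle). Hamiltonian: $H(\eta)=-U\sum_{\{x,y\}}\eta(x)\eta(y)+\Delta\sum_{x\in\Lambda}\eta(x)$, the first sum over unordered nearest-neighbor pairs in $\Lambda^-$. Kawasaki dynamics. Let $\bar\Lambda^{*,orie}$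 be the set of oriented nearest-neighbor bonds $(x\to y)$ with $x,y\in\Lambda$, or $x\in\partial^-\Lambda,y\notin\Lambda$, or $x\notin\Lambda,y\in\partial^-\Lambda$. $T_b\eta$ is obtained from $\eta$ by exchanging the values at $x,y$ (first case), setting $\eta(x)=0$ (second case), setting $\eta(y)=1$ (third case). The discrete-time Markov chain $(\eta_t)_{t\in\mathbb N}$ has, for $\eta\ne\eta'$, $P(\eta,\eta')=|\bar\Lambda^{*,orie}|^{-1}e^{-\beta[H(\eta')-H(\eta)]_+}$ if $\eta'=T_b\eta$ for some $b\in\bar\Lambda^{*,orie}$, and $0$ otherwise; $P(\eta,\eta)=1-\sum_{\eta'\ne\eta}P(\eta,\eta')$. Here $\beta>0$ is the inverse temperature. $\mathbb P_\eta$ is the law of the chain started at $\eta$; $\tau_{\mathcal A}=\min\{t\ge0:\eta_t\in\mathcal A\}$. Standing assumptions. $U>0$, $\Delta\in(U,\frac32U)$, $3U-2\Delta\ll U$ (it is enough that $3U-2\Delta\le U/100$), $\frac{U}{2(3U-2\Delta)}-\frac12$ is not an integer; $r^*=\lfloor\frac{U}{2(3U-2\Delta)}-\frac12\rfloor$; the fractional part $\delta\in(0,1)$ of $\frac{U}{2(3U-2\Delta)}-\frac12$ satisfies $\delta\ne\frac12$. The volume $\Lambda$ is fixed and large: $L>2r^*+3$. Notions. A path is a sequence $\omega=(\omega_1,\dots,\omega_k)$ in $\mathcal X$ with $P(\omega_i,\omega_{i+1})>0$. $\Phi(\sigma,\eta)=\min_{\omega:\sigma\to\eta}\max_{\zeta\in\omega}H(\zeta)$,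 $\Phi(\sigma,\mathcal A)=\min_{\eta\in\mathcal A}\Phi(\sigma,\eta)$. Stability level: $V_\sigma=\Phi(\sigma,\mathcal I_\sigma)-H(\sigma)$ with $\mathcal I_\sigma=\{\eta\in\mathcal X:H(\eta)<H(\sigma)\}$, and $V_\sigma=\infty$ if $\mathcal I_\sigma=\emptyset$. $\mathcal X_V=\{\eta\in\mathcal X:V_\eta>V\}$. A function $\beta\mapsto f(\beta)$ is super-exponentially small (SES) if $\lim_{\beta\to\infty}\frac{\log f(\beta)}{\beta}=-\infty$ (with $\log 0=-\infty$). *)

theory Defs
  imports "HOL-Probability.Probability"
begin

section \<open>Lattice and volume\<close>

text \<open>
  A vertex \<open>(i, j)\<close> of the triangular lattice is the point \<open>i e\<^sub>1 + j e\<^sub>2\<close> of the plane with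
  \<open>e\<^sub>1 = (1, 0)\<close> and \<open>e\<^sub>2 = (1/2, sqrt 3 / 2)\<close>.  A site of the hexagonal lattice is the center
  of a triangular face and is identified with that face: \<open>Up i j\<close> and \<open>Down i j\<close> are the two
  halves of the rhombus with corners \<open>(i, j)\<close>, \<open>(i+1, j)\<close>, \<open>(i, j+1)\<close>, \<open>(i+1, j+1)\<close>.
\<close>

type_synonym vertex = "int \<times> int"

datatype site = Up int int | Down int int

fun corners :: "site \<Rightarrow> vertex set" where
  "corners (Up i j) = {(i, j), (i + 1, j), (i, j + 1)}"
| "corners (Down i j) = {(i + 1, j), (i, j + 1), (i + 1, j + 1)}"

text \<open>
  An edge of the hexagonal lattice joins the centers of two faces with a common side.  Since
  nearest neighbors are exactly the pairs at lattice distance one, this relation also renders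
  \<open>|x - y| = 1\<close>.
\<close>

definition nn :: "site \<Rightarrow> site \<Rightarrow> bool" where
  "nn x y \<longleftrightarrow> card (corners x \<inter> corners y) = 2"

text \<open>
  The regular hexagon of side length \<open>L\<close> centered at the origin, with corners
  \<open>\<plusminus>L e\<^sub>1\<close>, \<open>\<plusminus>L e\<^sub>2\<close>, \<open>\<plusminus>L (e\<^sub>2 - e\<^sub>1)\<close>.
\<close>

definition hexagon_vertices :: "nat \<Rightarrow> vertex set" where
  "hexagon_vertices L = {(i, j). \<bar>i\<bar> \<le> int L \<and> \<bar>j\<bar> \<le> int L \<and> \<bar>i + j\<bar> \<le> int L}"

definition hexagon :: "nat \<Rightarrow> site set" where
  "hexagon L = {x. corners x \<subseteq> hexagon_vertices L}"

definition Lam :: "nat \<Rightarrow> site set" where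
  "Lam L = hexagon L \<union> {x. x \<notin> hexagon L \<and> (\<exists>y\<in>hexagon L. nn x y)}"

definition Lam_bdry :: "nat \<Rightarrow> site set" where
  "Lam_bdry L = {x \<in> Lam L. \<exists>y. y \<notin> Lam L \<and> nn y x}"

definition Lam_minus :: "nat \<Rightarrow> site set" where
  "Lam_minus L = Lam L - Lam_bdry L"


section \<open>Configurations and energy\<close>

text \<open>Configurations are extensional: they take the value \<^const>\<open>undefined\<close> outside \<open>\<Lambda>\<close>.\<close>

type_synonym config = "site \<Rightarrow> nat"

definition configs :: "nat \<Rightarrow> config set" where
  "configs L = Lam L \<rightarrow>\<^sub>E {0, 1}"

definition empty_config :: "nat \<Rightarrow> config" where
  "empty_config L = (\<lambda>x\<in>Lam L. 0)"

definition full_config :: "nat \<Rightarrow> config" where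
  "full_config L = (\<lambda>x\<in>Lam L. if x \<in> Lam_minus L then 1 else 0)"

definition inner_pairs :: "nat \<Rightarrow> site set set" where
  "inner_pairs L = {{x, y} | x y. x \<in> Lam_minus L \<and> y \<in> Lam_minus L \<and> nn x y}"

text \<open>For an unordered pair \<open>e = {x, y}\<close> with \<open>x \<noteq> y\<close> the product over \<open>e\<close> is \<open>\<eta>(x) \<eta>(y)\<close>.\<close>

definition energy :: "nat \<Rightarrow> real \<Rightarrow> real \<Rightarrow> config \<Rightarrow> real" where
  "energy L U \<Delta> \<eta> =
     - U * (\<Sum>e\<in>inner_pairs L. \<Prod>z\<in>e. real (\<eta> z)) + \<Delta> * (\<Sum>x\<in>Lam L. real (\<eta> x))"


section \<open>Kawasaki dynamics\<close>

definition oriented_bonds :: "nat \<Rightarrow> (site \<times> site) set" where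
  "oriented_bonds L = {(x, y). nn x y \<and>
     (x \<in> Lam L \<and> y \<in> Lam L \<or> x \<in> Lam_bdry L \<and> y \<notin> Lam L \<or> x \<notin> Lam L \<and> y \<in> Lam_bdry L)}"

fun bond_move :: "nat \<Rightarrow> site \<times> site \<Rightarrow> config \<Rightarrow> config" where
  "bond_move L (x, y) \<eta> =
     (if x \<in> Lam L \<and> y \<in> Lam L then \<eta>(x := \<eta> y, y := \<eta> x)
      else if x \<in> Lam L then \<eta>(x := 0)
      else \<eta>(y := 1))"

definition jump_prob :: "nat \<Rightarrow> real \<Rightarrow> real \<Rightarrow> real \<Rightarrow> config \<Rightarrow> config \<Rightarrow> real" where
  "jump_prob L U \<Delta> \<beta> \<eta> \<eta>' =
     (if \<exists>b\<in>oriented_bonds L. \<eta>' = bond_move L b \<eta>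
      then 1 / real (card (oriented_bonds L)) * exp (- \<beta> * max 0 (energy L U \<Delta> \<eta>' - energy L U \<Delta> \<eta>))
      else 0)"

definition trans_prob :: "nat \<Rightarrow> real \<Rightarrow> real \<Rightarrow> real \<Rightarrow> config \<Rightarrow> config \<Rightarrow> real" where
  "trans_prob L U \<Delta> \<beta> \<eta> \<eta>' =
     (if \<eta>' \<noteq> \<eta> then jump_prob L U \<Delta> \<beta> \<eta> \<eta>'
      else 1 - (\<Sum>\<zeta>\<in>configs L - {\<eta>}. jump_prob L U \<Delta> \<beta> \<eta> \<zeta>))"

text \<open>
  The law of the chain started at \<open>\<sigma>\<close> is the Ionescu-Tulcea measure on trajectories
  \<open>nat \<Rightarrow> config\<close> obtained from the following kernels, where \<open>kawasaki_kernel \<dots> n \<omega>\<close> is the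
  conditional distribution of the state at time \<open>n\<close> given the states \<open>\<omega> 0, \<dots>, \<omega> (n - 1)\<close>.
  Its finite-dimensional distributions are computed in \<open>kawasaki_law_cylinder\<close> below.
\<close>

definition kawasaki_kernel ::
    "nat \<Rightarrow> real \<Rightarrow> real \<Rightarrow> real \<Rightarrow> config \<Rightarrow> nat \<Rightarrow> (nat \<Rightarrow> config) \<Rightarrow> config measure" where
  "kawasaki_kernel L U \<Delta> \<beta> \<sigma> n \<omega> =
     (case n of 0 \<Rightarrow> return (count_space (configs L)) \<sigma>
      | Suc m \<Rightarrow> point_measure (configs L) (\<lambda>\<eta>'. ennreal (trans_prob L U \<Delta> \<beta> (\<omega> m) \<eta>')))"

definition kawasaki_law ::
    "nat \<Rightarrow> real \<Rightarrow> real \<Rightarrow> real \<Rightarrow> config \<Rightarrow> (nat \<Rightarrow> config) measure" where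
  "kawasaki_law L U \<Delta> \<beta> \<sigma> =
     (let M = (\<lambda>_. count_space (configs L))
      in projective_family.lim UNIV (Ionescu_Tulcea.CI (kawasaki_kernel L U \<Delta> \<beta> \<sigma>) M) M)"

definition hitting_time :: "config set \<Rightarrow> (nat \<Rightarrow> config) \<Rightarrow> enat" where
  "hitting_time A \<omega> = (INF t\<in>{t. \<omega> t \<in> A}. enat t)"


section \<open>Energy landscape\<close>

text \<open>
  Positivity of the transition probabilities, hence everything in this section, is independent
  of \<open>\<beta>\<close> except possibly for the trivial steps from a configuration to itself; the parameter
  is kept because paths are defined through the transition matrix.
\<close>

definition paths ::
    "nat \<Rightarrow> real \<Rightarrow> real \<Rightarrow> real \<Rightarrow> config \<Rightarrow> config \<Rightarrow> config list set" where
  "paths L U \<Delta> \<beta> \<sigma> \<eta> =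
     {\<omega>. \<omega> \<noteq> [] \<and> set \<omega> \<subseteq> configs L \<and> hd \<omega> = \<sigma> \<and> last \<omega> = \<eta> \<and>
         (\<forall>i. Suc i < length \<omega> \<longrightarrow> trans_prob L U \<Delta> \<beta> (\<omega> ! i) (\<omega> ! Suc i) > 0)}"

definition comm_height :: "nat \<Rightarrow> real \<Rightarrow> real \<Rightarrow> real \<Rightarrow> config \<Rightarrow> config \<Rightarrow> real" where
  "comm_height L U \<Delta> \<beta> \<sigma> \<eta> =
     Min ((\<lambda>\<omega>. Max (energy L U \<Delta> ` set \<omega>)) ` paths L U \<Delta> \<beta> \<sigma> \<eta>)"

definition comm_height_set :: "nat \<Rightarrow> real \<Rightarrow> real \<Rightarrow> real \<Rightarrow> config \<Rightarrow> config set \<Rightarrow> real" where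
  "comm_height_set L U \<Delta> \<beta> \<sigma> A = Min (comm_height L U \<Delta> \<beta> \<sigma> ` A)"

definition lower_configs :: "nat \<Rightarrow> real \<Rightarrow> real \<Rightarrow> config \<Rightarrow> config set" where
  "lower_configs L U \<Delta> \<sigma> = {\<eta> \<in> configs L. energy L U \<Delta> \<eta> < energy L U \<Delta> \<sigma>}"

definition stability_level :: "nat \<Rightarrow> real \<Rightarrow> real \<Rightarrow> real \<Rightarrow> config \<Rightarrow> ereal" where
  "stability_level L U \<Delta> \<beta> \<sigma> =
     (if lower_configs L U \<Delta> \<sigma> = {} then \<infinity>
      else ereal (comm_height_set L U \<Delta> \<beta> \<sigma> (lower_configs L U \<Delta> \<sigma>) - energy L U \<Delta> \<sigma>))"

definition stable_configs :: "nat \<Rightarrow> real \<Rightarrow> real \<Rightarrow> real \<Rightarrow> real \<Rightarrow> config set" where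
  "stable_configs L U \<Delta> \<beta> V = {\<eta> \<in> configs L. stability_level L U \<Delta> \<beta> \<eta> > ereal V}"

text \<open>The quantity \<open>U / (2 (3 U - 2 \<Delta>)) - 1 / 2\<close> whose integer part is \<open>r\<^sup>*\<close>.\<close>

definition crit_ratio :: "real \<Rightarrow> real \<Rightarrow> real" where
  "crit_ratio U \<Delta> = U / (2 * (3 * U - 2 * \<Delta>)) - 1 / 2"

definition crit_radius :: "real \<Rightarrow> real \<Rightarrow> int" where
  "crit_radius U \<Delta> = \<lfloor>crit_ratio U \<Delta>\<rfloor>"


section \<open>Super-exponential smallness\<close>

definition log_ext :: "real \<Rightarrow> ereal" where
  "log_ext x = (if x = 0 then - \<infinity> else ereal (ln x))"

definition SES :: "(real \<Rightarrow> real) \<Rightarrow> bool" where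
  "SES f \<longleftrightarrow> ((\<lambda>\<beta>. log_ext (f \<beta>) / ereal \<beta>) \<longlongrightarrow> - \<infinity>) at_top"


section \<open>Basic properties\<close>

lemma nn_iff:
  "nn (Up i j) (Up k l) \<longleftrightarrow> False"
  "nn (Down i j) (Down k l) \<longleftrightarrow> False"
  "nn (Up i j) (Down k l) \<longleftrightarrow> (k, l) \<in> {(i, j), (i - 1, j), (i, j - 1)}"
  "nn (Down k l) (Up i j) \<longleftrightarrow> (k, l) \<in> {(i, j), (i - 1, j), (i, j - 1)}"
proof -
  define a b where "a = k - i" and "b = l - j"
  have kl: "k = i + a" "l = j + b" by (auto simp: a_def b_def)
  have UD: "nn (Up i j) (Down k l) \<longleftrightarrow> (k, l) \<in> {(i, j), (i - 1, j), (i, j - 1)}"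
    unfolding kl nn_def by (simp add: Int_insert_left) presburger
  show "nn (Up i j) (Up k l) \<longleftrightarrow> False"
    unfolding kl nn_def by (simp add: Int_insert_left)
  show "nn (Down i j) (Down k l) \<longleftrightarrow> False"
    unfolding kl nn_def by (simp add: Int_insert_left)
  show "nn (Up i j) (Down k l) \<longleftrightarrow> (k, l) \<in> {(i, j), (i - 1, j), (i, j - 1)}"
    by (rule UD)
  then show "nn (Down k l) (Up i j) \<longleftrightarrow> (k, l) \<in> {(i, j), (i - 1, j), (i, j - 1)}"
    by (simp only: nn_def Int_commute)
qed

lemma nn_sym: "nn x y \<longleftrightarrow> nn y x"
  by (simp add: nn_def Int_commute)

lemma nn_iff':
  "nn y (Up i j) \<longleftrightarrow> y \<in> {Down i j, Down (i - 1) j, Down i (j - 1)}"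
  "nn y (Down i j) \<longleftrightarrow> y \<in> {Up i j, Up (i + 1) j, Up i (j + 1)}"
  by (cases y; auto simp: nn_iff)+

lemma finite_nn: "finite {y. nn y x}"
  by (cases x) (simp_all only: nn_iff' Collect_mem_eq finite_insert finite.emptyI)

lemma hexagon_iff:
  "Up i j \<in> hexagon L \<longleftrightarrow> - int L \<le> i \<and> i < int L \<and> - int L \<le> j \<and> j < int L \<and>
     - int L \<le> i + j \<and> i + j < int L"
  "Down i j \<in> hexagon L \<longleftrightarrow> - int L \<le> i \<and> i < int L \<and> - int L \<le> j \<and> j < int L \<and>
     - int L \<le> i + j + 1 \<and> i + j + 1 < int L"
  by (simp add: hexagon_def hexagon_vertices_def abs_le_iff, linarith)+

lemma finite_hexagon: "finite (hexagon L)"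
proof -
  have "hexagon L \<subseteq> (\<lambda>(i, j). Up i j) ` ({- int L..int L} \<times> {- int L..int L})
      \<union> (\<lambda>(i, j). Down i j) ` ({- int L - 1..int L} \<times> {- int L - 1..int L})"
  proof
    fix x assume x: "x \<in> hexagon L"
    show "x \<in> (\<lambda>(i, j). Up i j) ` ({- int L..int L} \<times> {- int L..int L})
      \<union> (\<lambda>(i, j). Down i j) ` ({- int L - 1..int L} \<times> {- int L - 1..int L})"
    proof (cases x)
      case (Up i j)
      then show ?thesis using x
        by (intro UnI1 image_eqI[of _ _ "(i, j)"]) (simp_all add: hexagon_iff)
    next
      case (Down i j)
      then show ?thesis using x
        by (intro UnI2 image_eqI[of _ _ "(i, j)"]) (simp_all add: hexagon_iff)
    qed
  qed
  then show ?thesis by (rule finite_subset) auto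
qed

lemma finite_Lam: "finite (Lam L)"
proof -
  have "Lam L \<subseteq> hexagon L \<union> (\<Union>y\<in>hexagon L. {x. nn x y})"
    by (auto simp: Lam_def)
  then show ?thesis
    by (rule finite_subset) (simp add: finite_hexagon finite_nn)
qed

lemma ex_nn_iff:
  "(\<exists>y. P y \<and> nn y (Up i j)) \<longleftrightarrow> P (Down i j) \<or> P (Down (i - 1) j) \<or> P (Down i (j - 1))"
  "(\<exists>y. P y \<and> nn y (Down i j)) \<longleftrightarrow> P (Up i j) \<or> P (Up (i + 1) j) \<or> P (Up i (j + 1))"
  by (auto simp: nn_iff')

lemma Lam_iff: "x \<in> Lam L \<longleftrightarrow> x \<in> hexagon L \<or> (\<exists>y. y \<in> hexagon L \<and> nn y x)"
  using nn_sym by (auto simp: Lam_def)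

lemma Lam_minus_eq_hexagon:
  assumes "L \<ge> 1" shows "Lam_minus L = hexagon L"
proof -
  have "x \<in> Lam_minus L \<longleftrightarrow> x \<in> hexagon L" for x
  proof (cases x)
    case (Up i j)
    show ?thesis
      unfolding Up Lam_minus_def Lam_bdry_def Diff_iff mem_Collect_eq ex_nn_iff Lam_iff hexagon_iff
      using assms by (smt (verit))
  next
    case (Down i j)
    show ?thesis
      unfolding Down Lam_minus_def Lam_bdry_def Diff_iff mem_Collect_eq ex_nn_iff Lam_iff hexagon_iff
      using assms by (smt (verit))
  qed
  then show ?thesis by blast
qed

lemma finite_configs: "finite (configs L)"
  by (auto simp: configs_def finite_Lam intro!: finite_PiE)

lemma finite_oriented_bonds: "finite (oriented_bonds L)"
proof -
  have "oriented_bonds L \<subseteq> (\<Union>x\<in>Lam L. {x} \<times> {y. nn y x} \<union> {y. nn y x} \<times> {x})"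
    using nn_sym by (auto simp: oriented_bonds_def Lam_bdry_def)
  then show ?thesis
    by (rule finite_subset) (simp add: finite_Lam finite_nn)
qed

lemma jump_prob_nonneg: "jump_prob L U \<Delta> \<beta> \<eta> \<zeta> \<ge> 0"
  by (simp add: jump_prob_def)

lemma bond_move_configs:
  "b \<in> oriented_bonds L \<Longrightarrow> \<eta> \<in> configs L \<Longrightarrow> bond_move L b \<eta> \<in> configs L"
  by (cases b)
     (auto simp: configs_def oriented_bonds_def Lam_bdry_def PiE_iff extensional_def Ball_def)

lemma sum_jump_prob_le_1:
  assumes "\<beta> \<ge> 0"
  shows "(\<Sum>\<zeta>\<in>configs L - {\<eta>}. jump_prob L U \<Delta> \<beta> \<eta> \<zeta>) \<le> 1"
proof -
  let ?B = "oriented_bonds L" and ?S = "configs L - {\<eta>}"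
  have "(\<Sum>\<zeta>\<in>?S. jump_prob L U \<Delta> \<beta> \<eta> \<zeta>)
      = (\<Sum>\<zeta>\<in>?S \<inter> (\<lambda>b. bond_move L b \<eta>) ` ?B. jump_prob L U \<Delta> \<beta> \<eta> \<zeta>)"
    by (intro sum.mono_neutral_right) (auto simp: finite_configs jump_prob_def)
  also have "\<dots> \<le> (\<Sum>\<zeta>\<in>?S \<inter> (\<lambda>b. bond_move L b \<eta>) ` ?B. 1 / real (card ?B))"
    using assms by (intro sum_mono) (auto simp: jump_prob_def divide_simps mult_nonneg_nonneg)
  also have "\<dots> \<le> (\<Sum>\<zeta>\<in>(\<lambda>b. bond_move L b \<eta>) ` ?B. 1 / real (card ?B))"
    by (intro sum_mono2) (auto simp: finite_oriented_bonds)
  also have "\<dots> \<le> real (card ?B) * (1 / real (card ?B))"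
    using card_image_le[OF finite_oriented_bonds, of "\<lambda>b. bond_move L b \<eta>" L]
    by (simp add: divide_right_mono)
  also have "\<dots> \<le> 1" by simp
  finally show ?thesis .
qed

lemma trans_prob_nonneg: "\<beta> \<ge> 0 \<Longrightarrow> trans_prob L U \<Delta> \<beta> \<eta> \<zeta> \<ge> 0"
  using sum_jump_prob_le_1[of \<beta>] by (auto simp: trans_prob_def jump_prob_nonneg)

lemma sum_trans_prob:
  assumes "\<eta> \<in> configs L"
  shows "(\<Sum>\<zeta>\<in>configs L. trans_prob L U \<Delta> \<beta> \<eta> \<zeta>) = 1"
proof -
  have "(\<Sum>\<zeta>\<in>configs L - {\<eta>}. trans_prob L U \<Delta> \<beta> \<eta> \<zeta>) = (\<Sum>\<zeta>\<in>configs L - {\<eta>}. jump_prob L U \<Delta> \<beta> \<eta> \<zeta>)"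
    by (rule sum.cong) (auto simp: trans_prob_def)
  then show ?thesis
    using assms by (subst sum.remove[OF finite_configs assms]) (simp add: trans_prob_def)
qed

lemma Ionescu_Tulcea_kawasaki:
  assumes "\<beta> \<ge> 0" "\<sigma> \<in> configs L"
  shows "Ionescu_Tulcea (kawasaki_kernel L U \<Delta> \<beta> \<sigma>) (\<lambda>_. count_space (configs L))"
proof (rule Ionescu_Tulcea.intro)
  let ?X = "configs L" and ?K = "kawasaki_kernel L U \<Delta> \<beta> \<sigma>"
  have pm: "prob_space (point_measure ?X (\<lambda>\<eta>'. ennreal (trans_prob L U \<Delta> \<beta> \<eta> \<eta>')))" if "\<eta> \<in> ?X" for \<eta>
    by (rule prob_spaceI)
       (simp add: space_point_measure emeasure_point_measure_finite finite_configs sum_ennreal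
          trans_prob_nonneg[OF assms(1)] sum_trans_prob[OF that])
  have mem: "\<omega> m \<in> ?X" if "\<omega> \<in> space (PiM {0..<Suc m} (\<lambda>_. count_space ?X))" for \<omega> m
    using that by (auto simp: space_PiM PiE_iff)
  show "prob_space (?K i \<omega>)" if "\<omega> \<in> space (PiM {0..<i} (\<lambda>_. count_space ?X))" for i \<omega>
    using that assms(2) pm mem
    by (cases i) (auto simp: kawasaki_kernel_def prob_space_return)
  show "?K i \<in> measurable (PiM {0..<i} (\<lambda>_. count_space ?X)) (subprob_algebra (count_space ?X))" for i
  proof (cases i)
    case 0
    then show ?thesis
      using assms(2) by (auto simp: kawasaki_kernel_def[abs_def] space_subprob_algebra
            intro!: measurable_const prob_space_imp_subprob_space prob_space_return)
  next
    case (Suc m)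
    have "(\<lambda>\<omega>. \<omega> m) \<in> measurable (PiM {0..<i} (\<lambda>_. count_space ?X)) (count_space ?X)"
      using Suc by (intro measurable_component_singleton) auto
    moreover have "(\<lambda>\<eta>. point_measure ?X (\<lambda>\<eta>'. ennreal (trans_prob L U \<Delta> \<beta> \<eta> \<eta>')))
        \<in> measurable (count_space ?X) (subprob_algebra (count_space ?X))"
      using pm by (auto simp: space_subprob_algebra sets_point_measure prob_space_imp_subprob_space)
    ultimately have "(\<lambda>\<omega>. point_measure ?X (\<lambda>\<eta>'. ennreal (trans_prob L U \<Delta> \<beta> (\<omega> m) \<eta>')))
        \<in> measurable (PiM {0..<i} (\<lambda>_. count_space ?X)) (subprob_algebra (count_space ?X))"
      by (rule measurable_compose)
    then show ?thesis
      by (simp add: Suc kawasaki_kernel_def[abs_def])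
  qed
qed

lemma kawasaki_law_cylinder:
  assumes "\<beta> \<ge> 0" "\<sigma> \<in> configs L" "\<And>i. i \<le> n \<Longrightarrow> p i \<in> configs L"
  shows "\<P>(\<omega> in kawasaki_law L U \<Delta> \<beta> \<sigma>. \<forall>i\<le>n. \<omega> i = p i) =
    (if p 0 = \<sigma> then \<Prod>i<n. trans_prob L U \<Delta> \<beta> (p i) (p (Suc i)) else 0)"
proof -
  define M where "M = (\<lambda>_::nat. count_space (configs L))"
  define K where "K = kawasaki_kernel L U \<Delta> \<beta> \<sigma>"
  define q where "q m = restrict p {0..<m}" for m
  interpret IT: Ionescu_Tulcea K M
    unfolding K_def M_def by (rule Ionescu_Tulcea_kawasaki[OF assms(1,2)])
  have fX: "finite (configs L)" by (rule finite_configs)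
  have q_space: "q m \<in> space (PiM {0..<m} M)" if "m \<le> Suc n" for m
    using that assms(3) by (auto simp: q_def M_def space_PiM PiE_iff)
  have sing: "{q m} \<in> sets (PiM {0..<m} M)" if "m \<le> Suc n" for m
  proof -
    have "{q m} = Pi\<^sub>E {0..<m} (\<lambda>i. {p i})"
      by (auto simp: q_def PiE_iff extensional_def fun_eq_iff)
    also have "\<dots> \<in> sets (PiM {0..<m} M)"
      using that assms(3) by (intro sets_PiM_I_finite) (auto simp: M_def)
    finally show ?thesis .
  qed
  have step: "emeasure (IT.C 0 (Suc m) (\<lambda>_. undefined)) {q (Suc m)}
      = emeasure (K m (q m)) {p m} * emeasure (IT.C 0 m (\<lambda>_. undefined)) {q m}" if "m \<le> n" for m
  proof -
    have u: "(\<lambda>_. undefined) \<in> space (PiM {0..<0} M)" by (simp add: space_PiM)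
    have ne: "space (IT.C 0 m (\<lambda>_. undefined)) \<noteq> {}"
      using IT.prob_space_C[OF u, of m] by (rule prob_space.not_empty)
    have "emeasure (IT.C 0 (Suc m) (\<lambda>_. undefined)) {q (Suc m)}
       = (\<integral>\<^sup>+x. emeasure (IT.eP m x) {q (Suc m)} \<partial>IT.C 0 m (\<lambda>_. undefined))"
      using that ne
      by (simp, subst emeasure_bind[OF ne _ sing])
         (auto simp: measurable_cong_sets[OF IT.sets_C[OF u] refl] IT.measurable_eP)
    also have "\<dots> = (\<integral>\<^sup>+x. emeasure (K m (q m)) {p m} * indicator {q m} x \<partial>IT.C 0 m (\<lambda>_. undefined))"
    proof (rule nn_integral_cong)
      fix x assume "x \<in> space (IT.C 0 m (\<lambda>_. undefined))"
      then have x: "x \<in> space (PiM {0..<m} M)" by (simp add: IT.space_C[OF u])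
      have xe: "x \<in> extensional {0..<m}" using x by (auto simp: space_PiM PiE_iff)
      have "fun_upd x m -` {q (Suc m)} \<inter> space (M m) = (if x = q m then {p m} else {})"
        using assms(3)[OF that] xe
        by (auto simp: q_def M_def fun_eq_iff extensional_def less_Suc_eq restrict_def)
           (metis less_irrefl_nat)+
      then show "emeasure (IT.eP m x) {q (Suc m)} = emeasure (K m (q m)) {p m} * indicator {q m} x"
        using that by (subst IT.emeasure_eP[OF x sing]) (auto)
    qed
    also have "\<dots> = emeasure (K m (q m)) {p m} * emeasure (IT.C 0 m (\<lambda>_. undefined)) {q m}"
      using that sing[of m] by (subst nn_integral_cmult_indicator) (auto simp: IT.sets_C[OF u])
    finally show ?thesis .
  qed
  have C: "emeasure (IT.C 0 (Suc m) (\<lambda>_. undefined)) {q (Suc m)}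
     = ennreal (if p 0 = \<sigma> then \<Prod>i<m. trans_prob L U \<Delta> \<beta> (p i) (p (Suc i)) else 0)" if "m \<le> n" for m
    using that
  proof (induction m)
    case 0
    have "emeasure (IT.C 0 0 (\<lambda>_. undefined)) {q 0} = 1"
      using sing[of 0] by (simp add: q_def restrict_def)
    moreover have "emeasure (K 0 (q 0)) {p 0} = (if p 0 = \<sigma> then 1 else 0)"
      using assms(3)[of 0] by (simp add: K_def kawasaki_kernel_def)
    ultimately show ?case
      using step[of 0] by (simp del: IT.C.simps)
  next
    case (Suc m)
    have "emeasure (K (Suc m) (q (Suc m))) {p (Suc m)} = ennreal (trans_prob L U \<Delta> \<beta> (p m) (p (Suc m)))"
      using assms(3)[OF Suc.prems]
      by (simp add: K_def kawasaki_kernel_def q_def emeasure_point_measure_finite fX)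
    with step[of "Suc m"] Suc show ?case
      by (simp add: ennreal_mult'' trans_prob_nonneg[OF assms(1)] prod_nonneg mult.commute
           ennreal_mult del: IT.C.simps)
  qed
  have law: "kawasaki_law L U \<Delta> \<beta> \<sigma> = IT.PF.lim"
    by (simp add: kawasaki_law_def K_def M_def Let_def)
  have req: "restrict \<omega> {0..<Suc n} = q (Suc n) \<longleftrightarrow> (\<forall>i\<le>n. \<omega> i = p i)" for \<omega>
  proof
    assume eq: "restrict \<omega> {0..<Suc n} = q (Suc n)"
    have "\<omega> i = p i" if "i \<le> n" for i
      using fun_cong[OF eq, of i] that by (simp add: q_def)
    then show "\<forall>i\<le>n. \<omega> i = p i" by blast
  next
    assume "\<forall>i\<le>n. \<omega> i = p i"
    then show "restrict \<omega> {0..<Suc n} = q (Suc n)"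
      unfolding q_def by (intro restrict_ext) auto
  qed
  have "{\<omega> \<in> space IT.PF.lim. \<forall>i\<le>n. \<omega> i = p i} = IT.PF.emb UNIV {0..<Suc n} {q (Suc n)}"
    using req by (auto simp: prod_emb_def IT.PF.space_lim space_PiM)
  then have "emeasure IT.PF.lim {\<omega> \<in> space IT.PF.lim. \<forall>i\<le>n. \<omega> i = p i}
      = emeasure (IT.C 0 (Suc n) (\<lambda>_. undefined)) {q (Suc n)}"
    using IT.lim[of "{0..<Suc n}" "{q (Suc n)}"] sing[of "Suc n"]
      IT.emeasure_CI[of "{0..<Suc n}" "Suc n" "{q (Suc n)}"]
      prod_emb_id[of "{q (Suc n)}" "{0..<Suc n}" M] q_space[of "Suc n"]
    by (simp add: space_PiM del: IT.C.simps)
  also note C[of n]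
  finally show ?thesis
    unfolding law measure_def
    by (simp add: prod_nonneg trans_prob_nonneg[OF assms(1)])
qed

end

theory Submission
  imports Defs "HOL-Real_Asymp.Real_Asymp"
begin

text \<open>
  Metastable states.  Write \<open>\<kappa> = 3 U - 2 \<Delta>\<close>.  A configuration is improved below the height
  \<open>H + \<Delta> + U\<close> by one of the following moves, tried in this order: a particle with at most one
  neighbour leaves; a vacant site with two occupied neighbours is filled; two adjacent vacant
  sites, each next to the cluster, are filled (gain \<open>\<kappa>\<close>).  If none applies, the interface seen
  from the outside has straight sides and convex corners only.  Removing the row behind a side
  of length \<open>m\<close> changes the energy by \<open>m \<kappa> - (\<Delta> - U)\<close>, adding a row of \<open>2 m + 1\<close> sites in
  front of it by \<open>(\<Delta> - U) - m \<kappa>\<close>.  Since \<open>(\<Delta> - U) / \<kappa> = crit_ratio U \<Delta>\<close>, a side of length at most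
  \<open>r\<^sup>*\<close> shrinks and one of length at least \<open>r\<^sup>* + 2\<close> grows; two consecutive sides of length
  \<open>r\<^sup>* + 1\<close> are both shrunk or both grown according to whether \<open>\<delta> > 1/2\<close>.  Such a pair is found
  at the topmost particles, provided that no side of the hexagon lies in the way; if particles
  touch the border of the hexagon, then either the same argument applies along the border or
  the border is full, and the topmost vacant sites are filled by moving holes through the
  occupied sites above them.

  Recurrence.  The chain killed on the metastable set is reversible, and the descending paths give a Poincare
  inequality with constant of order \<open>exp (\<beta> V\<^sup>*)\<close>; hence the survival probability at time
  \<open>exp (\<beta> (V\<^sup>* + \<epsilon>))\<close> is at most \<open>exp (O (\<beta>) - c exp (\<beta> \<epsilon>))\<close>.
\<close>

section \<open>Energy landscape on sets of occupied sites\<close>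

text \<open>The identity (3 \<Delta> - 2 U) + \<kappa> = \<Delta> + U explains the height. Filling a
  row peaks at 3 \<Delta> - 2 U above the start, and removing a row at a profit stays below the same
  value. A side of length \<open>r + 1\<close> pays in neither direction; the first of two rows then
  leaves a debt below \<kappa>, for which the remaining room just suffices. Removing two rows and
  adding two rows have opposite total energies, so \<delta> \<noteq> 1/2 makes exactly one of them a
  gain. A cluster may be disconnected and have cavities, and nothing is known about its global
  shape. The argument therefore inspects only two sides next to an extreme particle. It must also
  ensure that a free particle can travel to the place where it is needed, since a growing row can
  close passages. This is why accessibility is demanded for the set with the strip already added,
  and why strips are filled from the far end towards their entrance.\<close>

definition cfg :: "nat \<Rightarrow> site set \<Rightarrow> config" where
  "cfg L S = (\<lambda>x\<in>Lam L. if x \<in> S then 1 else 0)"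

definition deg :: "site set \<Rightarrow> site \<Rightarrow> nat" where
  "deg S x = card {y \<in> S. nn y x}"

text \<open>Bounding both ends of a move replaces paths of height at most \<open>h\<close> by a
  reflexive transitive closure; \<beta> does not occur, and the relation is symmetric.\<close>

definition moves_below :: "nat \<Rightarrow> real \<Rightarrow> real \<Rightarrow> real \<Rightarrow> (config \<times> config) set" where
  "moves_below L U \<Delta> h = {(\<eta>, \<eta>'). \<eta> \<in> configs L \<and> \<eta>' \<in> configs L \<and>
     energy L U \<Delta> \<eta> \<le> h \<and> energy L U \<Delta> \<eta>' \<le> h \<and> (\<exists>b\<in>oriented_bonds L. \<eta>' = bond_move L b \<eta>)}"

lemma hexagon_subset_Lam: "hexagon L \<subseteq> Lam L"
  by (auto simp: Lam_def)

lemma Lam_bdry_eq: "L \<ge> 1 \<Longrightarrow> Lam_bdry L = Lam L - hexagon L"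
  using Lam_minus_eq_hexagon[of L] by (auto simp: Lam_minus_def Lam_bdry_def)

lemma nn_irrefl: "\<not> nn x x"
  by (cases x) (auto simp: nn_iff)

lemma card_nn: "card {y. nn y x} = 3"
proof (cases x)
  case (Up i j)
  have "{y. nn y x} = {Down i j, Down (i - 1) j, Down i (j - 1)}" by (simp only: Up nn_iff' Collect_mem_eq)
  then show ?thesis by simp
next
  case (Down i j)
  have "{y. nn y x} = {Up i j, Up (i + 1) j, Up i (j + 1)}" by (simp only: Down nn_iff' Collect_mem_eq)
  then show ?thesis by simp
qed

lemma nn_hexagon_Lam: "x \<in> hexagon L \<Longrightarrow> nn y x \<Longrightarrow> y \<in> Lam L"
  using nn_sym by (auto simp: Lam_iff)

lemma cfg_configs: "cfg L S \<in> configs L"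
  by (auto simp: cfg_def configs_def)

lemma configs_eq_cfg:
  assumes "\<eta> \<in> configs L" shows "\<eta> = cfg L {x \<in> Lam L. \<eta> x = 1}"
proof
  fix x show "\<eta> x = cfg L {x \<in> Lam L. \<eta> x = 1} x"
    using assms by (cases "x \<in> Lam L") (auto simp: configs_def cfg_def PiE_iff extensional_def)
qed

lemma finite_inner_pairs: "finite (inner_pairs L)"
proof -
  have "inner_pairs L \<subseteq> Pow (Lam L)" by (auto simp: inner_pairs_def Lam_minus_def)
  then show ?thesis by (rule finite_subset) (simp add: finite_Lam)
qed

lemma energy_cfg:
  assumes "S \<subseteq> Lam L"
  shows "energy L U \<Delta> (cfg L S) = \<Delta> * card S - U * card {e \<in> inner_pairs L. e \<subseteq> S}"
proof -
  have "(\<Sum>x\<in>Lam L. real (cfg L S x)) = (\<Sum>x\<in>Lam L. if x \<in> S then 1 else 0)"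
    by (rule sum.cong) (auto simp: cfg_def)
  also have "\<dots> = card S"
    using assms by (simp add: finite_Lam sum.If_cases Int_absorb1)
  finally have 1: "(\<Sum>x\<in>Lam L. real (cfg L S x)) = card S" .
  have "(\<Prod>z\<in>e. real (cfg L S z)) = (if e \<subseteq> S then 1 else 0)" if "e \<in> inner_pairs L" for e
  proof -
    have e: "e \<subseteq> Lam L" "finite e"
      using that by (auto simp: inner_pairs_def Lam_minus_def)
    show ?thesis
    proof (cases "e \<subseteq> S")
      case True
      then show ?thesis using e by (auto simp: cfg_def intro!: prod.neutral)
    next
      case False
      then obtain z where "z \<in> e" "z \<notin> S" by auto
      then show ?thesis using e by (auto simp: cfg_def)
    qed
  qed
  then have "(\<Sum>e\<in>inner_pairs L. \<Prod>z\<in>e. real (cfg L S z)) = (\<Sum>e\<in>inner_pairs L. if e \<subseteq> S then 1 else 0)"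
    by (rule sum.cong[OF refl])
  also have "\<dots> = card {e \<in> inner_pairs L. e \<subseteq> S}"
    using finite_inner_pairs[of L] by (simp add: sum.If_cases Int_def)
  finally show ?thesis using 1 by (simp add: energy_def)
qed

text \<open>An exchange is its own inverse. Creation and annihilation are undone along the reversed
  bond, unless the move changed nothing; then the same bond fixes the configuration again.\<close>

lemma bond_move_reversible:
  assumes "\<eta> \<in> configs L" "b \<in> oriented_bonds L" "L \<ge> 1"
  shows "\<exists>b'\<in>oriented_bonds L. \<eta> = bond_move L b' (bond_move L b \<eta>)"
proof -
  obtain x y where b: "b = (x, y)" by (cases b)
  have nxy: "nn x y" and xy: "x \<noteq> y"
    using assms(2) nn_irrefl by (auto simp: b oriented_bonds_def)
  have sub: "Lam_bdry L \<subseteq> Lam L" by (auto simp: Lam_bdry_def)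
  have bin: "\<eta> z = 0 \<or> \<eta> z = 1" if "z \<in> Lam L" for z
    using assms(1) that by (auto simp: configs_def)
  consider "x \<in> Lam L" "y \<in> Lam L" | "x \<in> Lam_bdry L" "y \<notin> Lam L" | "x \<notin> Lam L" "y \<in> Lam_bdry L"
    using assms(2) by (auto simp: b oriented_bonds_def)
  then show ?thesis
  proof cases
    case 1
    then have "\<eta> = bond_move L b (bond_move L b \<eta>)"
      using xy by (auto simp: b fun_eq_iff)
    then show ?thesis using assms(2) by blast
  next
    case 2
    have "(y, x) \<in> oriented_bonds L" using 2 nxy nn_sym by (auto simp: oriented_bonds_def)
    moreover have "\<eta> = bond_move L (y, x) (bond_move L b \<eta>)" if "\<eta> x = 1"
      using 2 xy sub that by (auto simp: b fun_eq_iff)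
    moreover have "\<eta> = bond_move L b (bond_move L b \<eta>)" if "\<eta> x = 0"
      using 2 xy sub that by (auto simp: b fun_eq_iff)
    ultimately show ?thesis using bin[of x] 2 sub assms(2) by (metis subsetD)
  next
    case 3
    have "(y, x) \<in> oriented_bonds L" using 3 nxy nn_sym by (auto simp: oriented_bonds_def)
    moreover have "\<eta> = bond_move L (y, x) (bond_move L b \<eta>)" if "\<eta> y = 0"
      using 3 xy sub that by (auto simp: b fun_eq_iff)
    moreover have "\<eta> = bond_move L b (bond_move L b \<eta>)" if "\<eta> y = 1"
      using 3 xy sub that by (auto simp: b fun_eq_iff)
    ultimately show ?thesis using bin[of y] 3 sub assms(2) by (metis subsetD)
  qed
qed

lemma sym_moves_below: "L \<ge> 1 \<Longrightarrow> sym (moves_below L U \<Delta> h)"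
  using bond_move_reversible by (auto simp: sym_def moves_below_def)

text \<open>A vacant site is accessible if a free particle can travel between it and the outside
  through vacant sites.\<close>

inductive acc :: "nat \<Rightarrow> site set \<Rightarrow> site \<Rightarrow> bool" for L :: nat and S :: "site set" where
  boundary: "x \<in> Lam_bdry L \<Longrightarrow> x \<notin> S \<Longrightarrow> acc L S x"
| step: "x \<in> Lam L \<Longrightarrow> x \<notin> S \<Longrightarrow> nn x y \<Longrightarrow> acc L S y \<Longrightarrow> acc L S x"

lemma acc_not_mem: "acc L S x \<Longrightarrow> x \<notin> S"
  by (cases rule: acc.cases) auto

lemma acc_Lam: "acc L S x \<Longrightarrow> x \<in> Lam L"
  by (cases rule: acc.cases) (auto simp: Lam_bdry_def)

lemma acc_antimono: "acc L S x \<Longrightarrow> T \<subseteq> S \<Longrightarrow> acc L T x"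
  by (induction rule: acc.induct) (auto intro: acc.intros)

lemma acc_neighbour:
  assumes "nn x z" "acc L S z" "x \<notin> S" "x \<in> hexagon L"
  shows "acc L S x"
  using assms hexagon_subset_Lam by (blast intro: acc.step)

text \<open>Two adjacent vacant sites cannot block each other: one of them has an exit route that
  avoids the other. This provides an order in which both can be filled.\<close>

lemma acc_two:
  assumes "acc L S a" "acc L S b" "nn a b"
  shows "acc L (insert a S) b \<or> acc L (insert b S) a"
proof (rule ccontr)
  assume no: "\<not> ?thesis"
  have ab: "a \<notin> S" "b \<notin> S" "a \<in> Lam L" "b \<in> Lam L" "a \<noteq> b"
    using assms acc_not_mem acc_Lam nn_irrefl by blast+
  \<comment> \<open>If both orders failed, no exit route could contain \<open>a\<close> or
    \<open>b\<close>, so every accessible site would stay accessible with both filled, including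
    \<open>a\<close> itself.\<close>
  have "acc L (insert a (insert b S)) x" if "acc L S x" for x
    using that
  proof (induction rule: acc.induct)
    case (boundary x)
    then show ?case using no ab by (auto intro: acc.boundary)
  next
    case (step x y)
    have "acc L (insert a S) y" "acc L (insert b S) y"
      using step.IH by (auto elim: acc_antimono)
    then show ?case using no ab step by (auto intro: acc.step)
  qed
  from this[OF assms(1)] show False by (auto dest: acc_not_mem)
qed

section \<open>Climbs below a given height and local reductions\<close>

locale kawasaki_model =
  fixes L :: nat and U \<Delta> :: real
  assumes L_ge_1: "L \<ge> 1" and U_pos: "U > 0" and \<Delta>_gt: "U < \<Delta>" and \<Delta>_less: "2 * \<Delta> < 3 * U"
begin

definition H :: "site set \<Rightarrow> real" where "H S = energy L U \<Delta> (cfg L S)"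

definition climb :: "real \<Rightarrow> site set \<Rightarrow> site set \<Rightarrow> bool" where
  "climb h S T \<longleftrightarrow> (cfg L S, cfg L T) \<in> (moves_below L U \<Delta> h)\<^sup>*"

definition reducible :: "site set \<Rightarrow> bool" where
  "reducible S \<longleftrightarrow> (\<exists>T \<subseteq> Lam L. H T < H S \<and> climb (H S + \<Delta> + U) S T)"

lemma climb_refl [simp]: "climb h S S"
  by (simp add: climb_def)

lemma climb_sym: "climb h S T \<Longrightarrow> climb h T S"
  unfolding climb_def using sym_rtrancl[OF sym_moves_below[OF L_ge_1]] by (rule symD)

lemma climb_trans [trans]: "climb h S T \<Longrightarrow> climb h T R \<Longrightarrow> climb h S R"
  unfolding climb_def by (rule rtrancl_trans)

lemma moves_below_mono: "h \<le> h' \<Longrightarrow> moves_below L U \<Delta> h \<subseteq> moves_below L U \<Delta> h'"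
  by (auto simp: moves_below_def)

lemma climb_mono: "climb h S T \<Longrightarrow> h \<le> h' \<Longrightarrow> climb h' S T"
  unfolding climb_def using rtrancl_mono[OF moves_below_mono] by blast

lemma climb_move:
  assumes "b \<in> oriented_bonds L" "cfg L T = bond_move L b (cfg L S)" "H S \<le> h" "H T \<le> h"
  shows "climb h S T"
proof -
  have "(cfg L S, cfg L T) \<in> moves_below L U \<Delta> h"
    using assms unfolding moves_below_def H_def by (blast intro: cfg_configs)
  then show ?thesis unfolding climb_def by blast
qed

lemma climb_move_inner:
  assumes "x \<in> Lam L" "y \<in> Lam L" "nn x y" "x \<notin> S" "y \<notin> S" "H (insert x S) \<le> h" "H (insert y S) \<le> h"
  shows "climb h (insert x S) (insert y S)"
proof (rule climb_move)
  show "(x, y) \<in> oriented_bonds L" using assms by (auto simp: oriented_bonds_def)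
  show "cfg L (insert y S) = bond_move L (x, y) (cfg L (insert x S))"
    using assms nn_irrefl by (auto simp: cfg_def fun_eq_iff)
qed (use assms in auto)

lemma climb_boundary:
  assumes "x \<in> Lam_bdry L" "x \<notin> S" "H (insert x S) \<le> h" "H S \<le> h"
  shows "climb h (insert x S) S"
proof -
  obtain y where y: "y \<notin> Lam L" "nn y x" and x: "x \<in> Lam L" using assms by (auto simp: Lam_bdry_def)
  show ?thesis
  proof (rule climb_move)
    show "(x, y) \<in> oriented_bonds L" using assms y nn_sym by (auto simp: oriented_bonds_def)
    show "cfg L S = bond_move L (x, y) (cfg L (insert x S))"
      using assms y x by (auto simp: cfg_def fun_eq_iff)
  qed (use assms in auto)
qed

lemma finite_sub: "S \<subseteq> Lam L \<Longrightarrow> finite S"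
  using finite_subset finite_Lam by blast

lemma H_insert_hexagon:
  assumes "S \<subseteq> hexagon L" "x \<in> hexagon L" "x \<notin> S"
  shows "H (insert x S) = H S + \<Delta> - U * deg S x"
proof -
  have S: "S \<subseteq> Lam L" "x \<in> Lam L" "finite S"
    using assms hexagon_subset_Lam finite_sub by blast+
  let ?E = "\<lambda>S. {e \<in> inner_pairs L. e \<subseteq> S}"
  have "?E (insert x S) = ?E S \<union> (\<lambda>y. {x, y}) ` {y \<in> S. nn y x}"
  proof (intro equalityI subsetI)
    fix e assume e: "e \<in> ?E (insert x S)"
    then obtain a b where "e = {a, b}" "nn a b" by (auto simp: inner_pairs_def)
    then show "e \<in> ?E S \<union> (\<lambda>y. {x, y}) ` {y \<in> S. nn y x}"
      using e nn_sym[of a b] nn_irrefl[of a] by (cases "a = x"; cases "b = x"; auto)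
  next
    fix e assume "e \<in> ?E S \<union> (\<lambda>y. {x, y}) ` {y \<in> S. nn y x}"
    then show "e \<in> ?E (insert x S)"
    proof
      assume "e \<in> (\<lambda>y. {x, y}) ` {y \<in> S. nn y x}"
      then obtain y where y: "y \<in> S" "nn y x" "e = {x, y}" by auto
      then have "e \<in> inner_pairs L"
        using assms nn_sym[of x y] unfolding inner_pairs_def Lam_minus_eq_hexagon[OF L_ge_1] by blast
      then show ?thesis using y by auto
    qed auto
  qed
  moreover have "?E S \<inter> (\<lambda>y. {x, y}) ` {y \<in> S. nn y x} = {}" using assms by auto
  moreover have "card ((\<lambda>y. {x, y}) ` {y \<in> S. nn y x}) = deg S x"
    unfolding deg_def by (rule card_image) (auto simp: inj_on_def doubleton_eq_iff)
  ultimately have "card (?E (insert x S)) = card (?E S) + deg S x"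
    using finite_inner_pairs[of L] S by (simp add: card_Un_disjoint)
  then show ?thesis using S assms by (simp add: H_def energy_cfg algebra_simps)
qed

lemma H_insert_boundary:
  assumes "S \<subseteq> Lam L" "x \<in> Lam_bdry L" "x \<notin> S"
  shows "H (insert x S) = H S + \<Delta>"
proof -
  have x: "x \<in> Lam L" "x \<notin> Lam_minus L" and S: "finite S"
    using assms finite_sub by (auto simp: Lam_bdry_def Lam_minus_def)
  have "{e \<in> inner_pairs L. e \<subseteq> insert x S} = {e \<in> inner_pairs L. e \<subseteq> S}"
    using x by (auto simp: inner_pairs_def)
  then show ?thesis using S x assms by (simp add: H_def energy_cfg algebra_simps)
qed

lemma H_insert_le:
  assumes "S \<subseteq> hexagon L" "x \<in> Lam L" "x \<notin> S"
  shows "H (insert x S) \<le> H S + \<Delta>"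
proof (cases "x \<in> hexagon L")
  case True
  then show ?thesis using assms H_insert_hexagon[of S x] U_pos by auto
next
  case False
  then have "x \<in> Lam_bdry L" "S \<subseteq> Lam L"
    using assms hexagon_subset_Lam[of L] Lam_bdry_eq[OF L_ge_1] by auto
  then show ?thesis using H_insert_boundary[of S x] assms by simp
qed

text \<open>One extra particle costs at most \<Delta> wherever it stands, since contacts with the
  cluster only lower the energy. It can follow the route that witnesses accessibility and leave
  through the boundary layer.\<close>

lemma climb_acc:
  assumes "acc L S x" "S \<subseteq> hexagon L"
  shows "climb (H S + \<Delta>) (insert x S) S"
  using assms
proof (induction rule: acc.induct)
  case (boundary x)
  then have x: "x \<in> Lam L" by (auto simp: Lam_bdry_def)
  show ?case using boundary H_insert_le[OF boundary(3) x boundary(2)] U_pos \<Delta>_gt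
    by (intro climb_boundary) auto
next
  case (step x y)
  have y: "y \<in> Lam L" "y \<notin> S" using step acc_Lam acc_not_mem by auto
  have "climb (H S + \<Delta>) (insert x S) (insert y S)"
    using step y by (intro climb_move_inner H_insert_le) auto
  also have "climb (H S + \<Delta>) (insert y S) S" by (rule step.IH[OF step.prems])
  finally show ?case .
qed

lemma climb_fill:
  assumes "acc L S x" "S \<subseteq> hexagon L" shows "climb (H S + \<Delta>) S (insert x S)"
  using climb_acc[OF assms] by (rule climb_sym)

text \<open>The free particle has height H (S - {x}) + \<Delta>, and seen from \<open>S\<close> this
  is just the price of the broken bonds.\<close>

lemma climb_remove:
  assumes "acc L (S - {x}) x" "S \<subseteq> hexagon L" "x \<in> S"
  shows "climb (H S + U * deg (S - {x}) x) S (S - {x})"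
proof -
  have sub: "S - {x} \<subseteq> hexagon L" "x \<in> hexagon L" using assms by auto
  then have "H S = H (S - {x}) + \<Delta> - U * deg (S - {x}) x"
    using H_insert_hexagon[of "S - {x}" x] assms by (simp add: insert_absorb)
  then show ?thesis using climb_acc[OF assms(1) sub(1)] assms by (simp add: insert_absorb)
qed

lemma H_remove:
  assumes "S \<subseteq> hexagon L" "x \<in> S"
  shows "H (S - {x}) = H S - \<Delta> + U * deg (S - {x}) x"
proof -
  have "S - {x} \<subseteq> hexagon L" "x \<in> hexagon L" using assms by auto
  then show ?thesis using H_insert_hexagon[of "S - {x}" x] assms by (simp add: insert_absorb)
qed

lemma finite_deg: "finite {y \<in> S. nn y x}"
  using finite_nn[of x] by (rule rev_finite_subset) auto

lemma deg_le_3: "deg S x \<le> 3"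
  unfolding deg_def card_nn[of x, symmetric] by (rule card_mono[OF finite_nn]) auto

lemma deg_ge_1: "y \<in> S \<Longrightarrow> nn y x \<Longrightarrow> deg S x \<ge> 1"
  unfolding deg_def using finite_deg[of S x] by (metis (mono_tags, lifting) One_nat_def Suc_leI card_gt_0_iff empty_Collect_eq)

lemma deg_ge_2:
  assumes "y \<in> S" "nn y x" "z \<in> S" "nn z x" "y \<noteq> z" shows "deg S x \<ge> 2"
proof -
  have "card {y, z} \<le> deg S x"
    unfolding deg_def by (rule card_mono[OF finite_deg]) (use assms in auto)
  then show ?thesis using assms by auto
qed

lemma deg_le_2:
  assumes "y \<notin> S" "nn y x" shows "deg S x \<le> 2"
proof -
  have "deg S x \<le> card ({y. nn y x} - {y})"
    unfolding deg_def by (rule card_mono) (use assms finite_nn in auto)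
  then show ?thesis using assms card_nn[of x] finite_nn[of x] by simp
qed

lemma deg_le_1:
  assumes "y \<notin> S" "nn y x" "z \<notin> S" "nn z x" "y \<noteq> z" shows "deg S x \<le> 1"
proof -
  have "deg S x \<le> card ({y. nn y x} - {y, z})"
    unfolding deg_def by (rule card_mono) (use assms finite_nn in auto)
  also have "\<dots> = 1" using assms card_nn[of x] finite_nn[of x] by (subst card_Diff_subset) auto
  finally show ?thesis .
qed

lemma U_mult_mono: "m \<le> n \<Longrightarrow> U * real m \<le> U * real n"
  using U_pos by simp

lemma H_insert_deg_ge:
  assumes "S \<subseteq> hexagon L" "x \<in> hexagon L" "x \<notin> S" "deg S x \<ge> n"
  shows "H (insert x S) \<le> H S + \<Delta> - U * real n"
  using H_insert_hexagon[OF assms(1-3)] U_mult_mono[OF assms(4)] by simp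

lemma reducible_boundary_particle:
  assumes "S \<subseteq> Lam L" "x \<in> S" "x \<in> Lam_bdry L"
  shows "reducible S"
proof -
  have "H S = H (S - {x}) + \<Delta>"
    using H_insert_boundary[of "S - {x}" x] assms by (auto simp: insert_absorb)
  moreover from this have "climb (H S + \<Delta> + U) (insert x (S - {x})) (S - {x})"
    using assms U_pos \<Delta>_gt by (intro climb_boundary) (auto simp: insert_absorb)
  ultimately show ?thesis unfolding reducible_def
    using assms U_pos \<Delta>_gt by (intro exI[of _ "S - {x}"]) (auto simp: insert_absorb)
qed

lemma reducible_fill:
  assumes "S \<subseteq> hexagon L" "acc L S x" "x \<in> hexagon L" "deg S x \<ge> 2"
  shows "reducible S"
proof -
  have "H (insert x S) \<le> H S + \<Delta> - U * 2"
    using H_insert_deg_ge[OF assms(1,3) _ assms(4)] acc_not_mem[OF assms(2)] by simp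
  moreover have "climb (H S + \<Delta> + U) S (insert x S)"
    using climb_fill[OF assms(2,1)] by (rule climb_mono) (use U_pos in simp)
  ultimately show ?thesis unfolding reducible_def
    using assms U_pos \<Delta>_less hexagon_subset_Lam[of L] by (intro exI[of _ "insert x S"]) auto
qed

lemma reducible_remove:
  assumes "S \<subseteq> hexagon L" "acc L S z" "nn x z" "x \<in> S" "deg S x \<le> 1"
  shows "reducible S"
proof -
  have acc: "acc L (S - {x}) x"
    using assms acc_antimono[OF assms(2), of "S - {x}"] by (intro acc_neighbour[of x z]) auto
  have "deg (S - {x}) x \<le> deg S x"
    unfolding deg_def by (rule card_mono[OF finite_deg]) auto
  then have d: "U * deg (S - {x}) x \<le> U * real 1" using assms(5) by (intro U_mult_mono) simp
  have "climb (H S + \<Delta> + U) S (S - {x})"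
    using climb_remove[OF acc assms(1,4)] by (rule climb_mono) (use d U_pos \<Delta>_gt in linarith)
  moreover have "H (S - {x}) < H S" using H_remove[OF assms(1,4)] d \<Delta>_gt by simp
  ultimately show ?thesis unfolding reducible_def
    using assms hexagon_subset_Lam[of L] by (intro exI[of _ "S - {x}"]) auto
qed

text \<open>Two adjacent sites that each touch the cluster: the second one then has two occupied
  neighbours, and the pair gains \<open>3 U - 2 \<Delta>\<close>.\<close>

lemma reducible_pair:
  assumes S: "S \<subseteq> hexagon L" and hex: "a \<in> hexagon L" "b \<in> hexagon L" and "nn a b"
    and acc: "acc L S a" "acc L S b" and deg: "deg S a \<ge> 1" "deg S b \<ge> 1"
  shows "reducible S"
proof -
  have *: "reducible S"
    if hex: "a \<in> hexagon L" "b \<in> hexagon L" and "nn a b" and acc: "acc L S a" "acc L S b"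
     and deg: "deg S a \<ge> 1" "deg S b \<ge> 1" and acc': "acc L (insert a S) b" for a b
  proof -
    have n: "a \<notin> S" "b \<notin> S" "a \<noteq> b" using acc acc_not_mem \<open>nn a b\<close> nn_irrefl by blast+
    have "{y \<in> insert a S. nn y b} = insert a {y \<in> S. nn y b}" using \<open>nn a b\<close> by auto
    then have deg': "deg (insert a S) b \<ge> 2" using deg n finite_deg[of S b] by (simp add: deg_def)
    have h1: "H (insert a S) \<le> H S + \<Delta> - U" using H_insert_deg_ge[OF S hex(1) n(1) deg(1)] by simp
    have h2: "H (insert b (insert a S)) \<le> H (insert a S) + \<Delta> - U * 2"
      using H_insert_deg_ge[OF _ hex(2) _ deg'] n S hex by simp
    have "climb (H S + \<Delta> + U) S (insert a S)"
      using climb_fill[OF acc(1) S] by (rule climb_mono) (use U_pos in simp)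
    also have "climb (H S + \<Delta> + U) (insert a S) (insert b (insert a S))"
      by (rule climb_mono[OF climb_fill[OF acc']]) (use S hex h1 \<Delta>_less U_pos in auto)
    finally show ?thesis unfolding reducible_def
      using h1 h2 S hex \<Delta>_less hexagon_subset_Lam[of L] by (intro exI[of _ "insert b (insert a S)"]) auto
  qed
  \<comment> \<open>\<open>acc_two\<close> decides which of the two sites is filled before the
    other.\<close>
  show ?thesis using acc_two[OF acc \<open>nn a b\<close>] *[of a b] *[of b a] assms nn_sym[of a b] by blast
qed

section \<open>Filling and removing whole strips\<close>

text \<open>Odd sites are only known to touch the strip, even sites touch \<open>S\<close> as well.
  The first particle costs \<Delta> - U and each further pair at most (\<Delta> - U) + (\<Delta> - 2
  U) = - \<kappa>. Filling runs from \<open>y 0\<close> to \<open>y (2 * N)\<close>, so the unfilled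
  part of the strip is the corridor for the next particle.\<close>

lemma grow_chain:
  fixes y :: "nat \<Rightarrow> site"
  assumes S: "S \<subseteq> hexagon L" and inj: "inj_on y {..2 * N}"
    and y: "\<And>t. t \<le> 2 * N \<Longrightarrow> y t \<in> hexagon L" "\<And>t. t \<le> 2 * N \<Longrightarrow> y t \<notin> S"
    and consecutive: "\<And>t. t < 2 * N \<Longrightarrow> nn (y t) (y (Suc t))"
    and attached: "\<And>k. k \<le> N \<Longrightarrow> \<exists>z\<in>S. nn z (y (2 * k))"
    and exit: "nn (y (2 * N)) z" "acc L (S \<union> y ` {..2 * N}) z"
  shows "climb (H S + 3 * \<Delta> - 2 * U) S (S \<union> y ` {..2 * N})"
    and "H (S \<union> y ` {..2 * N}) \<le> H S + (\<Delta> - U) - N * (3 * U - 2 * \<Delta>)"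
proof -
  define W where "W t = S \<union> y ` {..<t}" for t
  have W_Suc: "W (Suc t) = insert (y t) (W t)" for t
    by (auto simp: W_def lessThan_Suc)
  have W_hex: "W t \<subseteq> hexagon L" if "t \<le> Suc (2 * N)" for t
    using that S y by (auto simp: W_def)
  have y_W: "y t \<notin> W t" if "t \<le> 2 * N" for t
  proof
    assume "y t \<in> W t"
    then obtain s where s: "s < t" "y t = y s" using y(2)[OF \<open>t \<le> 2 * N\<close>] unfolding W_def by blast
    then show False using inj_onD[OF inj s(2)] that by simp
  qed
  \<comment> \<open>Backwards along the strip: access enters at the last site through
    \<open>z\<close> and is handed on to each preceding site.\<close>
  have acc: "acc L (W (2 * N - t)) (y (2 * N - t))" if "t \<le> 2 * N" for t
    using that
  proof (induction t)
    case 0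
    have "acc L (W (2 * N)) z" using exit(2) by (rule acc_antimono) (auto simp: W_def)
    then show ?case using acc_neighbour[OF exit(1), where S = "W (2 * N)"] y(1)[of "2 * N"] y_W[of "2 * N"] by simp
  next
    case (Suc t)
    define s where "s = 2 * N - Suc t"
    have s: "2 * N - t = Suc s" "s < 2 * N" using Suc.prems by (auto simp: s_def)
    have "acc L (W (Suc s)) (y (Suc s))" using Suc s by simp
    then have "acc L (W s) (y (Suc s))" by (rule acc_antimono) (auto simp: W_Suc)
    then show ?case unfolding s_def[symmetric]
      using acc_neighbour[OF consecutive[OF s(2)], where S = "W s"] y(1)[of s] y_W[of s] s(2) by simp
  qed
  have acc: "acc L (W t) (y t)" if "t \<le> 2 * N" for t
    using acc[of "2 * N - t"] that by simp
  have deg1: "deg (W t) (y t) \<ge> 1" if "t \<le> 2 * N" for t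
  proof (cases t)
    case 0
    obtain z where "z \<in> S" "nn z (y 0)" using attached[of 0] by auto
    then show ?thesis unfolding 0 by (intro deg_ge_1[of z]) (auto simp: W_def)
  next
    case (Suc s)
    then have "y s \<in> W t" "nn (y s) (y t)" using consecutive[of s] that by (auto simp: W_def)
    then show ?thesis by (rule deg_ge_1)
  qed
  have deg2: "deg (W (2 * k)) (y (2 * k)) \<ge> 2" if k: "0 < k" "k \<le> N" for k
  proof -
    obtain z where z: "z \<in> S" "nn z (y (2 * k))" using attached[OF k(2)] by blast
    obtain s where s: "2 * k = Suc s" using not0_implies_Suc[of "2 * k"] k(1) by auto
    have sN: "s < 2 * N" using s k by linarith
    have "z \<noteq> y s" using z(1) y(2)[of s] sN by auto
    moreover have "z \<in> W (Suc s)" "y s \<in> W (Suc s)" using z(1) by (auto simp: W_def)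
    ultimately show ?thesis
      using deg_ge_2 z(2) consecutive[OF sN] unfolding s by blast
  qed
  \<comment> \<open>\<Delta> - U for the first site, another \<Delta> - U for an odd site, and
    \<Delta> for the free particle that completes the pair.\<close>
  let ?h = "H S + 3 * \<Delta> - 2 * U"
  have "climb ?h S (W (Suc (2 * k))) \<and> H (W (Suc (2 * k))) \<le> H S + (\<Delta> - U) - k * (3 * U - 2 * \<Delta>)"
    if "k \<le> N" for k
    using that
  proof (induction k)
    case 0
    have W0: "W 0 = S" by (simp add: W_def)
    have "H (W 1) \<le> H S + \<Delta> - U * real 1"
      using H_insert_deg_ge[OF S y(1) y(2), of 0 1] deg1[of 0] W_Suc[of 0] W0 by simp
    moreover have "climb ?h S (W 1)"
      using climb_mono[OF climb_fill[OF acc[of 0] W_hex], of ?h] W_Suc[of 0] W0 U_pos \<Delta>_gt by simp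
    ultimately show ?case by simp
  next
    case (Suc k)
    define t where "t = Suc (2 * k)"
    have t: "t \<le> 2 * N" "Suc t \<le> 2 * N" "Suc t = 2 * Suc k" using Suc.prems by (auto simp: t_def)
    have IH: "climb ?h S (W t)" "H (W t) \<le> H S + (\<Delta> - U) - k * (3 * U - 2 * \<Delta>)"
      using Suc by (auto simp: t_def)
    have pos: "0 \<le> k * (3 * U - 2 * \<Delta>)" using \<Delta>_less by simp
    have H1: "H (W (Suc t)) \<le> H (W t) + \<Delta> - U"
      unfolding W_Suc using H_insert_deg_ge[OF W_hex y(1) y_W deg1] t by simp
    have H2: "H (W (Suc (Suc t))) \<le> H (W (Suc t)) + \<Delta> - U * real 2"
      unfolding W_Suc[of "Suc t"]
      using H_insert_deg_ge[OF W_hex y(1) y_W, of "Suc t" 2] deg2[of "Suc k"] Suc.prems t(3) by simp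
    have "climb ?h (W t) (W (Suc t))"
      unfolding W_Suc using t IH(2) pos
      by (intro climb_mono[OF climb_fill[OF acc W_hex]]) (use \<Delta>_gt in auto)
    moreover have "climb ?h (W (Suc t)) (W (Suc (Suc t)))"
      unfolding W_Suc[of "Suc t"] using t IH(2) H1 pos
      by (intro climb_mono[OF climb_fill[OF acc W_hex]]) auto
    ultimately have "climb ?h S (W (Suc (Suc t)))" by (rule climb_trans[OF climb_trans[OF IH(1)]])
    moreover have "H (W (Suc (Suc t))) \<le> H S + (\<Delta> - U) - Suc k * (3 * U - 2 * \<Delta>)"
      using H1 H2 IH(2) by (simp add: algebra_simps)
    ultimately show ?case using t(3) by simp
  qed
  from this[of N] show "climb ?h S (S \<union> y ` {..2 * N})"
    "H (S \<union> y ` {..2 * N}) \<le> H S + (\<Delta> - U) - N * (3 * U - 2 * \<Delta>)"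
    by (auto simp: W_def lessThan_Suc_atMost)
qed

text \<open>Each removal opens the way to the next site. An even site then has at most two bonds
  left and an odd site one, so a pair costs at most (2 U - \<Delta>) + (U - \<Delta>) = \<kappa>.
  The final even site is open at its far end as well and leaves with a gain of at least \<Delta> -
  U.\<close>

lemma shrink_chain:
  fixes y :: "nat \<Rightarrow> site"
  assumes S: "S \<subseteq> hexagon L" and inj: "inj_on y {..2 * N}" and N: "N \<ge> 1"
    and y: "\<And>t. t \<le> 2 * N \<Longrightarrow> y t \<in> S"
    and consecutive: "\<And>t. t < 2 * N \<Longrightarrow> nn (y t) (y (Suc t))"
    and exposed: "\<And>t. t \<le> 2 * N \<Longrightarrow> t = 0 \<or> odd t \<or> t = 2 * N \<Longrightarrow> \<exists>z. z \<notin> S \<and> nn z (y t)"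
    and exit: "nn (y 0) z" "acc L S z"
  shows "climb (H S + N * (3 * U - 2 * \<Delta>) + 2 * \<Delta> - U) S (S - y ` {..2 * N})"
    and "H (S - y ` {..2 * N}) \<le> H S + N * (3 * U - 2 * \<Delta>) - (\<Delta> - U)"
proof -
  define W where "W t = S - y ` {..<t}" for t
  have W_Suc: "W (Suc t) = W t - {y t}" for t
    by (auto simp: W_def lessThan_Suc)
  have W_hex: "W t \<subseteq> hexagon L" for t
    using S by (auto simp: W_def)
  have y_W: "y t \<in> W t" if "t \<le> 2 * N" for t
  proof (rule ccontr)
    assume "y t \<notin> W t"
    then obtain s where s: "s < t" "y t = y s" using y[OF \<open>t \<le> 2 * N\<close>] unfolding W_def by blast
    then show False using inj_onD[OF inj s(2)] that by simp
  qed
  have acc: "acc L (W t - {y t}) (y t)" if "t \<le> 2 * N" for t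
    using that
  proof (induction t)
    case 0
    have "acc L (W 0 - {y 0}) z" using exit(2) by (rule acc_antimono) (auto simp: W_def)
    then show ?case using y[of 0] S by (intro acc_neighbour[OF exit(1)]) auto
  next
    case (Suc t)
    have n: "nn (y (Suc t)) (y t)" using consecutive[of t] nn_sym[of "y t"] Suc.prems by auto
    have "acc L (W t - {y t}) (y t)" using Suc by simp
    then have "acc L (W (Suc t) - {y (Suc t)}) (y t)" by (rule acc_antimono) (auto simp: W_Suc)
    then show ?case using y[OF Suc.prems] S by (intro acc_neighbour[OF n]) auto
  qed
  have deg2: "deg (W (Suc t)) (y t) \<le> 2" if "t \<le> 2 * N" for t
  proof (cases t)
    case 0
    obtain z where "z \<notin> S" "nn z (y 0)" using exposed[of 0] by auto
    then show ?thesis unfolding 0 by (intro deg_le_2[of z]) (auto simp: W_def)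
  next
    case (Suc s)
    then have "y s \<notin> W (Suc t)" "nn (y s) (y t)" using consecutive[of s] that by (auto simp: W_def)
    then show ?thesis by (rule deg_le_2)
  qed
  have deg1: "deg (W (Suc t)) (y t) \<le> 1" if t: "t \<le> 2 * N" "odd t \<or> t = 2 * N" for t
  proof -
    obtain z where z: "z \<notin> S" "nn z (y t)" using exposed[OF t(1)] t(2) by blast
    \<comment> \<open>\<open>N \<ge> 1\<close> guarantees a predecessor, which has just been
      removed; with the vacant \<open>z\<close> this leaves at most one bond.\<close>
    have "t \<noteq> 0" using t(2) N by (auto elim: oddE)
    then obtain s where s: "t = Suc s" using not0_implies_Suc by blast
    have sN: "s < 2 * N" "s \<le> 2 * N" using s t(1) by linarith+
    have "z \<noteq> y s" using z(1) y[OF sN(2)] by auto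
    moreover have "z \<notin> W (Suc t)" "y s \<notin> W (Suc t)" using z(1) s by (auto simp: W_def)
    ultimately show ?thesis
      using deg_le_1 z(2) consecutive[OF sN(1)] unfolding s by blast
  qed
  \<comment> \<open>This is H S + (N - 1) \<kappa> + 2 U, the height at which the last pair is
    opened by breaking two bonds.\<close>
  let ?h = "H S + N * (3 * U - 2 * \<Delta>) + 2 * \<Delta> - U"
  have rem: "climb ?h (W t) (W (Suc t))" "H (W (Suc t)) \<le> H (W t) - \<Delta> + U * real d"
    if "t \<le> 2 * N" "deg (W (Suc t)) (y t) \<le> d" "H (W t) + U * real d \<le> ?h" for t d
  proof -
    have d: "U * deg (W (Suc t)) (y t) \<le> U * real d" by (rule U_mult_mono[OF that(2)])
    show "climb ?h (W t) (W (Suc t))"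
      using climb_mono[OF climb_remove[OF acc[OF that(1)] W_hex y_W[OF that(1)]], of ?h] d that(3)
      by (simp add: W_Suc)
    show "H (W (Suc t)) \<le> H (W t) - \<Delta> + U * real d"
      using H_remove[OF W_hex y_W[OF that(1)]] d by (simp add: W_Suc)
  qed
  have "climb ?h S (W (2 * k)) \<and> H (W (2 * k)) \<le> H S + k * (3 * U - 2 * \<Delta>)" if "k \<le> N" for k
    using that
  proof (induction k)
    case 0
    show ?case by (simp add: W_def)
  next
    case (Suc k)
    have IH: "climb ?h S (W (2 * k))" "H (W (2 * k)) \<le> H S + k * (3 * U - 2 * \<Delta>)"
      using Suc by auto
    have "Suc k * (3 * U - 2 * \<Delta>) \<le> N * (3 * U - 2 * \<Delta>)"
      using Suc.prems \<Delta>_less by (intro mult_right_mono) auto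
    then have kN: "k * (3 * U - 2 * \<Delta>) + (3 * U - 2 * \<Delta>) \<le> N * (3 * U - 2 * \<Delta>)"
      by (simp add: algebra_simps)
    have h1: "H (W (2 * k)) + U * real 2 \<le> ?h" using IH(2) kN by simp
    have le: "2 * k \<le> 2 * N" "Suc (2 * k) \<le> 2 * N" using Suc.prems by auto
    note 1 = rem[OF le(1) deg2[OF le(1)] h1]
    have h2: "H (W (Suc (2 * k))) + U * real 1 \<le> ?h"
      using 1(2) h1 \<Delta>_gt by simp
    note 2 = rem[OF le(2) deg1[OF le(2)] h2]
    have "climb ?h S (W (2 * Suc k))"
      using climb_trans[OF climb_trans[OF IH(1) 1(1)] 2(1)] by simp
    moreover have "H (W (2 * Suc k)) \<le> H S + Suc k * (3 * U - 2 * \<Delta>)"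
      using IH(2) 1(2) 2(2) by (simp add: algebra_simps)
    ultimately show ?case by blast
  qed
  then have N: "climb ?h S (W (2 * N))" "H (W (2 * N)) \<le> H S + N * (3 * U - 2 * \<Delta>)" by auto
  have "H (W (2 * N)) + U * real 1 \<le> ?h" using N(2) \<Delta>_gt by simp
  note last = rem[OF order.refl deg1 this]
  have W_eq: "W (Suc (2 * N)) = S - y ` {..2 * N}" by (simp add: W_def lessThan_Suc_atMost)
  show "climb ?h S (S - y ` {..2 * N})"
    using climb_trans[OF N(1) last(1)] unfolding W_eq by simp
  show "H (S - y ` {..2 * N}) \<le> H S + N * (3 * U - 2 * \<Delta>) - (\<Delta> - U)"
    using last(2) N(2) unfolding W_eq by simp
qed

end

text \<open>A hole travels along a chain of occupied sites, so that cavities can be filled through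
  a wall.\<close>

inductive wall :: "nat \<Rightarrow> site set \<Rightarrow> site \<Rightarrow> bool" for L :: nat and S :: "site set" where
  exit: "x \<in> S \<Longrightarrow> x \<in> hexagon L \<Longrightarrow> nn x y \<Longrightarrow> y \<notin> hexagon L \<Longrightarrow> wall L S x"
| step: "x \<in> S \<Longrightarrow> nn x y \<Longrightarrow> wall L S y \<Longrightarrow> wall L S x"

lemma wall_mem: "wall L S x \<Longrightarrow> x \<in> S"
  by (cases rule: wall.cases) auto

section \<open>Filling cavities by moving holes\<close>

context kawasaki_model
begin

lemma nn_boundary: "x \<in> hexagon L \<Longrightarrow> nn x y \<Longrightarrow> y \<notin> hexagon L \<Longrightarrow> y \<in> Lam_bdry L"
  using Lam_bdry_eq[OF L_ge_1] nn_hexagon_Lam nn_sym by blast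

text \<open>A hole costs at most 3 U - \<Delta> < 2 U in any position, and the particle at the exit
  has at most two bonds to break, which accounts for 2 U. By symmetry of climbs the same height
  suffices to fill the hole there from outside.\<close>

lemma climb_wall:
  assumes "wall L S x" "S \<subseteq> hexagon L"
  shows "climb (H S + 2 * U) (S - {x}) S"
  using assms
proof (induction rule: wall.induct)
  case (exit x y)
  have y: "y \<notin> S" "nn y x" using exit nn_sym[of x y] by auto
  have "acc L (S - {x}) y"
    using nn_boundary[OF exit(2-4)] y by (intro acc.boundary) auto
  then have "acc L (S - {x}) x" by (intro acc_neighbour[OF exit(3)]) (use exit(2) in auto)
  from climb_remove[OF this exit.prems exit(1)]
  have "climb (H S + U * deg (S - {x}) x) S (S - {x})" .
  moreover have "U * deg (S - {x}) x \<le> U * real 2"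
    using deg_le_2[of y "S - {x}" x] y by (intro U_mult_mono) auto
  ultimately have "climb (H S + 2 * U) S (S - {x})" by (elim climb_mono) linarith
  then show ?case by (rule climb_sym)
next
  case (step x y)
  have y: "y \<in> S" "x \<noteq> y" using wall_mem[OF step(3)] step(2) nn_irrefl[of x] by auto
  have le: "H (S - {z}) \<le> H S + 2 * U" if "z \<in> S" for z
    using H_remove[OF step.prems that] U_mult_mono[OF deg_le_3[of "S - {z}" z]] \<Delta>_gt by simp
  have eq: "S - {x} = insert y (S - {x, y})" "S - {y} = insert x (S - {x, y})"
    using step y by auto
  have xy: "x \<in> Lam L" "y \<in> Lam L" "nn y x"
    using step(1,2) step.prems y(1) nn_sym[of x y] hexagon_subset_Lam[of L] by auto
  have "climb (H S + 2 * U) (insert y (S - {x, y})) (insert x (S - {x, y}))"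
    by (rule climb_move_inner[OF xy(2,1,3)])
      (use le[OF step(1)] le[OF y(1)] in \<open>simp_all add: eq\<close>)
  then have "climb (H S + 2 * U) (S - {x}) (S - {y})" by (simp only: eq)
  also have "climb (H S + 2 * U) (S - {y}) S" by (rule step.IH[OF step.prems])
  finally show ?case .
qed

lemma climb_wall_fill:
  assumes "S \<subseteq> hexagon L" "x \<in> hexagon L" "x \<notin> S" "wall L (insert x S) x"
  shows "climb (H (insert x S) + 2 * U) S (insert x S)"
  using climb_wall[OF assms(4)] assms by simp

lemma reducible_wall_fill:
  assumes "S \<subseteq> hexagon L" "x \<in> hexagon L" "x \<notin> S" "wall L (insert x S) x" "deg S x \<ge> 2"
  shows "reducible S"
proof -
  have h: "H (insert x S) \<le> H S + \<Delta> - U * real 2"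
    using H_insert_deg_ge[OF assms(1-3,5)] .
  then have "climb (H S + \<Delta> + U) S (insert x S)"
    using U_pos by (intro climb_mono[OF climb_wall_fill[OF assms(1-4)]]) auto
  then show ?thesis unfolding reducible_def
    using h assms(1,2) \<Delta>_less U_pos hexagon_subset_Lam[of L] by (intro exI[of _ "insert x S"]) auto
qed

text \<open>The first filling may need (\<Delta> - U) + 2 U, which exhausts the allowed height
  \<Delta> + U; afterwards the second site has two occupied neighbours.\<close>

lemma reducible_wall_pair:
  assumes S: "S \<subseteq> hexagon L" and hex: "a \<in> hexagon L" "b \<in> hexagon L" "a \<notin> S" "b \<notin> S"
    and "nn a b" and wall: "wall L (insert a S) a" "wall L (insert b (insert a S)) b"
    and deg: "deg S a \<ge> 1" "deg S b \<ge> 1"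
  shows "reducible S"
proof -
  have ab: "a \<noteq> b" using \<open>nn a b\<close> nn_irrefl by blast
  have "{y \<in> insert a S. nn y b} = insert a {y \<in> S. nn y b}" using \<open>nn a b\<close> by auto
  then have deg': "deg (insert a S) b \<ge> 2" using deg hex finite_deg[of S b] by (simp add: deg_def)
  have h1: "H (insert a S) \<le> H S + \<Delta> - U"
    using H_insert_deg_ge[OF S hex(1,3) deg(1)] by simp
  have h2: "H (insert b (insert a S)) \<le> H (insert a S) + \<Delta> - U * 2"
    using H_insert_deg_ge[OF _ hex(2) _ deg'] hex S ab by simp
  have "climb (H S + \<Delta> + U) S (insert a S)"
    using h1 by (intro climb_mono[OF climb_wall_fill[OF S hex(1,3) wall(1)]]) auto
  also have "climb (H S + \<Delta> + U) (insert a S) (insert b (insert a S))"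
    using h1 h2 S hex ab \<Delta>_less U_pos by (intro climb_mono[OF climb_wall_fill[OF _ hex(2) _ wall(2)]]) auto
  finally show ?thesis unfolding reducible_def
    using h1 h2 S hex \<Delta>_less hexagon_subset_Lam[of L] by (intro exI[of _ "insert b (insert a S)"]) auto
qed

end

section \<open>Sides of a cluster\<close>

text \<open>A row of triangular faces alternates between the two face types: \<open>f\<close> lists
  the faces at even positions, \<open>g\<close> those between them.\<close>

definition alternate :: "(nat \<Rightarrow> 'a) \<Rightarrow> (nat \<Rightarrow> 'a) \<Rightarrow> nat \<Rightarrow> 'a" where
  "alternate f g t = (if even t then f (t div 2) else g (t div 2))"

lemma alternate_simps [simp]:
  "alternate f g 0 = f 0" "alternate f g (2 * k) = f k" "alternate f g (Suc (2 * k)) = g k"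
  by (auto simp: alternate_def)

lemma nat_even_odd_cases:
  fixes t :: nat
  obtains k where "t = 2 * k" | k where "t = Suc (2 * k)"
  by (metis evenE oddE Suc_eq_plus1)

lemma image_alternate: "alternate f g ` {..2 * N} = f ` {..N} \<union> g ` {..<N}"
proof (intro equalityI subsetI)
  fix x assume "x \<in> alternate f g ` {..2 * N}"
  then obtain t where t: "t \<le> 2 * N" "x = alternate f g t" by auto
  show "x \<in> f ` {..N} \<union> g ` {..<N}"
    using t by (cases t rule: nat_even_odd_cases) auto
next
  fix x assume "x \<in> f ` {..N} \<union> g ` {..<N}"
  then consider k where "k \<le> N" "x = f k" | k where "k < N" "x = g k" by auto
  then show "x \<in> alternate f g ` {..2 * N}"
  proof cases
    case 1 then show ?thesis by (intro image_eqI[of _ _ "2 * k"]) auto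
  next
    case 2 then show ?thesis by (intro image_eqI[of _ _ "Suc (2 * k)"]) auto
  qed
qed

lemma inj_on_alternate:
  assumes "inj_on f {..N}" "inj_on g {..<N}" "\<And>k l. f k \<noteq> g l"
  shows "inj_on (alternate f g) {..2 * N}"
proof (rule inj_onI)
  fix s t assume "s \<in> {..2 * N}" "t \<in> {..2 * N}" "alternate f g s = alternate f g t"
  then show "s = t"
    using assms(3) assms(3)[symmetric] inj_onD[OF assms(1)] inj_onD[OF assms(2)]
    by (cases s rule: nat_even_odd_cases; cases t rule: nat_even_odd_cases) auto
qed

text \<open>With c = (\<Delta> - U) / \<kappa>, the assumptions \<open>r_below\<close>,
  \<open>r_above\<close> and \<open>r_half\<close> read r < c < r + 1 and c \<noteq> r + 1/2,
  cleared of denominators.\<close>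

locale critical_model = kawasaki_model +
  fixes r :: nat
  assumes r_ge_1: "r \<ge> 1"
    and r_below: "r * (3 * U - 2 * \<Delta>) < \<Delta> - U"
    and r_above: "\<Delta> - U < (r + 1) * (3 * U - 2 * \<Delta>)"
    and r_half: "2 * (\<Delta> - U) \<noteq> (2 * r + 1) * (3 * U - 2 * \<Delta>)"
    and L_large: "L > 2 * r + 3"
begin

lemma grow_strip:
  fixes f g :: "nat \<Rightarrow> site"
  assumes S: "S \<subseteq> hexagon L" and inj: "inj_on f {..N}" "inj_on g {..<N}" "\<And>k l. f k \<noteq> g l"
    and f: "\<And>k. k \<le> N \<Longrightarrow> f k \<in> hexagon L" "\<And>k. k \<le> N \<Longrightarrow> f k \<notin> S"
    and g: "\<And>k. k < N \<Longrightarrow> g k \<in> hexagon L" "\<And>k. k < N \<Longrightarrow> g k \<notin> S"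
    and nn: "\<And>k. nn (f k) (g k)" "\<And>k. nn (g k) (f (Suc k))"
    and attached: "\<And>k. k \<le> N \<Longrightarrow> \<exists>z\<in>S. nn z (f k)"
    and exit: "nn (f N) z" "acc L (S \<union> (f ` {..N} \<union> g ` {..<N})) z"
  shows "climb (H S + 3 * \<Delta> - 2 * U) S (S \<union> (f ` {..N} \<union> g ` {..<N}))"
    and "H (S \<union> (f ` {..N} \<union> g ` {..<N})) \<le> H S + (\<Delta> - U) - N * (3 * U - 2 * \<Delta>)"
proof -
  have y: "alternate f g t \<in> hexagon L \<and> alternate f g t \<notin> S" if "t \<le> 2 * N" for t
    using that f g by (cases t rule: nat_even_odd_cases) auto
  have c: "nn (alternate f g t) (alternate f g (Suc t))" for t
  proof (cases t rule: nat_even_odd_cases)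
    case (1 k) then show ?thesis using nn(1) by simp
  next
    case (2 k)
    then have "Suc t = 2 * Suc k" by simp
    then show ?thesis using nn(2) 2 by (simp only: alternate_simps)
  qed
  note * = grow_chain[OF S inj_on_alternate[OF inj], of z, unfolded image_alternate]
  show "climb (H S + 3 * \<Delta> - 2 * U) S (S \<union> (f ` {..N} \<union> g ` {..<N}))"
    "H (S \<union> (f ` {..N} \<union> g ` {..<N})) \<le> H S + (\<Delta> - U) - N * (3 * U - 2 * \<Delta>)"
    by (rule *; use y c attached exit in simp)+
qed

lemma shrink_strip:
  fixes f g :: "nat \<Rightarrow> site"
  assumes S: "S \<subseteq> hexagon L" and inj: "inj_on f {..N}" "inj_on g {..<N}" "\<And>k l. f k \<noteq> g l"
    and N: "N \<ge> 1"
    and f: "\<And>k. k \<le> N \<Longrightarrow> f k \<in> S" and g: "\<And>k. k < N \<Longrightarrow> g k \<in> S"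
    and nn: "\<And>k. nn (f k) (g k)" "\<And>k. nn (g k) (f (Suc k))"
    and exposed: "\<And>k. k < N \<Longrightarrow> \<exists>z. z \<notin> S \<and> nn z (g k)" "\<exists>z. z \<notin> S \<and> nn z (f N)"
    and exit: "nn (f 0) z" "acc L S z"
  shows "climb (H S + N * (3 * U - 2 * \<Delta>) + 2 * \<Delta> - U) S (S - (f ` {..N} \<union> g ` {..<N}))"
    and "H (S - (f ` {..N} \<union> g ` {..<N})) \<le> H S + N * (3 * U - 2 * \<Delta>) - (\<Delta> - U)"
proof -
  have y: "alternate f g t \<in> S" if "t \<le> 2 * N" for t
    using that f g by (cases t rule: nat_even_odd_cases) auto
  have c: "nn (alternate f g t) (alternate f g (Suc t))" for t
  proof (cases t rule: nat_even_odd_cases)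
    case (1 k) then show ?thesis using nn(1) by simp
  next
    case (2 k)
    then have "Suc t = 2 * Suc k" by simp
    then show ?thesis using nn(2) 2 by (simp only: alternate_simps)
  qed
  have z: "z \<notin> S" "nn z (f 0)" using exit acc_not_mem nn_sym[of z] by auto
  have e: "\<exists>z. z \<notin> S \<and> nn z (alternate f g t)" if "t \<le> 2 * N" "t = 0 \<or> odd t \<or> t = 2 * N" for t
    using that exposed z by (cases t rule: nat_even_odd_cases) auto
  have exit': "nn (alternate f g 0) z" using exit by simp
  note * = shrink_chain[OF S inj_on_alternate[OF inj] N y c e exit' exit(2), unfolded image_alternate]
  show "climb (H S + N * (3 * U - 2 * \<Delta>) + 2 * \<Delta> - U) S (S - (f ` {..N} \<union> g ` {..<N}))"
    "H (S - (f ` {..N} \<union> g ` {..<N})) \<le> H S + N * (3 * U - 2 * \<Delta>) - (\<Delta> - U)"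
    by (rule *; assumption)+
qed

lemma reducibleI:
  assumes "climb h S T" "h \<le> H S + \<Delta> + U" "T \<subseteq> hexagon L" "H T < H S"
  shows "reducible S"
  unfolding reducible_def using climb_mono[OF assms(1,2)] assms(3,4) hexagon_subset_Lam[of L] by auto

end

text \<open>Coordinates on the lattice in which one of the six sides of the hexagon is on top.\<close>

locale hex_coords =
  fixes L :: nat and u d :: "int \<Rightarrow> int \<Rightarrow> site"
  assumes nn_u: "nn (u i j) y \<longleftrightarrow> y = d i j \<or> y = d (i - 1) j \<or> y = d i (j - 1)"
    and nn_d: "nn (d i j) y \<longleftrightarrow> y = u i j \<or> y = u (i + 1) j \<or> y = u i (j + 1)"
    and u_inj: "u i j = u k l \<longleftrightarrow> i = k \<and> j = l"
    and d_inj: "d i j = d k l \<longleftrightarrow> i = k \<and> j = l"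
    and u_neq_d: "u i j \<noteq> d k l"
    and hex_u: "u i j \<in> hexagon L \<longleftrightarrow> - int L \<le> i \<and> i < int L \<and> - int L \<le> j \<and> j < int L \<and>
     - int L \<le> i + j \<and> i + j < int L"
    and hex_d: "d i j \<in> hexagon L \<longleftrightarrow> - int L \<le> i \<and> i < int L \<and> - int L \<le> j \<and> j < int L \<and>
     - int L \<le> i + j + 1 \<and> i + j + 1 < int L"
    and exhaust: "\<exists>i j. x = u i j \<or> x = d i j"

lemma hex_coords_Up_Down: "hex_coords L Up Down"
proof
  show "nn (Up i j) y \<longleftrightarrow> y = Down i j \<or> y = Down (i - 1) j \<or> y = Down i (j - 1)" for i j y
    unfolding nn_sym[of _ y] nn_iff' by simp
  show "nn (Down i j) y \<longleftrightarrow> y = Up i j \<or> y = Up (i + 1) j \<or> y = Up i (j + 1)" for i j y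
    unfolding nn_sym[of _ y] nn_iff' by simp
  show "\<exists>i j. x = Up i j \<or> x = Down i j" for x by (cases x) auto
qed (simp_all add: hexagon_iff)

context hex_coords
begin

text \<open>A turn by 60 degrees, which exchanges the two face types. The new top side is the
  clockwise successor of the old one, so facts proved at the top can be carried around the
  hexagon.\<close>

lemma rotate: "hex_coords L (\<lambda>p q. d (p + q) (- p - 1)) (\<lambda>p q. u (p + q + 1) (- p - 1))"
proof
  fix x
  obtain i j where "x = u i j \<or> x = d i j" using exhaust by blast
  moreover have "d i j = d ((- j - 1) + (i + j + 1)) (- (- j - 1) - 1)"
    "u i j = u ((- j - 1) + (i + j) + 1) (- (- j - 1) - 1)" by simp_all
  ultimately show "\<exists>p q. x = d (p + q) (- p - 1) \<or> x = u (p + q + 1) (- p - 1)" by metis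
qed (auto simp: nn_u nn_d u_inj d_inj u_neq_d u_neq_d[symmetric] hex_u hex_d algebra_simps)

text \<open>Reflection in the vertical axis: rows and face types are kept, left and right are
  exchanged.\<close>

lemma mirror: "hex_coords L (\<lambda>i j. u (- i - j - 1) j) (\<lambda>i j. d (- i - j - 2) j)"
proof
  fix x
  obtain i j where "x = u i j \<or> x = d i j" using exhaust by blast
  moreover have "u i j = u (- (- i - j - 1) - j - 1) j" "d i j = d (- (- i - j - 2) - j - 2) j" by simp_all
  ultimately show "\<exists>p q. x = u (- p - q - 1) q \<or> x = d (- p - q - 2) q" by metis
qed (auto simp: nn_u nn_d u_inj d_inj u_neq_d u_neq_d[symmetric] hex_u hex_d algebra_simps)

lemma nn_simps [simp]:
  "nn (u i j) (d i j)" "nn (d i j) (u i j)" "nn (d i j) (u (i + 1) j)" "nn (d i j) (u i (j + 1))"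
  "nn (u i j) (d (i - 1) j)" "nn (u i j) (d i (j - 1))" "nn (u (i + 1) j) (d i j)"
  "nn (u i (j + 1)) (d i j)" "nn (d (i - 1) j) (u i j)" "nn (d i (j - 1)) (u i j)"
  by (auto simp: nn_u nn_d)

text \<open>Half-infinite, since the length of the side is not known when its surroundings are
  described; it contains every strip that may later be filled in front of the side.\<close>

definition outer_strip :: "int \<Rightarrow> int \<Rightarrow> site set" where
  "outer_strip i j = {d (i + k) (j - k) | k. 0 \<le> k} \<union> {u (i + k + 1) (j - k) | k. 0 \<le> k}"

end

locale kawasaki_coords = kawasaki_model + hex_coords
begin

lemma Lam_cases: "x \<in> Lam L \<Longrightarrow> x \<in> hexagon L \<or> x \<in> Lam_bdry L"
  using Lam_bdry_eq[OF L_ge_1] by auto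

text \<open>All rows above \<open>j\<close> are vacant, so a free particle rises from
  \<open>d p q\<close> to \<open>u p (q + 1)\<close> and on. The induction is on the distance to the
  top, beyond which every site of \<Lambda> is a boundary site.\<close>

lemma acc_above:
  assumes "\<And>p q. q > j \<Longrightarrow> u p q \<notin> T \<and> d p q \<notin> T" "q > j"
  shows "d p q \<in> Lam L \<Longrightarrow> acc L T (d p q)" "u p q \<in> Lam L \<Longrightarrow> acc L T (u p q)"
proof -
  have "(d p q \<in> Lam L \<longrightarrow> acc L T (d p q)) \<and> (u p q \<in> Lam L \<longrightarrow> acc L T (u p q))"
    if "q > j" "int L - q \<le> int n" for n p q
    using that
  proof (induction n arbitrary: p q)
    case 0
    then have "d p q \<notin> hexagon L" "u p q \<notin> hexagon L" by (auto simp: hex_u hex_d)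
    then show ?case using Lam_cases assms(1)[OF 0(1)] by (auto intro: acc.boundary)
  next
    case (Suc n)
    have T: "d p q \<notin> T" "u p q \<notin> T" using assms(1)[OF Suc.prems(1)] by auto
    have d: "acc L T (d p q)" if "d p q \<in> Lam L" for p
    proof (cases "d p q \<in> hexagon L")
      case True
      then have "u p (q + 1) \<in> Lam L" by (rule nn_hexagon_Lam) simp
      then have "acc L T (u p (q + 1))" using Suc.IH[of "q + 1" p] Suc.prems by simp
      then show ?thesis
        using acc.step[OF that _ nn_simps(4)] assms(1)[OF Suc.prems(1)] by simp
    next
      case False
      then show ?thesis using that Lam_cases assms(1)[OF Suc.prems(1)] by (auto intro: acc.boundary)
    qed
    moreover have "acc L T (u p q)" if "u p q \<in> Lam L"
    proof (cases "u p q \<in> hexagon L")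
      case True
      then have "d p q \<in> Lam L" by (rule nn_hexagon_Lam) simp
      then show ?thesis using acc.step[OF that T(2) nn_simps(1) d] by simp
    next
      case False
      then show ?thesis using that Lam_cases T by (auto intro: acc.boundary)
    qed
    ultimately show ?case by blast
  qed
  from this[of q "nat (int L - q)"] assms(2)
  show "d p q \<in> Lam L \<Longrightarrow> acc L T (d p q)" "u p q \<in> Lam L \<Longrightarrow> acc L T (u p q)" by auto
qed

end

section \<open>Geometry of irreducible clusters\<close>

locale frozen_cluster = critical_model + kawasaki_coords +
  fixes S :: "site set"
  assumes S_hex: "S \<subseteq> hexagon L" and irreducible: "\<not> reducible S"
begin

lemma frozen_vacant:
  assumes "acc L S x" "x \<in> hexagon L" "y \<in> S" "nn y x" "z \<in> S" "nn z x" shows "y = z"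
  using reducible_fill[OF S_hex assms(1,2)] deg_ge_2[OF assms(3-6)] irreducible by blast

text \<open>A particle next to an accessible vacancy could leave at a profit as soon as a second
  neighbour were missing.\<close>

lemma frozen_occupied:
  assumes "acc L S z" "nn x z" "x \<in> S" "nn y x" "y \<noteq> z" shows "y \<in> S"
proof (rule ccontr)
  assume "y \<notin> S"
  then have "deg S x \<le> 1"
    using assms acc_not_mem[OF assms(1)] nn_sym[of x z] by (intro deg_le_1[of y _ _ z]) auto
  then show False using reducible_remove[OF S_hex assms(1-3)] irreducible by blast
qed

lemma frozen_pair:
  assumes "a \<in> hexagon L" "b \<in> hexagon L" "nn a b" "acc L S a" "acc L S b"
    "y \<in> S" "nn y a" "z \<in> S" "nn z b"
  shows False
  using reducible_pair[OF S_hex assms(1-5)] deg_ge_1 assms(6-9) irreducible by blast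

text \<open>
  Walk along the side that starts at the common edge of the occupied \<open>A 0 = u i j\<close> and the vacant
  \<open>D 0 = d i j\<close>.  Inside the cluster lies the strip \<open>I (- 1), A 0, I 0, A 1, \<dots>\<close>, outside the
  strip \<open>D 0, C 0, D 1, \<dots>\<close>, which is entered through \<open>C (- 1) = u i (j + 1)\<close>.  Unless the cluster
  shrinks or grows, the length of the side is \<open>r + 1\<close>.
\<close>

lemma frozen_side:
  fixes i j :: int
  assumes start: "u i j \<in> S" "d i j \<in> hexagon L" "d i j \<notin> S"
    and accC: "acc L (S \<union> outer_strip i j) (u i (j + 1))"
    and accA: "d (i - 1) j \<in> S \<Longrightarrow> acc L S (u (i - 1) (j + 1))"
  shows "\<And>k. 0 \<le> k \<Longrightarrow> k \<le> int r \<Longrightarrow>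
      u (i + k) (j - k) \<in> S \<and> d (i + k) (j - k) \<in> hexagon L \<and> acc L S (d (i + k) (j - k)) \<and>
      acc L S (u (i + k + 1) (j - k)) \<and>
      d (i + k - 1) (j - k) \<in> S \<and> d (i + k) (j - k - 1) \<in> S"
    and "u (i + (int r + 1)) (j - (int r + 1)) \<notin> S"
    and "d (i + (int r + 1)) (j - (int r + 1)) \<notin> S"
proof -
  define A where "A k = u (i + k) (j - k)" for k
  define D where "D k = d (i + k) (j - k)" for k
  define C where "C k = u (i + k + 1) (j - k)" for k
  define I where "I k = d (i + k) (j - k - 1)" for k
  have nn: "nn (A k) (D k)" "nn (D k) (A k)" "nn (D k) (C k)" "nn (C k) (D k)" "nn (C (k - 1)) (D k)"
    "nn (D k) (C (k - 1))" "nn (A k) (I k)" "nn (I k) (A k)" "nn (A k) (I (k - 1))" "nn (I (k - 1)) (A k)"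
    "nn (C k) (D (k + 1))" "nn (D (k + 1)) (C k)" "nn (I k) (A (k + 1))" "nn (A (k + 1)) (I k)" for k
    by (auto simp: A_def D_def C_def I_def nn_u nn_d algebra_simps)
  define P where "P k \<longleftrightarrow> A k \<in> S \<and> D k \<in> hexagon L \<and> D k \<notin> S" for k
  have P0: "P 0" using start by (simp add: P_def A_def D_def)
  \<comment> \<open>The hexagon has width 2 L, so the walk must end; \<open>m\<close> is the length
    of the side.\<close>
  have "\<not> P (int (2 * L))" using start(2) by (auto simp: P_def D_def hex_d)
  then obtain m where m: "\<not> P (int m)" and less_m: "\<And>k. k < m \<Longrightarrow> P (int k)"
    using exists_least_iff[of "\<lambda>m. \<not> P (int m)"] by blast
  have m_pos: "m \<ge> 1" using m P0 by (cases m) auto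
  have accC1: "acc L S (C (- 1))" using acc_antimono[OF accC] by (simp add: C_def)
  \<comment> \<open>\<open>D k\<close> is entered from \<open>C (k - 1)\<close>. It touches
    \<open>A k\<close>, so a particle at \<open>C k\<close> would be a second contact; and
    \<open>A k\<close>, which sees the vacancy \<open>D k\<close>, must keep both inner
    neighbours.\<close>
  have walk: "acc L S (D k) \<and> acc L S (C k) \<and> I (k - 1) \<in> S \<and> I k \<in> S"
    if P: "P k" and accC: "acc L S (C (k - 1))" for k
  proof -
    have PD: "A k \<in> S" "D k \<in> hexagon L" "D k \<notin> S" using P by (auto simp: P_def)
    have accD: "acc L S (D k)" using acc_neighbour[OF nn(6) accC PD(3,2)] .
    have ne: "I l \<noteq> D k" if "l = k \<or> l = k - 1" for l using that by (auto simp: I_def D_def d_inj)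
    have "C k \<notin> S"
      using frozen_vacant[OF accD PD(2,1) nn(1) _ nn(4)] by (auto simp: A_def C_def u_inj)
    then have "acc L S (C k)"
      using accD nn(4) nn_hexagon_Lam[OF PD(2)] by (blast intro: acc.step)
    then show ?thesis
      using accD frozen_occupied[OF accD nn(1) PD(1) nn(8)] frozen_occupied[OF accD nn(1) PD(1) nn(10)] ne
      by auto
  qed
  have *: "acc L S (D (int k)) \<and> acc L S (C (int k)) \<and> I (int k - 1) \<in> S \<and> I (int k) \<in> S" if "k < m" for k
    using that
  proof (induction k)
    case 0
    then show ?case using walk[of 0] P0 accC1 by simp
  next
    case (Suc k)
    then show ?case using walk[of "int (Suc k)"] less_m[of "Suc k"] by simp
  qed
  have C_hex: "C k \<in> hexagon L" if "D k \<in> hexagon L" "D (k + 1) \<in> hexagon L" for k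
    using that by (auto simp: C_def D_def hex_u hex_d)
  define k0 where "k0 = int m - 1"
  have k0: "int m = k0 + 1" "k0 = int (m - 1)" "m - 1 < m" using m_pos by (auto simp: k0_def)
  have last: "P k0" "acc L S (D k0)" "acc L S (C k0)" "I k0 \<in> S"
    using less_m[OF k0(3)] *[OF k0(3)] unfolding k0(2) by auto
  \<comment> \<open>A particle at \<open>D (int m)\<close> would form a reentrant corner: the vacant
    pair \<open>C k0\<close>, \<open>D k0\<close> would touch the cluster at both members.\<close>
  have Dm: "D (int m) \<notin> S"
  proof
    assume D: "D (int m) \<in> S"
    have "C k0 \<in> hexagon L"
      using C_hex[of k0] D S_hex last(1) k0(1) by (auto simp: P_def)
    then show False
      using frozen_pair[of "C k0" "D k0" "D (int m)" "A k0"] last D nn unfolding k0(1) by (auto simp: P_def)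
  qed
  have Am: "A (int m) \<notin> S"
  proof
    assume A: "A (int m) \<in> S"
    then have "A (k0 + 1) \<in> hexagon L" "D k0 \<in> hexagon L" using S_hex last(1) k0(1) by (auto simp: P_def)
    then have "D (int m) \<in> hexagon L" unfolding k0(1) by (auto simp: A_def D_def hex_u hex_d)
    then show False using m A Dm by (auto simp: P_def)
  qed
  have AI: "A k \<noteq> I l" "C k \<noteq> D l" for k l by (auto simp: A_def I_def C_def D_def u_neq_d)
  \<comment> \<open>The row consists of \<open>A 0\<close>, ..., \<open>A (m - 1)\<close> and the
    \<open>I\<close> sites around them. It opens at \<open>A (- 1)\<close> and, since
    \<open>A m\<close> is vacant, also at its far end.\<close>
  have no_shrink: "\<not> m \<le> r"
  proof
    assume mr: "m \<le> r"
    define f where "f k = I (int k - 1)" for k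
    define g where "g k = A (int k)" for k
    have f: "f k \<in> S" if "k \<le> m" for k
    proof (cases "k = m")
      case True
      then show ?thesis using last(4) by (simp add: f_def k0_def)
    next
      case False
      then show ?thesis using *[of k] that by (simp add: f_def)
    qed
    have g: "g k \<in> S" if "k < m" for k using less_m[OF that] by (simp add: g_def P_def)
    have accA: "acc L S (A (- 1))"
      using accA f[of 0] by (simp add: f_def I_def A_def)
    have fg: "nn (f k) (g k)" "nn (g k) (f (Suc k))" for k
      using nn(10)[of "int k"] nn(7)[of "int k"] by (simp_all add: f_def g_def)
    have e: "\<exists>z. z \<notin> S \<and> nn z (g k)" if "k < m" for k
      using less_m[OF that] nn(2)[of "int k"] by (auto simp: g_def P_def)
    have e': "\<exists>z. z \<notin> S \<and> nn z (f m)"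
      using Am nn(14)[of "int m - 1"] by (auto simp: f_def)
    have f0: "nn (f 0) (A (- 1))" using nn(8)[of "- 1"] by (simp add: f_def)
    have inj: "inj_on f {..m}" "inj_on g {..<m}" "f k \<noteq> g l" for k l
      using u_neq_d u_neq_d[symmetric] by (auto simp: inj_on_def f_def g_def I_def A_def u_inj d_inj)
    note sh = shrink_strip[OF S_hex inj m_pos f g fg e e' f0 accA]
    have "m * (3 * U - 2 * \<Delta>) \<le> r * (3 * U - 2 * \<Delta>)"
      using mr \<Delta>_less by (intro mult_right_mono) auto
    then have "m * (3 * U - 2 * \<Delta>) < \<Delta> - U" using r_below by (rule le_less_trans)
    then have "reducible S"
      using S_hex U_pos \<Delta>_less sh(2) by (intro reducibleI[OF sh(1)]) auto
    then show False using irreducible by blast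
  qed
  have no_grow: "\<not> r + 2 \<le> m"
  proof
    assume mr: "r + 2 \<le> m"
    \<comment> \<open>Numbered backwards, so that filling ends at \<open>D 0\<close>, beside the
      entrance \<open>C (- 1)\<close>. Only r + 2 places of the side are used:
      \<open>N = r + 1\<close> already makes the row profitable by \<open>r_above\<close>.\<close>
    define f where "f k = D (int (r + 1) - int k)" for k
    define g where "g k = C (int r - int k)" for k
    have P: "P (int (r + 1) - int k)" if "k \<le> r + 1" for k
      using less_m[of "r + 1 - k"] that mr by (auto simp: of_nat_diff)
    have f: "f k \<in> hexagon L" "f k \<notin> S" if "k \<le> r + 1" for k
      using P[OF that] by (auto simp: f_def P_def)
    have att: "\<exists>z\<in>S. nn z (f k)" if "k \<le> r + 1" for k
      using P[OF that] nn(1) by (auto simp: f_def P_def)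
    have g: "g k \<in> hexagon L" "g k \<notin> S" if "k < r + 1" for k
    proof -
      show "g k \<in> hexagon L"
        using C_hex[of "int r - int k"] f(1)[of k] f(1)[of "Suc k"] that
        by (simp add: g_def f_def algebra_simps)
      show "g k \<notin> S"
        using *[of "r - k"] mr that acc_not_mem[of L S "C (int r - int k)"] by (auto simp: g_def of_nat_diff)
    qed
    have fg: "nn (f k) (g k)" "nn (g k) (f (Suc k))" for k
      using nn(6)[of "int (r + 1) - int k"] nn(4)[of "int r - int k"]
      by (simp_all add: f_def g_def algebra_simps)
    have inj: "inj_on f {..r + 1}" "inj_on g {..<r + 1}" "f k \<noteq> g l" for k l
      using u_neq_d u_neq_d[symmetric] by (auto simp: inj_on_def f_def g_def C_def D_def u_inj d_inj)
    have "f ` {..r + 1} \<union> g ` {..<r + 1} \<subseteq> outer_strip i j"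
    proof -
      have "f k \<in> outer_strip i j" if "k \<le> r + 1" for k
        unfolding f_def D_def outer_strip_def
        by (intro UnI1 CollectI exI[of _ "int (r + 1) - int k"]) (use that in auto)
      moreover have "g k \<in> outer_strip i j" if "k < r + 1" for k
        unfolding g_def C_def outer_strip_def
        by (intro UnI2 CollectI exI[of _ "int r - int k"]) (use that in auto)
      ultimately show ?thesis by auto
    qed
    then have acc: "acc L (S \<union> (f ` {..r + 1} \<union> g ` {..<r + 1})) (C (- 1))"
      using acc_antimono[OF accC, of "S \<union> (f ` {..r + 1} \<union> g ` {..<r + 1})"]
      by (auto simp: C_def)
    have fN: "nn (f (r + 1)) (C (- 1))" using nn(6)[of 0] by (simp add: f_def)
    note gr = grow_strip[OF S_hex inj f g fg att fN acc]
    have "reducible S"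
      using S_hex r_above U_pos \<Delta>_less gr(2) f g
      by (intro reducibleI[OF gr(1)]) (auto simp: algebra_simps)
    then show False using irreducible by blast
  qed
  have mr: "m = r + 1" using no_shrink no_grow by linarith
  show "u (i + k) (j - k) \<in> S \<and> d (i + k) (j - k) \<in> hexagon L \<and> acc L S (d (i + k) (j - k)) \<and>
      acc L S (u (i + k + 1) (j - k)) \<and>
      d (i + k - 1) (j - k) \<in> S \<and> d (i + k) (j - k - 1) \<in> S" if "0 \<le> k" "k \<le> int r" for k
    using *[of "nat k"] less_m[of "nat k"] that mr
    by (auto simp: P_def A_def C_def D_def I_def algebra_simps)
  show "u (i + (int r + 1)) (j - (int r + 1)) \<notin> S" "d (i + (int r + 1)) (j - (int r + 1)) \<notin> S"
    using Am Dm by (auto simp: A_def D_def mr algebra_simps)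
qed

end

section \<open>Two consecutive sides of critical length\<close>

context critical_model
begin

text \<open>The second filling comes close to the limit: by \<open>r_above\<close> it starts less
  than \<kappa> above \<open>H S\<close>.\<close>

lemma reducible_grow_twice:
  assumes S1: "climb (H S + 3 * \<Delta> - 2 * U) S S1" "H S1 \<le> H S + (\<Delta> - U) - r * (3 * U - 2 * \<Delta>)"
    and S2: "climb (H S1 + 3 * \<Delta> - 2 * U) S1 S2"
      "H S2 \<le> H S1 + (\<Delta> - U) - (r + 1) * (3 * U - 2 * \<Delta>)" "S2 \<subseteq> hexagon L"
    and half: "2 * (\<Delta> - U) < (2 * r + 1) * (3 * U - 2 * \<Delta>)"
  shows "reducible S"
proof -
  have r': "(r + 1) * (3 * U - 2 * \<Delta>) = r * (3 * U - 2 * \<Delta>) + (3 * U - 2 * \<Delta>)"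
    "(2 * r + 1) * (3 * U - 2 * \<Delta>) = 2 * (r * (3 * U - 2 * \<Delta>)) + (3 * U - 2 * \<Delta>)"
    by (simp_all add: algebra_simps)
  have "climb (H S + \<Delta> + U) S S2"
    using climb_trans[OF climb_mono[OF S1(1)] climb_mono[OF S2(1)], of "H S + \<Delta> + U"]
      S1(2) r_above \<Delta>_less unfolding r' by simp
  then show ?thesis
    using S1(2) S2(2,3) half unfolding r' by (intro reducibleI) auto
qed

text \<open>The first removal comes close to the limit: r \<kappa> < \<Delta> - U puts its peak (r +
  1) \<kappa> + 2 \<Delta> - U just below \<Delta> + U. By \<open>half\<close> the second one peaks
  below 3 \<Delta> - 2 U.\<close>

lemma reducible_shrink_twice:
  assumes S1: "climb (H S + (r + 1) * (3 * U - 2 * \<Delta>) + 2 * \<Delta> - U) S S1"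
      "H S1 \<le> H S + (r + 1) * (3 * U - 2 * \<Delta>) - (\<Delta> - U)"
    and S2: "climb (H S1 + r * (3 * U - 2 * \<Delta>) + 2 * \<Delta> - U) S1 S2"
      "H S2 \<le> H S1 + r * (3 * U - 2 * \<Delta>) - (\<Delta> - U)" "S2 \<subseteq> hexagon L"
    and half: "(2 * r + 1) * (3 * U - 2 * \<Delta>) < 2 * (\<Delta> - U)"
  shows "reducible S"
proof -
  have r': "(r + 1) * (3 * U - 2 * \<Delta>) = r * (3 * U - 2 * \<Delta>) + (3 * U - 2 * \<Delta>)"
    "(2 * r + 1) * (3 * U - 2 * \<Delta>) = 2 * (r * (3 * U - 2 * \<Delta>)) + (3 * U - 2 * \<Delta>)"
    by (simp_all add: algebra_simps)
  have "climb (H S + \<Delta> + U) S S2"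
    using climb_trans[OF climb_mono[OF S1(1)] climb_mono[OF S2(1)], of "H S + \<Delta> + U"]
      S1(2) r_below half \<Delta>_less unfolding r' by simp
  then show ?thesis
    using S1(2) S2(2,3) half unfolding r' by (intro reducibleI) auto
qed

end

context frozen_cluster
begin

lemma rotated: "frozen_cluster L U \<Delta> r (\<lambda>p q. d (p + q) (- p - 1)) (\<lambda>p q. u (p + q + 1) (- p - 1)) S"
  by (intro frozen_cluster.intro critical_model_axioms kawasaki_coords.intro kawasaki_model_axioms rotate frozen_cluster_axioms.intro S_hex irreducible)

lemma mirrored: "frozen_cluster L U \<Delta> r (\<lambda>i j. u (- i - j - 1) j) (\<lambda>i j. d (- i - j - 2) j) S"
  by (intro frozen_cluster.intro critical_model_axioms kawasaki_coords.intro kawasaki_model_axioms mirror frozen_cluster_axioms.intro S_hex irreducible)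

text \<open>The strip itself is the corridor. A \<open>u\<close> site in it may be a boundary site,
  but it belongs to \<Lambda> as a neighbour of a \<open>d\<close> site in the hexagon.\<close>

lemma acc_strip:
  assumes "acc L T (u i (j + 1))"
    and D: "\<And>k. 0 \<le> k \<Longrightarrow> k \<le> int n \<Longrightarrow> d (i + k) (j - k) \<in> hexagon L \<and> d (i + k) (j - k) \<notin> T"
    and C: "\<And>k. 0 \<le> k \<Longrightarrow> k < int n \<Longrightarrow> u (i + k + 1) (j - k) \<notin> T"
  shows "acc L T (d (i + int n) (j - int n))"
  using D C
proof (induction n)
  case 0
  have "d i j \<in> hexagon L" "d i j \<notin> T" using "0.prems"(1)[of 0] by auto
  then show ?case using acc_neighbour[OF nn_simps(4) assms(1)] by simp
next
  case (Suc n)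
  let ?D = "d (i + int n) (j - int n)" and ?C = "u (i + int n + 1) (j - int n)"
  let ?D' = "d (i + int (Suc n)) (j - int (Suc n))"
  have D: "acc L T ?D" "?D \<in> hexagon L" "?D' \<in> hexagon L" "?D' \<notin> T"
    using Suc Suc.prems(1)[of "int n"] Suc.prems(1)[of "int (Suc n)"] by auto
  have nn: "nn ?C ?D" "nn ?D' ?C" by (simp_all add: nn_u nn_d u_inj d_inj)
  have "acc L T ?C"
    using acc.step[OF nn_hexagon_Lam[OF D(2) nn(1)] _ nn(1) D(1)] Suc.prems(2)[of "int n"] by simp
  then show ?case using acc_neighbour[OF nn(2)] D by simp
qed

text \<open>
  Two consecutive sides of length \<open>R = r + 1\<close>: the second one starts at the last site \<open>d a b\<close>
  behind the first, and is a side of the same kind in rotated coordinates.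
\<close>

lemma no_corner:
  fixes i j :: int
  assumes above: "\<And>p q. q > j \<Longrightarrow> u p q \<notin> S \<and> d p q \<notin> S"
    and start: "u i j \<in> S" "d i j \<in> hexagon L" "d i j \<notin> S"
    and border: "j = int L - 1 \<or> (\<forall>q. d (int L - 1) q \<notin> S)"
  shows False
proof -
  define R where "R = int r + 1"
  have rR: "int r = R - 1" "R \<ge> 2" using r_ge_1 by (auto simp: R_def)
  have above_strip: "u p q \<notin> S \<union> outer_strip i j \<and> d p q \<notin> S \<union> outer_strip i j" if "q > j" for p q
    using above[OF that] that by (auto simp: outer_strip_def u_inj d_inj u_neq_d u_neq_d[symmetric])
  have C_Lam: "u i (j + 1) \<in> Lam L" by (rule nn_hexagon_Lam[OF start(2)]) simp
  have accC: "acc L (S \<union> outer_strip i j) (u i (j + 1))"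
    by (rule acc_above(2)[OF above_strip _ C_Lam]) auto
  have accA: "acc L S (u (i - 1) (j + 1))" if "d (i - 1) j \<in> S"
  proof -
    have "u (i - 1) (j + 1) \<in> Lam L" using nn_hexagon_Lam[of "d (i - 1) j" L] that S_hex by auto
    then show ?thesis using acc_above(2)[OF above] by auto
  qed
  note side = frozen_side[OF start accC accA]
  define a where "a = i + int r"
  define b where "b = j - R"
  have ij: "i = a - R + 1" "j = b + R" by (simp_all add: a_def b_def R_def)
  have D: "d (i + k) (j - k) \<in> hexagon L" "acc L S (d (i + k) (j - k))" "d (i + k) (j - k) \<notin> S"
    and A: "u (i + k) (j - k) \<in> S" and C: "acc L S (u (i + k + 1) (j - k))" "u (i + k + 1) (j - k) \<notin> S"
    and I: "d (i + k - 1) (j - k) \<in> S" "d (i + k) (j - k - 1) \<in> S" if "0 \<le> k" "k < R" for k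
    using side(1)[of k] that acc_not_mem by (auto simp: R_def)
  \<comment> \<open>\<open>d a b\<close> ends the row behind the first side and is also the first
    particle of the second side, whose outer row begins at \<open>u (a + 1) b\<close>.\<close>
  have B0: "d a b \<in> S" using I(2)[of "R - 1"] rR by (simp add: ij algebra_simps)
  have AR: "u (a + 1) b \<notin> S" and DR: "d (a + 1) b \<notin> S"
    using side(2,3) by (simp_all add: ij R_def algebra_simps)
  have Dr: "d a (b + 1) \<in> hexagon L" "acc L S (d a (b + 1))"
    using D(1,2)[of "R - 1"] rR by (simp_all add: ij algebra_simps)
  \<comment> \<open>Room in front of the second side could be missing only at the lower right
    border. There \<open>border\<close> excludes the particle \<open>d a b\<close>, or else the
    first side lies in the top row and, as L > 2 r + 3, is too short to reach that border.\<close>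
  have aL: "a + 1 < int L"
  proof (rule ccontr)
    assume "\<not> ?thesis"
    then have a: "a = int L - 1" using Dr(1) by (auto simp: hex_d)
    then have "j = int L - 1" using border B0 by auto
    then show False using start(2) L_large a by (auto simp: hex_d ij R_def)
  qed
  have bL: "- int L \<le> b" using B0 S_hex hex_d[of a b] by auto
  have abL: "- int L \<le> a + b + 1" using B0 S_hex hex_d[of a b] by auto
  have hexA: "u (a + 1) b \<in> hexagon L" and hexD: "d (a + 1) b \<in> hexagon L"
    using aL bL abL Dr(1) by (auto simp: hex_u hex_d)
  interpret rot: frozen_cluster L U \<Delta> r "\<lambda>p q. d (p + q) (- p - 1)" "\<lambda>p q. u (p + q + 1) (- p - 1)" S
    by (rule rotated)
  define outer' where "outer' = rot.outer_strip (- b - 1) (a + b + 1)"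
  have outer': "outer' = {u (a + 1) (b - k) | k. 0 \<le> k} \<union> {d (a + 1) (b - k - 1) | k. 0 \<le> k}"
  proof -
    have "outer' = {u ((- b - 1 + k) + (a + b + 1 - k) + 1) (- (- b - 1 + k) - 1) | k. 0 \<le> k}
      \<union> {d ((- b - 1 + k + 1) + (a + b + 1 - k)) (- (- b - 1 + k + 1) - 1) | k. 0 \<le> k}"
      by (simp only: outer'_def rot.outer_strip_def)
    then show ?thesis by (simp add: algebra_simps)
  qed
  have above': "u p q \<notin> S \<union> outer' \<and> d p q \<notin> S \<union> outer'" if "q > j" for p q
    using above[OF that] that rR by (auto simp: outer' ij u_inj d_inj u_neq_d u_neq_d[symmetric])
  \<comment> \<open>The entrance to the second side is reached along the outer strip of the first,
    which is disjoint from \<open>outer'\<close>.\<close>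
  have accC': "acc L (S \<union> outer') (d (a + 1) b)"
  proof -
    have "acc L (S \<union> outer') (d (i + int (nat R)) (j - int (nat R)))"
    proof (rule acc_strip)
      show "acc L (S \<union> outer') (u i (j + 1))" by (rule acc_above(2)[OF above' _ C_Lam]) auto
      fix k :: int
      assume k: "0 \<le> k"
      show "d (i + k) (j - k) \<in> hexagon L \<and> d (i + k) (j - k) \<notin> S \<union> outer'" if "k \<le> int (nat R)"
      proof (cases "k = R")
        case True
        then show ?thesis using DR hexD by (auto simp: ij outer' d_inj u_neq_d[symmetric])
      next
        case False
        then show ?thesis using D(1,3)[of k] k that rR by (auto simp: ij outer' d_inj u_neq_d[symmetric])
      qed
      show "u (i + k + 1) (j - k) \<notin> S \<union> outer'" if "k < int (nat R)"
        using C(2)[of k] k that rR by (auto simp: ij outer' u_inj u_neq_d)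
    qed
    then show ?thesis using rR by (simp add: ij)
  qed
  have accDR: "acc L S (d (a + 1) b)" using accC' by (rule acc_antimono) auto
  have accAR: "acc L S (u (a + 1) b)" by (rule acc_neighbour[OF _ accDR AR hexA]) simp
  have side': "\<And>k. 0 \<le> k \<Longrightarrow> k < R \<Longrightarrow> d a (b - k) \<in> S \<and> u (a + 1) (b - k) \<in> hexagon L \<and>
      u (a + 1) (b - k) \<notin> S \<and> d (a + 1) (b - k - 1) \<notin> S \<and> u a (b - k) \<in> S"
    "d a (b - R) \<notin> S"
  proof -
    have s: "d ((- b - 1) + (a + b + 1)) (- (- b - 1) - 1) \<in> S"
      "u ((- b - 1) + (a + b + 1) + 1) (- (- b - 1) - 1) \<in> hexagon L"
      "u ((- b - 1) + (a + b + 1) + 1) (- (- b - 1) - 1) \<notin> S"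
      "acc L (S \<union> rot.outer_strip (- b - 1) (a + b + 1)) (d ((- b - 1) + (a + b + 1 + 1)) (- (- b - 1) - 1))"
      "acc L S (d ((- b - 1 - 1) + (a + b + 1 + 1)) (- (- b - 1 - 1) - 1))"
      using B0 hexA AR accC' Dr(2) by (simp_all add: outer'_def add.commute)
    note s' = rot.frozen_side[OF s(1-5)]
    show "d a (b - k) \<in> S \<and> u (a + 1) (b - k) \<in> hexagon L \<and>
      u (a + 1) (b - k) \<notin> S \<and> d (a + 1) (b - k - 1) \<notin> S \<and> u a (b - k) \<in> S" if "0 \<le> k" "k < R" for k
      using s'(1)[of k] that acc_not_mem[of L S] by (auto simp: R_def algebra_simps)
    show "d a (b - R) \<notin> S" using s'(2) by (simp add: R_def algebra_simps)
  qed
  consider "2 * (\<Delta> - U) < (2 * r + 1) * (3 * U - 2 * \<Delta>)" | "(2 * r + 1) * (3 * U - 2 * \<Delta>) < 2 * (\<Delta> - U)"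
    using r_half by linarith
  then have "reducible S"
  proof cases
    case 1
    \<comment> \<open>With r + 1 outer places, one row on the second side has \<open>N = r\<close>
      and costs energy. Its last site \<open>u (a + 1) b\<close> supports a longer row on the first
      side.\<close>
    define f where "f k = u (a + 1) (b - int r + int k)" for k
    define g where "g k = d (a + 1) (b - int r + int k)" for k
    have f: "f k \<in> hexagon L" "f k \<notin> S" if "k \<le> r" for k
      using side'(1)[of "int r - int k"] that by (auto simp: f_def R_def algebra_simps)
    have g: "g k \<in> hexagon L" "g k \<notin> S" if "k < r" for k
    proof -
      show "g k \<in> hexagon L"
        using f(1)[of k] f(1)[of "Suc k"] that by (auto simp: f_def g_def hex_u hex_d)
      show "g k \<notin> S"
        using side'(1)[of "int r - 1 - int k"] that by (auto simp: g_def R_def algebra_simps)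
    qed
    have fg: "nn (f k) (g k)" "nn (g k) (f (Suc k))" for k
      by (simp_all add: f_def g_def nn_d u_inj)
    have att: "\<exists>z\<in>S. nn z (f k)" if "k \<le> r" for k
    proof
      show "nn (d a (b - int r + int k)) (f k)" by (simp add: f_def)
      show "d a (b - int r + int k) \<in> S"
        using side'(1)[of "int r - int k"] that by (auto simp: R_def algebra_simps)
    qed
    have exit: "nn (f r) (d (a + 1) b)" by (simp add: f_def)
    have out: "f ` {..r} \<union> g ` {..<r} \<subseteq> outer'"
    proof -
      have "f k \<in> outer'" if "k \<le> r" for k
        unfolding f_def outer' by (intro UnI1 CollectI exI[of _ "int r - int k"]) (use that in \<open>auto simp: u_inj\<close>)
      moreover have "g k \<in> outer'" if "k < r" for k
        unfolding g_def outer' by (intro UnI2 CollectI exI[of _ "int r - int k - 1"]) (use that in \<open>auto simp: d_inj\<close>)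
      ultimately show ?thesis by auto
    qed
    have acc: "acc L (S \<union> (f ` {..r} \<union> g ` {..<r})) (d (a + 1) b)"
      using out by (intro acc_antimono[OF accC']) auto
    have inj: "inj_on f {..r}" "inj_on g {..<r}" "f k \<noteq> g l" for k l
      using u_neq_d by (auto simp: inj_on_def f_def g_def u_inj d_inj)
    define S1 where "S1 = S \<union> (f ` {..r} \<union> g ` {..<r})"
    note step1 = grow_strip[OF S_hex inj f g fg att exit acc, folded S1_def]
    have S1_hex: "S1 \<subseteq> hexagon L" using S_hex f g by (auto simp: S1_def)
    \<comment> \<open>Thanks to the new particle \<open>f r\<close>, the row in front of the first
      side can begin one place further out, at \<open>d (a + 1) b\<close>, and reaches
      \<open>N = r + 1\<close>.\<close>
    define f2 where "f2 k = d (a + 1 - int k) (b + int k)" for k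
    define g2 where "g2 k = u (a + 1 - int k) (b + 1 + int k)" for k
    have f2: "f2 k \<in> hexagon L" "f2 k \<notin> S1" if "k \<le> r + 1" for k
    proof -
      have "f2 k \<in> hexagon L \<and> f2 k \<notin> S"
      proof (cases "k = 0")
        case True then show ?thesis using hexD DR by (simp add: f2_def)
      next
        case False
        then show ?thesis using D(1,3)[of "R - int k"] that by (auto simp: f2_def ij R_def algebra_simps)
      qed
      moreover have "f2 k \<notin> f ` {..r} \<union> g ` {..<r}"
        using u_neq_d[symmetric] by (auto simp: f2_def f_def g_def d_inj)
      ultimately show "f2 k \<in> hexagon L" "f2 k \<notin> S1" by (auto simp: S1_def)
    qed
    have g2: "g2 k \<in> hexagon L" "g2 k \<notin> S1" if "k < r + 1" for k
    proof -
      show "g2 k \<in> hexagon L"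
        using f2(1)[of k] f2(1)[of "Suc k"] that by (auto simp: f2_def g2_def hex_u hex_d)
      have "g2 k \<notin> S" using C(2)[of "int r - int k"] that by (auto simp: g2_def ij R_def algebra_simps)
      moreover have "g2 k \<notin> f ` {..r} \<union> g ` {..<r}"
        using u_neq_d by (auto simp: g2_def f_def g_def u_inj)
      ultimately show "g2 k \<notin> S1" by (auto simp: S1_def)
    qed
    have fg2: "nn (f2 k) (g2 k)" "nn (g2 k) (f2 (Suc k))" for k
      by (simp_all add: f2_def g2_def nn_u nn_d u_inj d_inj)
    have att2: "\<exists>z\<in>S1. nn z (f2 k)" if "k \<le> r + 1" for k
    proof (cases "k = 0")
      case True
      have "f r \<in> S1" by (auto simp: S1_def)
      then show ?thesis using exit True by (auto simp: f2_def)
    next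
      case False
      have "u (a + 1 - int k) (b + int k) \<in> S1"
        using A[of "R - int k"] False that by (auto simp: S1_def ij R_def algebra_simps)
      then show ?thesis by (intro bexI[of _ "u (a + 1 - int k) (b + int k)"]) (auto simp: f2_def)
    qed
    have exit2: "nn (f2 (r + 1)) (u i (j + 1))" by (simp add: f2_def ij R_def nn_d u_inj)
    have acc2: "acc L (S1 \<union> (f2 ` {..r + 1} \<union> g2 ` {..<r + 1})) (u i (j + 1))"
    proof (rule acc_above(2)[OF _ _ C_Lam])
      show "u p q \<notin> S1 \<union> (f2 ` {..r + 1} \<union> g2 ` {..<r + 1}) \<and>
        d p q \<notin> S1 \<union> (f2 ` {..r + 1} \<union> g2 ` {..<r + 1})" if "q > j" for p q
        using above[OF that] that
        by (auto simp: S1_def f_def g_def f2_def g2_def ij R_def u_inj d_inj u_neq_d u_neq_d[symmetric])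
    qed simp
    have inj2: "inj_on f2 {..r + 1}" "inj_on g2 {..<r + 1}" "f2 k \<noteq> g2 l" for k l
      using u_neq_d[symmetric] by (auto simp: inj_on_def f2_def g2_def u_inj d_inj)
    note step2 = grow_strip[OF S1_hex inj2 f2 g2 fg2 att2 exit2 acc2]
    show ?thesis
      by (rule reducible_grow_twice[OF step1 step2(1) _ _ 1])
        (use step2(2) S1_hex f2(1) g2(1) in auto)
  next
    case 2
    define f where "f k = d (i + int k - 1) (j - int k)" for k
    define g where "g k = u (i + int k) (j - int k)" for k
    have f: "f k \<in> S" if "k \<le> r + 1" for k
    proof (cases "k = r + 1")
      case True then show ?thesis using B0 by (simp add: f_def ij R_def)
    next
      case False
      then show ?thesis using I(1)[of "int k"] that by (auto simp: f_def R_def)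
    qed
    have g: "g k \<in> S" if "k < r + 1" for k
      using A[of "int k"] that by (auto simp: g_def R_def)
    have fg: "nn (f k) (g k)" "nn (g k) (f (Suc k))" for k
      by (simp_all add: f_def g_def nn_u nn_d u_inj d_inj)
    have e: "\<exists>z. z \<notin> S \<and> nn z (g k)" if "k < r + 1" for k
      by (rule exI[of _ "d (i + int k) (j - int k)"]) (use D(3)[of "int k"] that in \<open>auto simp: g_def R_def\<close>)
    have e': "\<exists>z. z \<notin> S \<and> nn z (f (r + 1))"
      by (rule exI[of _ "u (a + 1) b"]) (use AR in \<open>auto simp: f_def ij R_def\<close>)
    have exit: "nn (f 0) (u (i - 1) (j + 1))" by (simp add: f_def)
    have acc: "acc L S (u (i - 1) (j + 1))" using accA I(1)[of 0] rR by simp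
    have inj: "inj_on f {..r + 1}" "inj_on g {..<r + 1}" "f k \<noteq> g l" for k l
      using u_neq_d[symmetric] by (auto simp: inj_on_def f_def g_def u_inj d_inj)
    define S1 where "S1 = S - (f ` {..r + 1} \<union> g ` {..<r + 1})"
    note step1 = shrink_strip[OF S_hex inj le_add2 f g fg e e' exit acc, folded S1_def]
    have S1_hex: "S1 \<subseteq> hexagon L" using S_hex by (auto simp: S1_def)
    \<comment> \<open>The first removal took \<open>d a b\<close> along, so the row behind the
      second side is one place shorter and opens where \<open>d a b\<close> stood.\<close>
    define f2 where "f2 k = u a (b - int k)" for k
    define g2 where "g2 k = d a (b - int k - 1)" for k
    have f2: "f2 k \<in> S1" if "k \<le> r" for k
    proof -
      have "f2 k \<in> S" using side'(1)[of "int k"] that by (auto simp: f2_def R_def)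
      moreover have "f2 k \<notin> f ` {..r + 1} \<union> g ` {..<r + 1}"
        using u_neq_d by (auto simp: f2_def f_def g_def u_inj ij R_def)
      ultimately show ?thesis by (simp add: S1_def)
    qed
    have g2: "g2 k \<in> S1" if "k < r" for k
    proof -
      have "g2 k \<in> S" using side'(1)[of "int k + 1"] that by (auto simp: g2_def R_def algebra_simps)
      moreover have "g2 k \<notin> f ` {..r + 1} \<union> g ` {..<r + 1}"
        using u_neq_d[symmetric] by (auto simp: g2_def f_def g_def d_inj ij R_def)
      ultimately show ?thesis by (simp add: S1_def)
    qed
    have fg2: "nn (f2 k) (g2 k)" "nn (g2 k) (f2 (Suc k))" for k
      by (simp_all add: f2_def g2_def nn_u nn_d u_inj d_inj)
    have e2: "\<exists>z. z \<notin> S1 \<and> nn z (g2 k)" if "k < r" for k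
      by (rule exI[of _ "u (a + 1) (b - int k - 1)"])
        (use side'(1)[of "int k + 1"] that in \<open>auto simp: g2_def S1_def R_def nn_u d_inj algebra_simps\<close>)
    have e2': "\<exists>z. z \<notin> S1 \<and> nn z (f2 r)"
      by (rule exI[of _ "d a (b - R)"]) (use side'(2) in \<open>auto simp: f2_def S1_def R_def nn_d u_inj\<close>)
    have exit2: "nn (f2 0) (d a b)" by (simp add: f2_def)
    have "d a b = f (r + 1)" by (simp add: f_def ij R_def)
    then have nS1: "d a b \<notin> S1" by (auto simp: S1_def)
    have acc2: "acc L S1 (d a b)"
      by (rule acc_neighbour[OF _ acc_antimono[OF accAR] nS1])
        (use B0 S_hex in \<open>auto simp: S1_def\<close>)
    have inj2: "inj_on f2 {..r}" "inj_on g2 {..<r}" "f2 k \<noteq> g2 l" for k l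
      using u_neq_d by (auto simp: inj_on_def f2_def g2_def u_inj d_inj)
    note step2 = shrink_strip[OF S1_hex inj2 r_ge_1 f2 g2 fg2 e2 e2' exit2 acc2]
    show ?thesis
      by (rule reducible_shrink_twice[OF _ _ step2 _ 2]) (use step1 S1_hex in auto)
  qed
  then show False using irreducible by blast
qed

section \<open>Clusters that touch the border of the hexagon\<close>

text \<open>
  A particle on the top border cannot be followed by a corner, so it forces the whole top row,
  and with it the first site of the next border.
\<close>

lemma top_row_right:
  assumes "d i (int L - 1) \<in> S" "i + int n < 0"
  shows "d (i + int n) (int L - 1) \<in> S" "u (i + int n) (int L - 1) \<in> S" "u (i + int n + 1) (int L - 1) \<in> S"
proof -
  have above: "u p q \<notin> S \<and> d p q \<notin> S" if "q > int L - 1" for p q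
    using S_hex that hex_u[of p q] hex_d[of p q] by auto
  \<comment> \<open>The neighbour above lies outside the hexagon, hence is vacant and accessible;
    \<open>frozen_occupied\<close> then forces the other two neighbours.\<close>
  have row: "u k (int L - 1) \<in> S \<and> u (k + 1) (int L - 1) \<in> S" if d: "d k (int L - 1) \<in> S" for k
  proof -
    have "u k (int L) \<in> Lam L" using nn_hexagon_Lam[of "d k (int L - 1)" L "u k (int L)"] d S_hex by (auto simp: nn_u d_inj)
    then have "acc L S (u k (int L))" using acc_above(2)[of "int L - 1" S "int L" k, OF above] by auto
    from frozen_occupied[OF this _ d] show ?thesis by (auto simp: nn_u nn_d u_inj d_inj)
  qed
  have d: "d (i + int n) (int L - 1) \<in> S"
    using assms(2)
  proof (induction n)
    case 0
    then show ?case using assms(1) by simp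
  next
    case (Suc n)
    have IH: "d (i + int n) (int L - 1) \<in> S" using Suc by simp
    show ?case
    proof (rule ccontr)
      assume n: "d (i + int (Suc n)) (int L - 1) \<notin> S"
      have "d (i + int n) (int L - 1) \<in> hexagon L" using IH S_hex by auto
      then have "d (i + int n + 1) (int L - 1) \<in> hexagon L" using Suc.prems by (auto simp: hex_d)
      moreover have "u (i + int n + 1) (int L - 1) \<in> S" using row[OF IH] by simp
      ultimately show False using no_corner[of "int L - 1" "i + int n + 1", OF above] n by (auto simp: add_ac)
    qed
  qed
  then show "d (i + int n) (int L - 1) \<in> S" "u (i + int n) (int L - 1) \<in> S" "u (i + int n + 1) (int L - 1) \<in> S"
    using row by auto
qed

text \<open>To the right of \<open>d i\<close> this is the previous lemma, to the left its mirror
  image. The end \<open>u 0 (int L - 1)\<close> has coordinate sum L - 1 and so already lies on the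
  next border.\<close>

lemma top_row:
  assumes "d i (int L - 1) \<in> S"
  shows "(\<forall>k. - int L \<le> k \<longrightarrow> k < 0 \<longrightarrow> d k (int L - 1) \<in> S) \<and> u 0 (int L - 1) \<in> S"
proof -
  interpret mir: frozen_cluster L U \<Delta> r "\<lambda>i j. u (- i - j - 1) j" "\<lambda>i j. d (- i - j - 2) j" S
    by (rule mirrored)
  have i: "- int L \<le> i" "i < 0" using assms S_hex hex_d[of i "int L - 1"] by auto
  have "d k (int L - 1) \<in> S" if "- int L \<le> k" "k < 0" for k
  proof (cases "i \<le> k")
    case True
    then show ?thesis using top_row_right(1)[OF assms, of "nat (k - i)"] that by simp
  next
    case False
    have "d (- (- i - int L - 1) - (int L - 1) - 2) (int L - 1) \<in> S" using assms by simp
    from mir.top_row_right(1)[OF this, of "nat (i - k)"] show ?thesis using False that i by simp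
  qed
  moreover have "u 0 (int L - 1) \<in> S" using top_row_right(3)[OF assms, of "nat (- i - 1)"] i by simp
  ultimately show ?thesis by blast
qed

text \<open>The six families are the top row written in the coordinates of the successive rotations,
  so a fact about any of them is a rotated fact about the first.\<close>

lemma border_cases:
  assumes "x \<in> hexagon L" "nn x y" "y \<notin> hexagon L"
  obtains k where "x = d k (int L - 1)" "- int L \<le> k" "k < 0"
    | k where "x = u (k + int L) (- k - 1)" "- int L \<le> k" "k < 0"
    | k where "x = d (int L - 1) (- k - int L - 1)" "- int L \<le> k" "k < 0"
    | k where "x = u (- k - 1) (- int L)" "- int L \<le> k" "k < 0"
    | k where "x = d (- k - int L - 1) k" "- int L \<le> k" "k < 0"
    | k where "x = u (- int L) (k + int L)" "- int L \<le> k" "k < 0"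
proof -
  note that' = that
  obtain i j where "x = u i j \<or> x = d i j" using exhaust by blast
  then show thesis
  proof
    assume x: "x = u i j"
    then consider "i + j = int L - 1" | "i = - int L" | "j = - int L"
      using assms by (auto simp: nn_u hex_u hex_d)
    then show thesis
    proof cases
      case 1 then show thesis using assms(1) x by (intro that'(2)[of "i - int L"]) (auto simp: hex_u u_inj)
    next
      case 2 then show thesis using assms(1) x by (intro that'(6)[of "j - int L"]) (auto simp: hex_u u_inj)
    next
      case 3 then show thesis using assms(1) x by (intro that'(4)[of "- i - 1"]) (auto simp: hex_u u_inj)
    qed
  next
    assume x: "x = d i j"
    then consider "j = int L - 1" | "i = int L - 1" | "i + j = - int L - 1"
      using assms by (auto simp: nn_d hex_u hex_d)
    then show thesis
    proof cases
      case 1 then show thesis using assms(1) x by (intro that'(1)[of i]) (auto simp: hex_d d_inj)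
    next
      case 2 then show thesis using assms(1) x by (intro that'(3)[of "- j - int L - 1"]) (auto simp: hex_d d_inj)
    next
      case 3 then show thesis using assms(1) x by (intro that'(5)[of j]) (auto simp: hex_d d_inj)
    qed
  qed
qed

lemma rotated2: "frozen_cluster L U \<Delta> r (\<lambda>p q. u q (- p - q - 1)) (\<lambda>p q. d q (- p - q - 2)) S"
proof -
  interpret rot: frozen_cluster L U \<Delta> r "\<lambda>p q. d (p + q) (- p - 1)" "\<lambda>p q. u (p + q + 1) (- p - 1)" S
    by (rule rotated)
  show ?thesis using rot.rotated by (simp add: algebra_simps)
qed

lemma top_row2:
  assumes "d i (int L - 1) \<in> S \<or> u (i + int L) (- i - 1) \<in> S"
  shows "\<forall>k. - int L \<le> k \<longrightarrow> k < 0 \<longrightarrow> u (k + int L) (- k - 1) \<in> S" "d (int L - 1) (- 1) \<in> S"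
proof -
  interpret rot: frozen_cluster L U \<Delta> r "\<lambda>p q. d (p + q) (- p - 1)" "\<lambda>p q. u (p + q + 1) (- p - 1)" S
    by (rule rotated)
  have "\<exists>k. u (k + (int L - 1) + 1) (- k - 1) \<in> S"
  proof (cases "d i (int L - 1) \<in> S")
    case True
    then show ?thesis using top_row[of i] by (intro exI[of _ "- int L"]) simp
  next
    case False
    then show ?thesis using assms by (intro exI[of _ i]) simp
  qed
  then obtain k where "u (k + (int L - 1) + 1) (- k - 1) \<in> S" ..
  from rot.top_row[OF this]
  show "\<forall>k. - int L \<le> k \<longrightarrow> k < 0 \<longrightarrow> u (k + int L) (- k - 1) \<in> S" "d (int L - 1) (- 1) \<in> S"
    by simp_all
qed

lemma border_dichotomy:
  assumes x: "x \<in> S" "nn x y" "y \<notin> hexagon L"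
    and z: "z \<in> hexagon L" "nn z w" "w \<notin> hexagon L"
  shows "z \<in> S"
proof -
  interpret r2: frozen_cluster L U \<Delta> r "\<lambda>p q. u q (- p - q - 1)" "\<lambda>p q. d q (- p - q - 2)" S
    by (rule rotated2)
  interpret r4: frozen_cluster L U \<Delta> r "\<lambda>p q. u (- p - q - 1) p" "\<lambda>p q. d (- p - q - 2) p" S
    using r2.rotated2 by (simp add: algebra_simps)
  let ?E = "\<lambda>f. \<forall>k. - int L \<le> k \<longrightarrow> k < 0 \<longrightarrow> f k \<in> S"
  have a0: "?E (\<lambda>k. d k (int L - 1))" if "d i (int L - 1) \<in> S" for i
    using top_row[OF that] by simp
  have a1: "?E (\<lambda>k. u (k + int L) (- k - 1))" "d (int L - 1) (- 1) \<in> S"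
    if "d i (int L - 1) \<in> S \<or> u (i + int L) (- i - 1) \<in> S" for i
    using top_row2[OF that] by auto
  have a2: "?E (\<lambda>k. d (int L - 1) (- k - int L - 1))" if "d (int L - 1) i \<in> S" for i
    using r2.top_row[of "- i - int L - 1"] that by simp
  have a3: "?E (\<lambda>k. u (- k - 1) (- int L))" "d (- 1) (- int L) \<in> S" 
    if "d (int L - 1) i \<in> S \<or> u i (- int L) \<in> S" for i
    using r2.top_row2[of "- i - 1"] r2.top_row2[of "- i - int L - 1"] that by auto
  have a4: "?E (\<lambda>k. d (- k - int L - 1) k)" if "d (- i - int L - 1) i \<in> S" for i
    using r4.top_row[of i] that by simp
  have a5: "?E (\<lambda>k. u (- int L) (k + int L))" "d (- int L) (int L - 1) \<in> S"
    if "d (- i - int L - 1) i \<in> S \<or> u (- int L) (i + int L) \<in> S" for i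
    using r4.top_row2[of i] that by auto
  have x_hex: "x \<in> hexagon L" using x(1) S_hex by auto
  \<comment> \<open>Occupation is passed on clockwise from border to border until it reaches this
    corner of the top row; one full turn from there covers all six borders.\<close>
  have X0: "d (- int L) (int L - 1) \<in> S"
    using border_cases[OF x_hex x(2,3)]
  proof cases
    case a: (1 k)
    then show ?thesis using x(1) a5(2)[of "- int L"] a3(2)[of "- 1"] a1(2)[of k] by simp
  next
    case a: (2 k)
    then show ?thesis using x(1) a5(2)[of "- int L"] a3(2)[of "- 1"] a1(2)[of k] by simp
  next
    case a: (3 k)
    then show ?thesis using x(1) a5(2)[of "- int L"] a3(2)[of "- k - int L - 1"] by simp
  next
    case a: (4 k)
    then show ?thesis using x(1) a5(2)[of "- int L"] a3(2)[of "- k - 1"] by simp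
  next
    case a: (5 k)
    then show ?thesis using x(1) a5(2)[of k] by simp
  next
    case a: (6 k)
    then show ?thesis using x(1) a5(2)[of k] by simp
  qed
  have X2: "d (int L - 1) (- 1) \<in> S" using a1(2) X0 by blast
  then have X4: "d (- 1) (- int L) \<in> S" using a3(2) by blast
  then have X4: "d (- (- int L) - int L - 1) (- int L) \<in> S" by simp
  note E = a0[OF X0] a1(1)[OF disjI1[OF X0]] a2[OF X2] a3(1)[OF disjI1[OF X2]] a4[OF X4] a5(1)[OF disjI1[OF X4]]
  show ?thesis using border_cases[OF z] by cases (use E in simp_all)
qed

section \<open>Extreme sites and the end of the geometric argument\<close>

text \<open>Used for the particles and, when the border is full, for the vacancies: the surroundings
  of the extreme site above and to the right are then known.\<close>

lemma top_right_site:
  assumes "Z \<subseteq> hexagon L" "Z \<noteq> {}"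
  obtains p q where "\<And>p' q'. q' > q \<Longrightarrow> u p' q' \<notin> Z \<and> d p' q' \<notin> Z"
    "u p q \<in> Z \<and> d p q \<notin> Z \<or> d p q \<in> Z \<and> u (p + 1) q \<notin> Z"
proof -
  define Q where "Q = {q. \<exists>p. u p q \<in> Z \<or> d p q \<in> Z}"
  have Z: "- int L \<le> p \<and> p < int L \<and> - int L \<le> q \<and> q < int L" if "u p q \<in> Z \<or> d p q \<in> Z" for p q
    using that assms(1) hex_u[of p q] hex_d[of p q] by auto
  have "Q \<subseteq> {- int L..int L}"
    using Z by (force simp: Q_def)
  then have finQ: "finite Q" by (rule finite_subset) simp
  obtain x where "x \<in> Z" using assms(2) by blast
  then have neQ: "Q \<noteq> {}" using exhaust[of x] by (auto simp: Q_def)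
  define q where "q = Max Q"
  have q: "q \<in> Q" using Max_in[OF finQ neQ] by (simp add: q_def)
  have above: "u p' q' \<notin> Z \<and> d p' q' \<notin> Z" if "q' > q" for p' q'
    using Max_ge[OF finQ, of q'] that by (auto simp: Q_def q_def)
  \<comment> \<open>Horizontal positions in the row: faces alternate from left to right, with
    \<open>u p q\<close> at 2 p and \<open>d p q\<close> at 2 p + 1.\<close>
  define W where "W = {t. \<exists>p. t = 2 * p \<and> u p q \<in> Z \<or> t = 2 * p + 1 \<and> d p q \<in> Z}"
  have "W \<subseteq> {- 2 * int L..2 * int L + 1}"
    using Z by (force simp: W_def)
  then have finW: "finite W" by (rule finite_subset) simp
  have neW: "W \<noteq> {}" using q by (auto simp: Q_def W_def)
  have max: "Max W \<in> W" "\<And>t. t \<in> W \<Longrightarrow> t \<le> Max W" using Max_in[OF finW neW] Max_ge[OF finW] by auto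
  from max(1) obtain p where "Max W = 2 * p \<and> u p q \<in> Z \<or> Max W = 2 * p + 1 \<and> d p q \<in> Z"
    by (auto simp: W_def)
  then have "u p q \<in> Z \<and> d p q \<notin> Z \<or> d p q \<in> Z \<and> u (p + 1) q \<notin> Z"
  proof -
    have "2 * p' \<le> Max W" if "u p' q \<in> Z" for p'
      by (rule max(2)) (use that in \<open>auto simp: W_def\<close>)
    moreover have "2 * p' + 1 \<le> Max W" if "d p' q \<in> Z" for p'
      by (rule max(2)) (use that in \<open>auto simp: W_def\<close>)
    ultimately show ?thesis
      using \<open>Max W = 2 * p \<and> u p q \<in> Z \<or> Max W = 2 * p + 1 \<and> d p q \<in> Z\<close> by force
  qed
  with above show thesis by (rule that)
qed

text \<open>All hexagon sites above are occupied, so the hole rises through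
  \<open>u p (q + 1)\<close>, \<open>d p (q + 1)\<close> and so on until it leaves the
  hexagon.\<close>

lemma wall_column:
  assumes "\<And>p' q'. q' > q \<Longrightarrow> (u p' q' \<in> hexagon L \<longrightarrow> u p' q' \<in> T) \<and> (d p' q' \<in> hexagon L \<longrightarrow> d p' q' \<in> T)"
    and "d p q \<in> T" "d p q \<in> hexagon L"
  shows "wall L T (d p q)"
  using assms
proof (induction "nat (int L - q)" arbitrary: q rule: less_induct)
  case less
  show ?case
  proof (cases "u p (q + 1) \<in> hexagon L")
    case False
    then show ?thesis using less.prems by (intro wall.exit[of _ _ _ "u p (q + 1)"]) auto
  next
    case True
    then have uT: "u p (q + 1) \<in> T" using less.prems(1)[of "q + 1" p] by simp
    have "wall L T (u p (q + 1))"
    proof (cases "d p (q + 1) \<in> hexagon L")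
      case False
      then show ?thesis using uT True by (intro wall.exit[of _ _ _ "d p (q + 1)"]) auto
    next
      case d: True
      have "wall L T (d p (q + 1))"
      proof (rule less.hyps)
        show "nat (int L - (q + 1)) < nat (int L - q)" using d by (auto simp: hex_d)
        show "d p (q + 1) \<in> T" using less.prems(1)[of "q + 1" p] d by simp
      qed (use less.prems(1) d in auto)
      then show ?thesis by (intro wall.step[OF uT nn_simps(1)])
    qed
    then show ?thesis by (intro wall.step[OF less.prems(2) nn_simps(4)])
  qed
qed

lemma frozen_trivial: "S = {} \<or> S = hexagon L"
proof (cases "\<exists>x\<in>S. \<exists>y. nn x y \<and> y \<notin> hexagon L")
  case True
  then obtain x y where xy: "x \<in> S" "nn x y" "y \<notin> hexagon L" by blast
  \<comment> \<open>By \<open>border_dichotomy\<close> no border site is vacant, so all neighbours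
    of a vacant hexagon site lie in the hexagon.\<close>
  have border: "y \<in> hexagon L" if "z \<in> hexagon L" "z \<notin> S" "nn z y" for z y
    using border_dichotomy[OF xy that(1,3)] that(2) by blast
  show ?thesis
  proof (rule ccontr)
    assume "\<not> ?thesis"
    then have "hexagon L - S \<noteq> {}" using S_hex by auto
    from top_right_site[OF Diff_subset this]
    obtain p q where above: "\<And>p' q'. q' > q \<Longrightarrow> u p' q' \<notin> hexagon L - S \<and> d p' q' \<notin> hexagon L - S"
      and pq: "u p q \<in> hexagon L - S \<and> d p q \<notin> hexagon L - S \<or> d p q \<in> hexagon L - S \<and> u (p + 1) q \<notin> hexagon L - S"
      by metis
    have column: "wall L T (d p' q)" if "S \<subseteq> T" "d p' q \<in> T" "d p' q \<in> hexagon L" for p' T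
      using above that by (intro wall_column) auto
    from pq show False
    proof
      assume u: "u p q \<in> hexagon L - S \<and> d p q \<notin> hexagon L - S"
      have dS: "d p q \<in> S" using border[of "u p q" "d p q"] u by auto
      have d'_hex: "d (p - 1) q \<in> hexagon L" using border[of "u p q" "d (p - 1) q"] u by auto
      have wall_u: "wall L (insert (u p q) T) (u p q)" if "S \<subseteq> T" for T
      proof (rule wall.step)
        show "wall L (insert (u p q) T) (d p q)" using that dS S_hex by (intro column) auto
      qed auto
      show False
      proof (cases "d (p - 1) q \<in> S")
        case True
        then have "deg S (u p q) \<ge> 2"
          using dS by (intro deg_ge_2[of "d p q" _ _ "d (p - 1) q"]) (auto simp: d_inj)
        then show False using reducible_wall_fill[OF S_hex _ _ wall_u] u irreducible by auto
      next
        case False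
        \<comment> \<open>\<open>d (p - 1) q\<close> is vacant as well, but has a particle above it.
          It is filled through its own column, then \<open>u p q\<close> through the column of
          \<open>d p q\<close>.\<close>
        have "u (p - 1) (q + 1) \<in> hexagon L" using border[OF d'_hex False, of "u (p - 1) (q + 1)"] by simp
        then have "u (p - 1) (q + 1) \<in> S" using above[of "q + 1" "p - 1"] by simp
        then have deg: "deg S (d (p - 1) q) \<ge> 1" "deg S (u p q) \<ge> 1"
          using deg_ge_1[of "u (p - 1) (q + 1)" S "d (p - 1) q"] deg_ge_1[OF dS, of "u p q"] by simp_all
        have "wall L (insert (d (p - 1) q) S) (d (p - 1) q)" using d'_hex by (intro column) auto
        then show False
          using reducible_wall_pair[OF S_hex d'_hex _ False _ _ _ wall_u deg] u irreducible by auto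
      qed
    next
      assume d: "d p q \<in> hexagon L - S \<and> u (p + 1) q \<notin> hexagon L - S"
      have "u (p + 1) q \<in> S" using border[of "d p q" "u (p + 1) q"] d by auto
      moreover have "u p (q + 1) \<in> S"
        using border[of "d p q" "u p (q + 1)"] d above[of "q + 1" p] by auto
      ultimately have "deg S (d p q) \<ge> 2"
        by (intro deg_ge_2[of "u (p + 1) q" _ _ "u p (q + 1)"]) (auto simp: u_inj)
      moreover have "wall L (insert (d p q) S) (d p q)" using d by (intro column) auto
      ultimately show False using reducible_wall_fill[OF S_hex] d irreducible by auto
    qed
  qed
next
  case False
  then have inner: "y \<in> hexagon L" if "x \<in> S" "nn x y" for x y using that by blast
  show ?thesis
  proof (rule ccontr)
    assume "\<not> ?thesis"
    then have "S \<noteq> {}" by blast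
    from top_right_site[OF S_hex this]
    obtain p q where above: "\<And>p' q'. q' > q \<Longrightarrow> u p' q' \<notin> S \<and> d p' q' \<notin> S"
      and pq: "u p q \<in> S \<and> d p q \<notin> S \<or> d p q \<in> S \<and> u (p + 1) q \<notin> S"
      by metis
    from pq show False
    proof
      assume u: "u p q \<in> S \<and> d p q \<notin> S"
      \<comment> \<open>A particle there would have a neighbour outside the hexagon; this is the
        second alternative of \<open>border\<close> in \<open>no_corner\<close>.\<close>
      have "d (int L - 1) q' \<notin> S" for q'
        using inner[of "d (int L - 1) q'" "u (int L) q'"] by (auto simp: nn_d u_inj hex_u)
      then show False using no_corner[of q p, OF above] u inner[of "u p q" "d p q"] by auto
    next
      assume d: "d p q \<in> S \<and> u (p + 1) q \<notin> S"
      have "u p (q + 1) \<in> Lam L" using inner[of "d p q" "u p (q + 1)"] d hexagon_subset_Lam[of L] by auto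
      then have "acc L S (u p (q + 1))" using acc_above(2)[of q S "q + 1" p, OF above] by auto
      \<comment> \<open>The extreme particle has a vacancy above and another to its right, so it
        could leave.\<close>
      from frozen_occupied[OF this _ _ _, of "d p q" "u (p + 1) q"] show False using d by (auto simp: u_inj)
    qed
  qed
qed

end

lemma (in critical_model) reducible_unless_trivial:
  assumes "S \<subseteq> Lam L" "S \<noteq> {}" "S \<noteq> hexagon L"
  shows "reducible S"
proof (rule ccontr)
  assume irr: "\<not> reducible S"
  have "S \<inter> Lam_bdry L = {}" using reducible_boundary_particle[OF assms(1)] irr by auto
  then have "S \<subseteq> hexagon L" using assms(1) Lam_bdry_eq[OF L_ge_1] by auto
  then interpret frozen_cluster L U \<Delta> r Up Down S
    by (intro frozen_cluster.intro critical_model_axioms kawasaki_coords.intro kawasaki_model_axioms hex_coords_Up_Down frozen_cluster_axioms.intro irr)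
  show False using frozen_trivial assms(2,3) by blast
qed

section \<open>Killed reversible chains\<close>

locale reversible_chain =
  fixes X B :: "'a set" and P :: "'a \<Rightarrow> 'a \<Rightarrow> real" and m :: "'a \<Rightarrow> real"
  assumes finite_X: "finite X" and B_sub: "B \<subseteq> X"
    and P_nonneg: "x \<in> X \<Longrightarrow> y \<in> X \<Longrightarrow> P x y \<ge> 0"
    and P_sum: "x \<in> X \<Longrightarrow> (\<Sum>y\<in>X. P x y) = 1"
    and m_pos: "x \<in> X \<Longrightarrow> m x > 0"
    and balance: "x \<in> X \<Longrightarrow> y \<in> X \<Longrightarrow> m x * P x y = m y * P y x"
begin

text \<open>For \<open>x \<in> B\<close>, the probability of staying in \<open>B\<close> during the first \<open>n\<close> steps.\<close>

primrec stay :: "nat \<Rightarrow> 'a \<Rightarrow> real" where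
  "stay 0 x = 1"
| "stay (Suc n) x = (\<Sum>y\<in>B. P x y * stay n y)"

definition dirichlet :: "('a \<Rightarrow> real) \<Rightarrow> real" where
  "dirichlet f = (\<Sum>x\<in>X. \<Sum>y\<in>X. m x * P x y * (f x - f y)\<^sup>2) / 2"

lemma finite_B: "finite B" using finite_X B_sub by (rule rev_finite_subset)

lemma B_X: "x \<in> B \<Longrightarrow> x \<in> X" using B_sub by blast

lemma stay_nonneg: "x \<in> B \<Longrightarrow> stay n x \<ge> 0"
  by (induction n arbitrary: x) (auto intro!: sum_nonneg mult_nonneg_nonneg P_nonneg B_X)

lemma stay_Suc_le: "x \<in> B \<Longrightarrow> stay (Suc n) x \<le> stay n x"
proof (induction n arbitrary: x)
  case 0
  have "(\<Sum>y\<in>B. P x y) \<le> (\<Sum>y\<in>X. P x y)"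
    using 0 B_sub P_nonneg finite_X by (intro sum_mono2) auto
  then show ?case using 0 B_sub P_sum[of x] by auto
next
  case (Suc n)
  have "(\<Sum>y\<in>B. P x y * stay (Suc n) y) \<le> (\<Sum>y\<in>B. P x y * stay n y)"
    by (intro sum_mono mult_left_mono Suc.IH P_nonneg B_X Suc.prems)
  then show ?case by (simp only: stay.simps(2))
qed

text \<open>Expanding the square, the two pure terms agree, one by the row sums and the other by
  detailed balance; the mixed term is the inner product of f with P f.\<close>

lemma dirichlet_eq:
  "dirichlet f = (\<Sum>x\<in>X. m x * (f x)\<^sup>2) - (\<Sum>x\<in>X. m x * f x * (\<Sum>y\<in>X. P x y * f y))"
proof -
  have 1: "(\<Sum>x\<in>X. \<Sum>y\<in>X. m x * P x y * (f x)\<^sup>2) = (\<Sum>x\<in>X. m x * (f x)\<^sup>2)"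
  proof (rule sum.cong[OF refl])
    fix x assume x: "x \<in> X"
    have "(\<Sum>y\<in>X. m x * P x y * (f x)\<^sup>2) = m x * (f x)\<^sup>2 * (\<Sum>y\<in>X. P x y)"
      unfolding sum_distrib_left by (rule sum.cong) auto
    then show "(\<Sum>y\<in>X. m x * P x y * (f x)\<^sup>2) = m x * (f x)\<^sup>2" using P_sum[OF x] by simp
  qed
  have 2: "(\<Sum>x\<in>X. \<Sum>y\<in>X. m x * P x y * (f y)\<^sup>2) = (\<Sum>x\<in>X. m x * (f x)\<^sup>2)"
  proof -
    have "(\<Sum>x\<in>X. \<Sum>y\<in>X. m x * P x y * (f y)\<^sup>2) = (\<Sum>y\<in>X. \<Sum>x\<in>X. m x * P x y * (f y)\<^sup>2)"
      by (rule sum.swap)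
    also have "\<dots> = (\<Sum>y\<in>X. \<Sum>x\<in>X. m y * P y x * (f y)\<^sup>2)"
      by (intro sum.cong refl) (simp only: balance)
    finally show ?thesis unfolding 1 .
  qed
  have 3: "(\<Sum>x\<in>X. \<Sum>y\<in>X. m x * P x y * (f x * f y)) = (\<Sum>x\<in>X. m x * f x * (\<Sum>y\<in>X. P x y * f y))"
    by (simp add: sum_distrib_left mult_ac)
  have "(\<Sum>x\<in>X. \<Sum>y\<in>X. m x * P x y * (f x - f y)\<^sup>2)
      = (\<Sum>x\<in>X. \<Sum>y\<in>X. m x * P x y * (f x)\<^sup>2 + m x * P x y * (f y)\<^sup>2 - 2 * (m x * P x y * (f x * f y)))"
    by (rule sum.cong[OF refl], rule sum.cong[OF refl]) (simp add: power2_eq_square algebra_simps)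
  also have "\<dots> = 2 * (\<Sum>x\<in>X. m x * (f x)\<^sup>2) - 2 * (\<Sum>x\<in>X. m x * f x * (\<Sum>y\<in>X. P x y * f y))"
    by (simp only: sum.distrib sum_subtractf 1 2 3 sum_distrib_left[symmetric])
  finally show ?thesis by (simp add: dirichlet_def)
qed

text \<open>Since \<open>stay n\<close> decreases in \<open>n\<close>, its square norm at time \<open>n + 1\<close> is at most the inner
  product of \<open>stay n\<close> and \<open>stay (n + 1)\<close>, that is the square norm at time \<open>n\<close> minus a
  Dirichlet form.  This avoids any discussion of negative eigenvalues.\<close>

lemma norm_stay_le:
  assumes K: "K > 0"
    and poincare: "\<And>f. (\<And>x. x \<in> X - B \<Longrightarrow> f x = 0) \<Longrightarrow> (\<Sum>x\<in>X. m x * (f x)\<^sup>2) \<le> K * dirichlet f"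
  shows "(\<Sum>x\<in>B. m x * (stay n x)\<^sup>2) \<le> exp (- real n / K) * (\<Sum>x\<in>X. m x)"
proof (induction n)
  case 0
  have "(\<Sum>x\<in>B. m x) \<le> (\<Sum>x\<in>X. m x)"
    using m_pos finite_X B_sub by (intro sum_mono2) (auto intro: less_imp_le)
  then show ?case by simp
next
  case (Suc n)
  \<comment> \<open>Extension by zero turns sums over \<open>B\<close> into sums over
    \<open>X\<close> and satisfies the hypothesis of the Poincare inequality.\<close>
  define f where "f x = (if x \<in> B then stay n x else 0)" for x
  have restr: "(\<Sum>x\<in>X. g x * f x) = (\<Sum>x\<in>B. g x * stay n x)" for g
    using B_sub finite_X by (intro sum.mono_neutral_cong_right) (auto simp: f_def)
  have sq: "(\<Sum>x\<in>X. m x * (f x)\<^sup>2) = (\<Sum>x\<in>B. m x * (stay n x)\<^sup>2)"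
    using B_sub finite_X by (intro sum.mono_neutral_cong_right) (auto simp: f_def)
  have "(\<Sum>x\<in>X. m x * f x * (\<Sum>y\<in>X. P x y * f y)) = (\<Sum>x\<in>X. (m x * (\<Sum>y\<in>X. P x y * f y)) * f x)"
    by (simp add: mult_ac)
  also have "\<dots> = (\<Sum>x\<in>B. m x * stay (Suc n) x * stay n x)"
    unfolding restr by (simp add: restr)
  finally have inner: "(\<Sum>x\<in>X. m x * f x * (\<Sum>y\<in>X. P x y * f y)) = (\<Sum>x\<in>B. m x * stay (Suc n) x * stay n x)" .
  have "(\<Sum>x\<in>B. m x * (stay (Suc n) x)\<^sup>2) \<le> (\<Sum>x\<in>B. m x * stay (Suc n) x * stay n x)"
  proof (rule sum_mono)
    fix x assume x: "x \<in> B"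
    have "m x * stay (Suc n) x * stay (Suc n) x \<le> m x * stay (Suc n) x * stay n x"
      using x B_sub m_pos[of x] stay_nonneg[OF x, of "Suc n"] stay_Suc_le[OF x]
      by (intro mult_left_mono mult_nonneg_nonneg) auto
    then show "m x * (stay (Suc n) x)\<^sup>2 \<le> m x * stay (Suc n) x * stay n x"
      by (simp only: power2_eq_square mult.assoc)
  qed
  also have "\<dots> = (\<Sum>x\<in>B. m x * (stay n x)\<^sup>2) - dirichlet f"
    unfolding dirichlet_eq sq inner by simp
  also have "\<dots> \<le> (1 - 1 / K) * (\<Sum>x\<in>B. m x * (stay n x)\<^sup>2)"
  proof -
    have "(\<Sum>x\<in>X. m x * (f x)\<^sup>2) \<le> K * dirichlet f" by (rule poincare) (simp add: f_def)
    then show ?thesis using K unfolding sq by (simp add: field_simps)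
  qed
  also have "\<dots> \<le> exp (- 1 / K) * (\<Sum>x\<in>B. m x * (stay n x)\<^sup>2)"
    using exp_ge_add_one_self[of "- 1 / K"] B_sub m_pos
    by (intro mult_right_mono sum_nonneg) (auto intro!: mult_nonneg_nonneg less_imp_le[OF m_pos])
  also have "\<dots> \<le> exp (- 1 / K) * (exp (- real n / K) * (\<Sum>x\<in>X. m x))"
    using Suc by (intro mult_left_mono) auto
  also have "\<dots> = exp (- real (Suc n) / K) * (\<Sum>x\<in>X. m x)"
    by (simp add: exp_add[symmetric] add_divide_distrib diff_divide_distrib)
  finally show ?case .
qed

lemma stay_bound:
  assumes "K > 0" "\<And>f. (\<And>x. x \<in> X - B \<Longrightarrow> f x = 0) \<Longrightarrow> (\<Sum>x\<in>X. m x * (f x)\<^sup>2) \<le> K * dirichlet f"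
    and x: "x \<in> B"
  shows "m x * (stay n x)\<^sup>2 \<le> exp (- real n / K) * (\<Sum>x\<in>X. m x)"
proof -
  have "m x * (stay n x)\<^sup>2 \<le> (\<Sum>x\<in>B. m x * (stay n x)\<^sup>2)"
    using x finite_B B_sub m_pos by (intro member_le_sum) (auto intro!: mult_nonneg_nonneg less_imp_le[OF m_pos])
  also note norm_stay_le[OF assms(1,2)]
  finally show ?thesis .
qed

text \<open>The factor \<open>stay k\<close> serves the induction: the last step of a trajectory is
  summed into it, so n falls while k rises. The application has \<open>k = 0\<close>.\<close>

lemma sum_trajectories:
  assumes "s \<in> B"
  shows "(\<Sum>p\<in>Pi\<^sub>E {..n} (\<lambda>_. B). (if p 0 = s then \<Prod>i<n. P (p i) (p (Suc i)) else 0) * stay k (p n)) = stay (n + k) s"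
proof (induction n arbitrary: k)
  case 0
  have "(\<Sum>p\<in>Pi\<^sub>E {..0} (\<lambda>_. B). (if p 0 = s then \<Prod>i<0. P (p i) (p (Suc i)) else 0) * stay k (p 0))
    = (\<Sum>y\<in>B. (if y = s then 1 else 0) * stay k y)"
    by (rule sum.reindex_bij_witness[of _ "\<lambda>y. \<lambda>x\<in>{..0}. y" "\<lambda>p. p 0"])
      (auto simp: PiE_iff extensional_def fun_eq_iff)
  also have "\<dots> = stay k s" using assms finite_B by (simp add: if_distrib[of "\<lambda>a. a * _"] sum.delta cong: if_cong)
  finally show ?case by simp
next
  case (Suc n)
  let ?w = "\<lambda>p n. if p 0 = s then \<Prod>i<n. P (p i) (p (Suc i)) else 0"
  have "(\<Sum>p\<in>Pi\<^sub>E {..Suc n} (\<lambda>_. B). ?w p (Suc n) * stay k (p (Suc n)))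
     = (\<Sum>(y, p)\<in>B \<times> Pi\<^sub>E {..n} (\<lambda>_. B). ?w (p(Suc n := y)) (Suc n) * stay k y)"
    unfolding atMost_Suc PiE_insert_eq
    by (subst sum.reindex[OF inj_combinator]) (auto simp: split_beta intro!: sum.cong)
  also have "\<dots> = (\<Sum>p\<in>Pi\<^sub>E {..n} (\<lambda>_. B). \<Sum>y\<in>B. ?w (p(Suc n := y)) (Suc n) * stay k y)"
    by (subst sum.cartesian_product[symmetric], rule sum.swap)
  also have "\<dots> = (\<Sum>p\<in>Pi\<^sub>E {..n} (\<lambda>_. B). ?w p n * stay (Suc k) (p n))"
  proof (rule sum.cong[OF refl])
    fix p assume "p \<in> Pi\<^sub>E {..n} (\<lambda>_. B)"
    have "?w (p(Suc n := y)) (Suc n) = ?w p n * P (p n) y" for y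
    proof -
      have "(\<Prod>i<n. P ((p(Suc n := y)) i) ((p(Suc n := y)) (Suc i))) = (\<Prod>i<n. P (p i) (p (Suc i)))"
        by (intro prod.cong) auto
      then show ?thesis by simp
    qed
    then show "(\<Sum>y\<in>B. ?w (p(Suc n := y)) (Suc n) * stay k y) = ?w p n * stay (Suc k) (p n)"
      by (simp add: sum_distrib_left mult.assoc)
  qed
  also have "\<dots> = stay (n + Suc k) s" by (rule Suc.IH)
  finally show ?case by simp
qed

end

section \<open>The Kawasaki chain\<close>

context kawasaki_model
begin

abbreviation "n_bonds \<equiv> real (card (oriented_bonds L))"

lemma n_bonds_pos: "n_bonds > 0"
proof -
  have U: "Up 0 0 \<in> hexagon L" using L_ge_1 by (simp add: hexagon_iff)
  then have "Down 0 0 \<in> Lam L" by (rule nn_hexagon_Lam) (simp add: nn_iff)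
  then have "(Up 0 0, Down 0 0) \<in> oriented_bonds L"
    using U hexagon_subset_Lam by (auto simp: oriented_bonds_def nn_iff)
  then show ?thesis using finite_oriented_bonds[of L] card_gt_0_iff by fastforce
qed

section \<open>Reversibility and the Poincare inequality\<close>

text \<open>The Metropolis weight of a move depends only on its higher end, hence is symmetric;
  detailed balance and the lower bound for edges both come from this form.\<close>

lemma jump_prob_bond:
  assumes "b \<in> oriented_bonds L" "\<zeta> = bond_move L b \<eta>"
  shows "exp (- \<beta> * energy L U \<Delta> \<eta>) * jump_prob L U \<Delta> \<beta> \<eta> \<zeta>
    = exp (- \<beta> * max (energy L U \<Delta> \<eta>) (energy L U \<Delta> \<zeta>)) / n_bonds"
proof -
  have "jump_prob L U \<Delta> \<beta> \<eta> \<zeta>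
    = 1 / n_bonds * exp (- \<beta> * max 0 (energy L U \<Delta> \<zeta> - energy L U \<Delta> \<eta>))"
    using assms unfolding jump_prob_def by auto
  moreover have "exp (- \<beta> * energy L U \<Delta> \<eta>) * exp (- \<beta> * max 0 (energy L U \<Delta> \<zeta> - energy L U \<Delta> \<eta>))
    = exp (- \<beta> * max (energy L U \<Delta> \<eta>) (energy L U \<Delta> \<zeta>))"
    unfolding exp_add[symmetric] by (simp add: max_def algebra_simps)
  ultimately show ?thesis by simp
qed

lemma detailed_balance:
  assumes "\<eta> \<in> configs L" "\<zeta> \<in> configs L"
  shows "exp (- \<beta> * energy L U \<Delta> \<eta>) * trans_prob L U \<Delta> \<beta> \<eta> \<zeta>
    = exp (- \<beta> * energy L U \<Delta> \<zeta>) * trans_prob L U \<Delta> \<beta> \<zeta> \<eta>"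
proof (cases "\<eta> = \<zeta>")
  case ne: False
  show ?thesis
  proof (cases "\<exists>b\<in>oriented_bonds L. \<zeta> = bond_move L b \<eta>")
    case True
    then obtain b where b: "b \<in> oriented_bonds L" "\<zeta> = bond_move L b \<eta>" by blast
    obtain b' where b': "b' \<in> oriented_bonds L" "\<eta> = bond_move L b' \<zeta>"
      using bond_move_reversible[OF assms(1) b(1) L_ge_1] b(2) by blast
    show ?thesis
      using jump_prob_bond[OF b] jump_prob_bond[OF b'] ne by (simp add: trans_prob_def max.commute)
  next
    case False
    have "\<not> (\<exists>b\<in>oriented_bonds L. \<eta> = bond_move L b \<zeta>)"
      using False bond_move_reversible[OF assms(2) _ L_ge_1] by metis
    then show ?thesis using False ne by (simp add: trans_prob_def jump_prob_def)
  qed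
qed simp

lemma move_weight:
  assumes "(\<eta>, \<zeta>) \<in> moves_below L U \<Delta> h" "\<eta> \<noteq> \<zeta>" "\<beta> > 0"
  shows "exp (- \<beta> * energy L U \<Delta> \<eta>) * trans_prob L U \<Delta> \<beta> \<eta> \<zeta> \<ge> exp (- \<beta> * h) / n_bonds"
proof -
  obtain b where b: "b \<in> oriented_bonds L" "\<zeta> = bond_move L b \<eta>"
    and h: "energy L U \<Delta> \<eta> \<le> h" "energy L U \<Delta> \<zeta> \<le> h"
    using assms(1) by (auto simp: moves_below_def)
  have "exp (- \<beta> * h) \<le> exp (- \<beta> * max (energy L U \<Delta> \<eta>) (energy L U \<Delta> \<zeta>))"
    using h assms(3) by simp
  then show ?thesis
    using jump_prob_bond[OF b, of \<beta>] assms(2) n_bonds_pos by (simp add: trans_prob_def divide_right_mono)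
qed

lemma reversible_chain_kawasaki:
  assumes "\<beta> > 0"
  shows "reversible_chain (configs L) (configs L - A) (trans_prob L U \<Delta> \<beta>) (\<lambda>\<eta>. exp (- \<beta> * energy L U \<Delta> \<eta>))"
  by unfold_locales
    (use assms detailed_balance[where \<beta> = \<beta>] in \<open>auto simp: finite_configs trans_prob_nonneg sum_trans_prob\<close>)

lemma rtrancl_moves_configs:
  assumes "(\<eta>, \<zeta>) \<in> (moves_below L U \<Delta> h)\<^sup>*" "\<eta> \<in> configs L" shows "\<zeta> \<in> configs L"
  using assms by (induction rule: rtrancl_induct) (auto simp: moves_below_def)

abbreviation "n_configs \<equiv> real (card (configs L))"

text \<open>From each state one path to \<open>A\<close> is followed. Each of its steps is
  controlled by one term of the Dirichlet form, and the Boltzmann factors at start and peak differ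
  by exp (\<beta> * V). The length is at most \<open>n_configs ^ 2\<close>; its square and the sum
  over all states give the fifth power.\<close>

lemma poincare_kawasaki:
  assumes \<beta>: "\<beta> > 0" and f: "\<And>\<eta>. \<eta> \<in> configs L \<Longrightarrow> \<eta> \<in> A \<Longrightarrow> f \<eta> = 0"
    and reach: "\<And>\<eta>. \<eta> \<in> configs L \<Longrightarrow> \<eta> \<notin> A \<Longrightarrow>
      \<exists>\<zeta>\<in>A. (\<eta>, \<zeta>) \<in> (moves_below L U \<Delta> (energy L U \<Delta> \<eta> + V))\<^sup>*"
  shows "(\<Sum>\<eta>\<in>configs L. exp (- \<beta> * energy L U \<Delta> \<eta>) * (f \<eta>)\<^sup>2)
    \<le> 2 * n_bonds * n_configs ^ 5 * exp (\<beta> * V) *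
      reversible_chain.dirichlet (configs L) (trans_prob L U \<Delta> \<beta>) (\<lambda>\<eta>. exp (- \<beta> * energy L U \<Delta> \<eta>)) f"
proof -
  let ?E = "energy L U \<Delta>" and ?X = "configs L" and ?P = "trans_prob L U \<Delta> \<beta>"
  let ?m = "\<lambda>\<eta>. exp (- \<beta> * ?E \<eta>)"
  interpret reversible_chain ?X "?X - A" ?P ?m
    by (rule reversible_chain_kawasaki[OF \<beta>])
  define Q where "Q = dirichlet f"
  have term_nonneg: "?m x * ?P x y * (f x - f y)\<^sup>2 \<ge> 0" for x y
    using \<beta> by (intro mult_nonneg_nonneg trans_prob_nonneg) auto
  have term_le: "?m x * ?P x y * (f x - f y)\<^sup>2 \<le> 2 * Q" if "x \<in> ?X" "y \<in> ?X" for x y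
  proof -
    have "?m x * ?P x y * (f x - f y)\<^sup>2 \<le> (\<Sum>y\<in>?X. ?m x * ?P x y * (f x - f y)\<^sup>2)"
      using that finite_configs term_nonneg by (intro member_le_sum) auto
    also have "\<dots> \<le> (\<Sum>x\<in>?X. \<Sum>y\<in>?X. ?m x * ?P x y * (f x - f y)\<^sup>2)"
      using that finite_configs term_nonneg
      by (intro member_le_sum[of x ?X "\<lambda>x. \<Sum>y\<in>?X. ?m x * ?P x y * (f x - f y)\<^sup>2"] sum_nonneg) auto
    finally show ?thesis unfolding Q_def dirichlet_def by linarith
  qed
  have Q_nonneg: "Q \<ge> 0"
    unfolding Q_def dirichlet_def using term_nonneg by (intro divide_nonneg_pos sum_nonneg) auto
  \<comment> \<open>Bound for the increment of \<open>f\<close> across a move below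
    \<open>h\<close>; the factor 2 undoes the 1/2 in \<open>dirichlet\<close>.\<close>
  define D where "D h = sqrt (2 * n_bonds * exp (\<beta> * h) * Q)" for h
  have D_nonneg: "D h \<ge> 0" and D_sq: "(D h)\<^sup>2 = 2 * n_bonds * exp (\<beta> * h) * Q" for h
    using Q_nonneg by (auto simp: D_def)
  have edge: "\<bar>f x - f y\<bar> \<le> D h" if xy: "(x, y) \<in> moves_below L U \<Delta> h" for x y h
  proof (cases "x = y")
    case True
    then show ?thesis using D_nonneg by simp
  next
    case False
    have X: "x \<in> ?X" "y \<in> ?X" using xy by (auto simp: moves_below_def)
    have "exp (- \<beta> * h) / n_bonds * (f x - f y)\<^sup>2 \<le> ?m x * ?P x y * (f x - f y)\<^sup>2"
      by (rule mult_right_mono[OF move_weight[OF xy False \<beta>]]) simp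
    also have "\<dots> \<le> 2 * Q" by (rule term_le[OF X])
    finally have "(f x - f y)\<^sup>2 \<le> 2 * n_bonds * exp (\<beta> * h) * Q"
      using n_bonds_pos by (simp add: exp_minus field_simps)
    then have "sqrt ((f x - f y)\<^sup>2) \<le> D h" unfolding D_def by (rule real_sqrt_le_mono)
    then show ?thesis by simp
  qed
  have chain: "\<bar>f x - f y\<bar> \<le> real n * D h" if "(x, y) \<in> moves_below L U \<Delta> h ^^ n" for x y h n
    using that
  proof (induction n arbitrary: y)
    case 0
    then show ?case by simp
  next
    case (Suc n)
    then obtain z where z: "(x, z) \<in> moves_below L U \<Delta> h ^^ n" "(z, y) \<in> moves_below L U \<Delta> h" by auto
    show ?case using Suc.IH[OF z(1)] edge[OF z(2)] by (simp add: algebra_simps abs_if split: if_splits)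
  qed
  have "?m x * (f x)\<^sup>2 \<le> 2 * n_bonds * n_configs ^ 4 * exp (\<beta> * V) * Q" if x: "x \<in> ?X" for x
  proof (cases "x \<in> A")
    case True
    then show ?thesis using f[OF x] Q_nonneg by simp
  next
    case False
    define h where "h = ?E x + V"
    obtain a where a: "a \<in> A" "(x, a) \<in> (moves_below L U \<Delta> h)\<^sup>*" using reach[OF x False] by (auto simp: h_def)
    have fa: "f a = 0" using f[OF rtrancl_moves_configs[OF a(2) x] a(1)] .
    have sub: "moves_below L U \<Delta> h \<subseteq> ?X \<times> ?X" by (auto simp: moves_below_def)
    then have fin: "finite (moves_below L U \<Delta> h)" by (rule finite_subset) (simp add: finite_configs)
    obtain n where n: "n \<le> card (moves_below L U \<Delta> h)" "(x, a) \<in> moves_below L U \<Delta> h ^^ n"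
      using a(2) unfolding rtrancl_finite_eq_relpow[OF fin] by auto
    have "card (moves_below L U \<Delta> h) \<le> card (?X \<times> ?X)" by (rule card_mono[OF _ sub]) (simp add: finite_configs)
    then have n2: "real n \<le> n_configs ^ 2"
      using n(1) by (simp add: card_cartesian_product power2_eq_square flip: of_nat_mult)
    have "\<bar>f x\<bar> \<le> real n * D h" using chain[OF n(2)] fa by simp
    also have "\<dots> \<le> n_configs ^ 2 * D h" by (rule mult_right_mono[OF n2 D_nonneg])
    finally have "(f x)\<^sup>2 \<le> (n_configs ^ 2 * D h)\<^sup>2" by (rule abs_le_square_iff[THEN iffD1, OF order_trans]) simp
    then have "?m x * (f x)\<^sup>2 \<le> ?m x * (n_configs ^ 4 * (2 * n_bonds * exp (\<beta> * h) * Q))"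
      by (intro mult_left_mono) (simp_all add: power_mult_distrib D_sq flip: power_mult)
    also have "\<dots> = 2 * n_bonds * n_configs ^ 4 * exp (\<beta> * V) * Q"
      by (simp add: h_def exp_minus exp_add distrib_left field_simps)
    finally show ?thesis .
  qed
  then have "(\<Sum>x\<in>?X. ?m x * (f x)\<^sup>2) \<le> n_configs * (2 * n_bonds * n_configs ^ 4 * exp (\<beta> * V) * Q)"
    by (intro sum_bounded_above) auto
  also have "\<dots> = 2 * n_bonds * n_configs ^ 5 * exp (\<beta> * V) * Q"
    by (simp add: eval_nat_numeral)
  finally show ?thesis by (simp only: Q_def)
qed

section \<open>Survival probabilities under the law of the chain\<close>

lemma prob_space_kawasaki_law:
  assumes "\<beta> > 0" "\<sigma> \<in> configs L"
  shows "prob_space (kawasaki_law L U \<Delta> \<beta> \<sigma>)"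
    and "space (kawasaki_law L U \<Delta> \<beta> \<sigma>) = space (PiM UNIV (\<lambda>_::nat. count_space (configs L)))"
    and "sets (kawasaki_law L U \<Delta> \<beta> \<sigma>) = sets (PiM UNIV (\<lambda>_::nat. count_space (configs L)))"
proof -
  interpret IT: Ionescu_Tulcea "kawasaki_kernel L U \<Delta> \<beta> \<sigma>" "\<lambda>_. count_space (configs L)"
    using assms by (intro Ionescu_Tulcea_kawasaki) auto
  have law: "kawasaki_law L U \<Delta> \<beta> \<sigma> = IT.PF.lim" by (simp add: kawasaki_law_def Let_def)
  have "prob_space (distr IT.PF.lim (PiM {0::nat} (\<lambda>_. count_space (configs L))) (\<lambda>x. restrict x {0}))"
    unfolding IT.distr_lim[OF finite.insertI[OF finite.emptyI]] by (rule IT.PF.prob_space_P) auto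
  then show "prob_space (kawasaki_law L U \<Delta> \<beta> \<sigma>)"
    unfolding law by (rule prob_space_distrD[rotated])
      (simp add: measurable_cong_sets[OF IT.PF.sets_lim refl] measurable_restrict_subset)
  show "space (kawasaki_law L U \<Delta> \<beta> \<sigma>) = space (PiM UNIV (\<lambda>_::nat. count_space (configs L)))"
    "sets (kawasaki_law L U \<Delta> \<beta> \<sigma>) = sets (PiM UNIV (\<lambda>_::nat. count_space (configs L)))"
    by (simp_all add: law)
qed

text \<open>Up to time n the event is a finite union of cylinders, with probabilities given by
  \<open>kawasaki_law_cylinder\<close>; \<open>sum_trajectories\<close> adds them up.\<close>

lemma prob_avoid_le:
  assumes \<beta>: "\<beta> > 0" and \<sigma>: "\<sigma> \<in> configs L"
  defines "M \<equiv> kawasaki_law L U \<Delta> \<beta> \<sigma>"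
  shows "{\<omega> \<in> space M. \<forall>i\<le>n. \<omega> i \<notin> A} \<in> sets M" (is "?E \<in> _")
    and "measure M {\<omega> \<in> space M. \<forall>i\<le>n. \<omega> i \<notin> A} \<le> (if \<sigma> \<in> A then 0
      else reversible_chain.stay (configs L - A) (trans_prob L U \<Delta> \<beta>) n \<sigma>)"
proof -
  interpret M: prob_space M unfolding M_def by (rule prob_space_kawasaki_law(1)[OF \<beta> \<sigma>])
  interpret reversible_chain "configs L" "configs L - A" "trans_prob L U \<Delta> \<beta>" "\<lambda>\<eta>. exp (- \<beta> * energy L U \<Delta> \<eta>)"
    by (rule reversible_chain_kawasaki[OF \<beta>])
  note space_M = prob_space_kawasaki_law(2)[OF \<beta> \<sigma>, folded M_def]
  note sets_M = prob_space_kawasaki_law(3)[OF \<beta> \<sigma>, folded M_def]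
  let ?B = "configs L - A"
  define C where "C p = {\<omega> \<in> space M. \<forall>i\<le>n. \<omega> i = p i}" for p :: "nat \<Rightarrow> config"
  have comp: "(\<lambda>\<omega>. \<omega> i) \<in> measurable M (count_space (configs L))" for i
    unfolding measurable_cong_sets[OF sets_M refl] by (rule measurable_component_singleton) simp
  have C_sets: "C p \<in> sets M" for p
  proof -
    have "{\<omega> \<in> space M. \<omega> i = p i} \<in> sets M" for i
    proof -
      have "{\<omega> \<in> space M. \<omega> i = p i} = (\<lambda>\<omega>. \<omega> i) -` ({p i} \<inter> configs L) \<inter> space M"
        using measurable_space[OF comp] by auto
      moreover have "\<dots> \<in> sets M" by (rule measurable_sets[OF comp]) simp
      ultimately show ?thesis by simp
    qed
    then have "{\<omega> \<in> space M. \<forall>i\<in>{..n}. \<omega> i = p i} \<in> sets M"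
      by (intro sets.sets_Collect_finite_All) auto
    then show ?thesis unfolding C_def by (simp only: Ball_def atMost_iff)
  qed
  have fin: "finite (Pi\<^sub>E {..n} (\<lambda>_. ?B))" using finite_B by (intro finite_PiE) auto
  have eq: "?E = (\<Union>p\<in>Pi\<^sub>E {..n} (\<lambda>_. ?B). C p)"
  proof (intro equalityI subsetI)
    fix \<omega> assume \<omega>: "\<omega> \<in> ?E"
    then have "\<omega> i \<in> configs L" for i using measurable_space[OF comp, of \<omega> i] by auto
    then show "\<omega> \<in> (\<Union>p\<in>Pi\<^sub>E {..n} (\<lambda>_. ?B). C p)"
      using \<omega> by (intro UN_I[of "restrict \<omega> {..n}"]) (auto simp: C_def)
  next
    fix \<omega> assume "\<omega> \<in> (\<Union>p\<in>Pi\<^sub>E {..n} (\<lambda>_. ?B). C p)"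
    then obtain p where "p \<in> Pi\<^sub>E {..n} (\<lambda>_. ?B)" "\<omega> \<in> C p" by blast
    then show "\<omega> \<in> ?E" by (auto simp: C_def PiE_iff)
  qed
  show "?E \<in> sets M" unfolding eq using fin C_sets by (intro sets.finite_UN) auto
  have "measure M ?E \<le> (\<Sum>p\<in>Pi\<^sub>E {..n} (\<lambda>_. ?B). measure M (C p))"
    unfolding eq using fin C_sets by (intro M.finite_measure_subadditive_finite) auto
  also have "\<dots> = (\<Sum>p\<in>Pi\<^sub>E {..n} (\<lambda>_. ?B).
      (if p 0 = \<sigma> then \<Prod>i<n. trans_prob L U \<Delta> \<beta> (p i) (p (Suc i)) else 0) * stay 0 (p n))"
  proof (rule sum.cong[OF refl])
    fix p assume p: "p \<in> Pi\<^sub>E {..n} (\<lambda>_. ?B)"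
    have "measure M (C p) = (if p 0 = \<sigma> then \<Prod>i<n. trans_prob L U \<Delta> \<beta> (p i) (p (Suc i)) else 0)"
      unfolding M_def C_def using \<beta> \<sigma> p by (intro kawasaki_law_cylinder) auto
    then show "measure M (C p) = (if p 0 = \<sigma> then \<Prod>i<n. trans_prob L U \<Delta> \<beta> (p i) (p (Suc i)) else 0) * stay 0 (p n)"
      by simp
  qed
  also have "\<dots> = (if \<sigma> \<in> A then 0 else stay n \<sigma>)"
  proof (cases "\<sigma> \<in> A")
    case True
    then show ?thesis by (auto intro!: sum.neutral simp: PiE_iff)
  next
    case False
    then show ?thesis using sum_trajectories[of \<sigma> n 0] \<sigma> by simp
  qed
  finally show "measure M ?E \<le> (if \<sigma> \<in> A then 0 else stay n \<sigma>)" .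
qed

text \<open>The decay rate is 1 / K with K = K0 * exp (\<beta> * V), so n / K is at least (exp
  (\<beta> * \<epsilon>) - 1) / K0. Passing from the weighted norm to one state costs at most exp (2
  * \<beta> * E0) times the number of states; the division by 2 is the square root.\<close>

lemma stay_kawasaki_le:
  assumes \<beta>: "\<beta> > 0" and \<sigma>: "\<sigma> \<in> configs L" "\<sigma> \<notin> A"
    and reach: "\<And>\<eta>. \<eta> \<in> configs L \<Longrightarrow> \<eta> \<notin> A \<Longrightarrow>
      \<exists>\<zeta>\<in>A. (\<eta>, \<zeta>) \<in> (moves_below L U \<Delta> (energy L U \<Delta> \<eta> + V))\<^sup>*"
    and E: "\<And>\<eta>. \<eta> \<in> configs L \<Longrightarrow> \<bar>energy L U \<Delta> \<eta>\<bar> \<le> E0"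
    and n: "real n \<ge> exp (\<beta> * (V + \<epsilon>)) - 1" and V: "V \<ge> 0"
  shows "reversible_chain.stay (configs L - A) (trans_prob L U \<Delta> \<beta>) n \<sigma>
    \<le> exp ((- (exp (\<beta> * \<epsilon>) - 1) / (2 * n_bonds * n_configs ^ 5) + ln n_configs + 2 * \<beta> * E0) / 2)"
proof -
  let ?m = "\<lambda>\<eta>. exp (- \<beta> * energy L U \<Delta> \<eta>)"
  interpret reversible_chain "configs L" "configs L - A" "trans_prob L U \<Delta> \<beta>" ?m
    by (rule reversible_chain_kawasaki[OF \<beta>])
  have N: "n_configs > 0" using \<sigma>(1) finite_configs card_gt_0_iff by fastforce
  define K0 where "K0 = 2 * n_bonds * n_configs ^ 5"
  have K0: "K0 > 0" using N n_bonds_pos by (simp add: K0_def)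
  have "?m \<sigma> * (stay n \<sigma>)\<^sup>2 \<le> exp (- real n / (K0 * exp (\<beta> * V))) * (\<Sum>\<eta>\<in>configs L. ?m \<eta>)"
  proof (rule stay_bound)
    show "K0 * exp (\<beta> * V) > 0" using K0 by simp
    show "(\<Sum>x\<in>configs L. ?m x * (f x)\<^sup>2) \<le> K0 * exp (\<beta> * V) * dirichlet f"
      if "\<And>x. x \<in> configs L - (configs L - A) \<Longrightarrow> f x = 0" for f
      unfolding K0_def using that by (intro poincare_kawasaki[OF \<beta> _ reach]) auto
  qed (use \<sigma> in auto)
  also have "\<dots> \<le> exp (- (exp (\<beta> * \<epsilon>) - 1) / K0) * (n_configs * exp (\<beta> * E0))"
  proof (rule mult_mono)
    have "exp (\<beta> * V) \<ge> 1" using \<beta> V by simp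
    have "exp (\<beta> * \<epsilon>) - 1 \<le> exp (\<beta> * \<epsilon>) - 1 / exp (\<beta> * V)"
      using \<open>exp (\<beta> * V) \<ge> 1\<close> by simp
    also have "\<dots> = (exp (\<beta> * (V + \<epsilon>)) - 1) / exp (\<beta> * V)"
      by (simp add: diff_divide_distrib exp_add distrib_left)
    also have "\<dots> \<le> real n / exp (\<beta> * V)" using n by (intro divide_right_mono) auto
    finally have "(exp (\<beta> * \<epsilon>) - 1) / K0 \<le> (real n / exp (\<beta> * V)) / K0"
      using K0 by (intro divide_right_mono) auto
    then show "exp (- real n / (K0 * exp (\<beta> * V))) \<le> exp (- (exp (\<beta> * \<epsilon>) - 1) / K0)"
      by (simp add: mult.commute diff_divide_distrib)
    have "?m \<eta> \<le> exp (\<beta> * E0)" if "\<eta> \<in> configs L" for \<eta>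
      using E[OF that] \<beta> mult_left_mono[of "- energy L U \<Delta> \<eta>" E0 \<beta>] by simp
    then show "(\<Sum>\<eta>\<in>configs L. ?m \<eta>) \<le> n_configs * exp (\<beta> * E0)" by (rule sum_bounded_above)
  qed (auto intro!: sum_nonneg)
  finally have 1: "?m \<sigma> * (stay n \<sigma>)\<^sup>2 \<le> exp (- (exp (\<beta> * \<epsilon>) - 1) / K0) * (n_configs * exp (\<beta> * E0))" .
  have "exp (- (\<beta> * E0)) \<le> ?m \<sigma>"
    using E[OF \<sigma>(1)] \<beta> mult_left_mono[of "energy L U \<Delta> \<sigma>" E0 \<beta>] by simp
  then have "exp (- (\<beta> * E0)) * (stay n \<sigma>)\<^sup>2 \<le> ?m \<sigma> * (stay n \<sigma>)\<^sup>2" by (rule mult_right_mono) simp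
  with 1 have "exp (- (\<beta> * E0)) * (stay n \<sigma>)\<^sup>2 \<le> exp (- (exp (\<beta> * \<epsilon>) - 1) / K0) * (n_configs * exp (\<beta> * E0))"
    by linarith
  then have "exp (\<beta> * E0) * (exp (- (\<beta> * E0)) * (stay n \<sigma>)\<^sup>2)
      \<le> exp (\<beta> * E0) * (exp (- (exp (\<beta> * \<epsilon>) - 1) / K0) * (n_configs * exp (\<beta> * E0)))"
    by (rule mult_left_mono) simp
  moreover have "exp (\<beta> * E0) * (exp (- (\<beta> * E0)) * (stay n \<sigma>)\<^sup>2) = (stay n \<sigma>)\<^sup>2"
    by (simp add: mult.assoc[symmetric] flip: exp_add)
  ultimately have "(stay n \<sigma>)\<^sup>2 \<le> exp (\<beta> * E0) * (exp (- (exp (\<beta> * \<epsilon>) - 1) / K0) * (n_configs * exp (\<beta> * E0)))"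
    by (simp only:)
  also have "\<dots> = exp (- (exp (\<beta> * \<epsilon>) - 1) / K0 + ln n_configs + 2 * \<beta> * E0)"
  proof -
    have "2 * \<beta> * E0 = \<beta> * E0 + \<beta> * E0" by simp
    then show ?thesis using N by (simp only: exp_add exp_ln mult_ac)
  qed
  also have "\<dots> = (exp ((- (exp (\<beta> * \<epsilon>) - 1) / K0 + ln n_configs + 2 * \<beta> * E0) / 2))\<^sup>2"
    by (simp add: power2_eq_square flip: exp_add)
  finally show ?thesis
    unfolding K0_def by (rule power2_le_imp_le) simp
qed

section \<open>Paths, communication heights and stability levels\<close>

lemma rtrancl_moves_path:
  assumes "(\<sigma>, \<eta>) \<in> (moves_below L U \<Delta> h)\<^sup>*" "\<sigma> \<in> configs L" "energy L U \<Delta> \<sigma> \<le> h"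
  shows "\<exists>\<omega>\<in>paths L U \<Delta> \<beta> \<sigma> \<eta>. \<forall>\<zeta>\<in>set \<omega>. energy L U \<Delta> \<zeta> \<le> h"
  using assms(1)
proof (induction rule: rtrancl_induct)
  case base
  show ?case using assms(2,3) by (intro bexI[of _ "[\<sigma>]"]) (auto simp: paths_def)
next
  case (step \<eta> \<zeta>)
  then obtain \<omega> where \<omega>: "\<omega> \<in> paths L U \<Delta> \<beta> \<sigma> \<eta>" "\<forall>\<zeta>\<in>set \<omega>. energy L U \<Delta> \<zeta> \<le> h" by blast
  show ?case
  \<comment> \<open>A bond move may change nothing; such a step is dropped, since the holding
    probability need not be positive.\<close>
  proof (cases "\<zeta> = \<eta>")
    case True
    then show ?thesis using \<omega> by blast
  next
    case False
    have "trans_prob L U \<Delta> \<beta> \<eta> \<zeta> > 0"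
      using step(2) False n_bonds_pos by (auto simp: trans_prob_def jump_prob_def moves_below_def)
    moreover have "\<omega> \<noteq> []" "last \<omega> = \<eta>" using \<omega>(1) by (auto simp: paths_def)
    ultimately have "trans_prob L U \<Delta> \<beta> ((\<omega> @ [\<zeta>]) ! i) ((\<omega> @ [\<zeta>]) ! Suc i) > 0"
      if "Suc i < length (\<omega> @ [\<zeta>])" for i
    proof (cases "Suc i < length \<omega>")
      case True
      then show ?thesis using \<omega>(1) by (simp add: paths_def nth_append)
    next
      case False
      then have "length \<omega> = Suc i" using that by simp
      then show ?thesis
        using \<open>0 < trans_prob L U \<Delta> \<beta> \<eta> \<zeta>\<close> last_conv_nth[OF \<open>\<omega> \<noteq> []\<close>] \<open>last \<omega> = \<eta>\<close>
        by (simp add: nth_append)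
    qed
    then have "\<omega> @ [\<zeta>] \<in> paths L U \<Delta> \<beta> \<sigma> \<zeta>"
      using \<omega>(1) step(2) by (simp add: paths_def moves_below_def)
    moreover have "energy L U \<Delta> \<zeta> \<le> h" using step(2) by (auto simp: moves_below_def)
    ultimately show ?thesis using \<omega>(2) by (intro bexI[of _ "\<omega> @ [\<zeta>]"]) auto
  qed
qed

lemma path_rtrancl_moves:
  assumes "\<omega> \<in> paths L U \<Delta> \<beta> \<sigma> \<eta>" "\<And>\<zeta>. \<zeta> \<in> set \<omega> \<Longrightarrow> energy L U \<Delta> \<zeta> \<le> h"
  shows "(\<sigma>, \<eta>) \<in> (moves_below L U \<Delta> h)\<^sup>*"
proof -
  have \<omega>: "\<omega> \<noteq> []" "set \<omega> \<subseteq> configs L" "\<omega> ! 0 = \<sigma>" "\<omega> ! (length \<omega> - 1) = \<eta>"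
    and tr: "\<And>i. Suc i < length \<omega> \<Longrightarrow> trans_prob L U \<Delta> \<beta> (\<omega> ! i) (\<omega> ! Suc i) > 0"
    using assms(1) by (auto simp: paths_def hd_conv_nth last_conv_nth)
  have "(\<sigma>, \<omega> ! i) \<in> (moves_below L U \<Delta> h)\<^sup>*" if "i < length \<omega>" for i
    using that
  proof (induction i)
    case 0
    then show ?case using \<omega> by simp
  next
    case (Suc i)
    have IH: "(\<sigma>, \<omega> ! i) \<in> (moves_below L U \<Delta> h)\<^sup>*" using Suc by simp
    have mem: "\<omega> ! i \<in> set \<omega>" "\<omega> ! Suc i \<in> set \<omega>" using Suc.prems by auto
    show ?case
    proof (cases "\<omega> ! Suc i = \<omega> ! i")
      case False
      then have "\<exists>b\<in>oriented_bonds L. \<omega> ! Suc i = bond_move L b (\<omega> ! i)"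
        using tr[OF Suc.prems] by (auto simp: trans_prob_def jump_prob_def split: if_splits)
      then have "(\<omega> ! i, \<omega> ! Suc i) \<in> moves_below L U \<Delta> h"
        using mem \<omega>(2) assms(2) by (auto simp: moves_below_def)
      then show ?thesis using IH by (rule rtrancl_into_rtrancl[rotated])
    qed (use IH in simp)
  qed
  from this[of "length \<omega> - 1"] show ?thesis using \<omega> by simp
qed

end

lemma SES_if_le:
  assumes f: "\<And>\<beta>. \<beta> > 0 \<Longrightarrow> 0 \<le> f \<beta> \<and> f \<beta> \<le> exp (g \<beta>)"
    and g: "filterlim (\<lambda>\<beta>. g \<beta> / \<beta>) at_bot at_top"
  shows "SES f"
  unfolding SES_def tendsto_MInfty
proof
  fix c :: real
  have "\<forall>\<^sub>F \<beta> in at_top. g \<beta> / \<beta> \<le> c - 1"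
    using g unfolding filterlim_at_bot by blast
  then show "\<forall>\<^sub>F \<beta> in at_top. log_ext (f \<beta>) / ereal \<beta> < ereal c"
    using eventually_gt_at_top[of 0]
  proof eventually_elim
    case (elim \<beta>)
    show ?case
    proof (cases "f \<beta> = 0")
      case True
      then show ?thesis using elim by (simp add: log_ext_def)
    next
      case False
      then have "ln (f \<beta>) \<le> g \<beta>"
        using f[OF elim(2)] ln_mono[of "f \<beta>" "exp (g \<beta>)"] by simp
      then have "ln (f \<beta>) / \<beta> \<le> g \<beta> / \<beta>" using elim(2) by (intro divide_right_mono) auto
      then show ?thesis using False elim by (simp add: log_ext_def)
    qed
  qed
qed

lemma filterlim_stay_exponent:
  fixes K \<epsilon> c E :: real
  assumes "K > 0" "\<epsilon> > 0"
  shows "filterlim (\<lambda>\<beta>. ((- (exp (\<beta> * \<epsilon>) - 1) / K + c + 2 * \<beta> * E) / 2) / \<beta>) at_bot at_top"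
  using assms by real_asymp

text \<open>Follow an exit route of the empty lattice: if it meets \<open>S\<close>, then the last
  particle on it can leave.\<close>

lemma acc_exposed:
  assumes "acc L {} x" shows "acc L S x \<or> (\<exists>y\<in>S. acc L (S - {y}) y)"
  using assms
proof (induction rule: acc.induct)
  case (boundary x)
  then show ?case by (cases "x \<in> S") (auto intro: acc.boundary)
next
  case (step x y)
  show ?case
  proof (cases "x \<in> S \<and> acc L S y")
    case True
    then have "acc L (S - {x}) y" by (auto intro: acc_antimono)
    then have "acc L (S - {x}) x" using step(1,3) by (intro acc.step[of x _ _ y]) auto
    then show ?thesis using True by blast
  next
    case False
    then show ?thesis using step by (auto intro: acc.step)
  qed
qed

lemma full_config_eq: "L \<ge> 1 \<Longrightarrow> full_config L = cfg L (hexagon L)"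
  by (simp add: full_config_def cfg_def Lam_minus_eq_hexagon)

lemma empty_config_eq: "empty_config L = cfg L {}"
  by (simp add: empty_config_def cfg_def)

lemma (in kawasaki_coords) acc_empty: "x \<in> hexagon L \<Longrightarrow> acc L {} x"
proof -
  assume x: "x \<in> hexagon L"
  obtain i j where ij: "x = u i j \<or> x = d i j" using exhaust by blast
  have "u i j \<in> Lam L \<Longrightarrow> acc L {} (u i j)" "d i j \<in> Lam L \<Longrightarrow> acc L {} (d i j)"
    by (rule acc_above[of "j - 1"]; simp)+
  then show ?thesis using ij x hexagon_subset_Lam by blast
qed

context kawasaki_model
begin

text \<open>Only connectedness is at stake, so the height is left unspecified; particles are peeled
  off one at a time.\<close>

lemma ex_climb_to_empty: "S \<subseteq> Lam L \<Longrightarrow> \<exists>h. climb h S {}"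
proof (induction "card S" arbitrary: S rule: less_induct)
  case less
  have fin: "finite S" by (rule finite_sub[OF less.prems])
  show ?case
  proof (cases "S = {}")
    case True
    then show ?thesis by auto
  next
    case False
    have "\<exists>h. \<exists>y\<in>S. climb h S (S - {y})"
    proof (cases "\<exists>y\<in>S. y \<in> Lam_bdry L")
      case True
      then obtain y where y: "y \<in> S" "y \<in> Lam_bdry L" by blast
      then have "climb (max (H S) (H (S - {y}))) (insert y (S - {y})) (S - {y})"
        by (intro climb_boundary) (auto simp: insert_absorb)
      then show ?thesis using y by (auto simp: insert_absorb)
    next
      case False
      then have hex: "S \<subseteq> hexagon L" using less.prems Lam_bdry_eq[OF L_ge_1] by auto
      interpret kawasaki_coords L U \<Delta> Up Down
        by (intro kawasaki_coords.intro kawasaki_model_axioms hex_coords_Up_Down)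
      obtain x where x: "x \<in> S" using \<open>S \<noteq> {}\<close> by blast
      have "acc L {} x" using x hex acc_empty by auto
      from acc_exposed[OF this, of S] obtain y where "y \<in> S" "acc L (S - {y}) y"
        using x acc_not_mem by blast
      then show ?thesis using climb_remove[OF _ hex] by blast
    qed
    then obtain h y where y: "y \<in> S" "climb h S (S - {y})" by blast
    have "card (S - {y}) < card S" using fin y(1) by (rule card_Diff1_less)
    moreover have "S - {y} \<subseteq> Lam L" using less.prems by blast
    ultimately obtain h' where h': "climb h' (S - {y}) {}" using less.hyps by blast
    have "climb (max h h') S (S - {y})" by (rule climb_mono[OF y(2)]) simp
    also have "climb (max h h') (S - {y}) {}" by (rule climb_mono[OF h']) simp
    finally have "climb (max h h') S {}" .
    then show ?thesis by blast
  qed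
qed

text \<open>\<open>Min\<close> is informative only on nonempty finite sets; this lemma and
  \<open>finite_path_heights\<close> make the communication height a genuine minimum.\<close>

lemma ex_path:
  assumes "\<sigma> \<in> configs L" "\<eta> \<in> configs L" shows "paths L U \<Delta> \<beta> \<sigma> \<eta> \<noteq> {}"
proof -
  define S where "S = {x \<in> Lam L. \<sigma> x = 1}"
  define T where "T = {x \<in> Lam L. \<eta> x = 1}"
  have \<sigma>: "\<sigma> = cfg L S" unfolding S_def by (rule configs_eq_cfg[OF assms(1)])
  have \<eta>: "\<eta> = cfg L T" unfolding T_def by (rule configs_eq_cfg[OF assms(2)])
  have ST: "S \<subseteq> Lam L" "T \<subseteq> Lam L" by (auto simp: S_def T_def)
  obtain h1 h2 where "climb h1 S {}" "climb h2 T {}"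
    using ex_climb_to_empty[OF ST(1)] ex_climb_to_empty[OF ST(2)] by blast
  define h where "h = max (H S) (max h1 h2)"
  have "climb h S {}" by (rule climb_mono[OF \<open>climb h1 S {}\<close>]) (simp add: h_def)
  also have "climb h {} T"
    by (rule climb_sym[OF climb_mono[OF \<open>climb h2 T {}\<close>]]) (simp add: h_def)
  finally have "(\<sigma>, \<eta>) \<in> (moves_below L U \<Delta> h)\<^sup>*" unfolding climb_def \<sigma>[symmetric] \<eta>[symmetric] .
  moreover have "energy L U \<Delta> \<sigma> \<le> h" by (simp add: h_def H_def \<sigma>[symmetric])
  ultimately show ?thesis using rtrancl_moves_path[OF _ assms(1)] by blast
qed

text \<open>There may be infinitely many paths, but every height is the energy of some
  configuration.\<close>

lemma finite_path_heights: "finite ((\<lambda>\<omega>. Max (energy L U \<Delta> ` set \<omega>)) ` paths L U \<Delta> \<beta> \<sigma> \<eta>)"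
proof (rule finite_subset)
  show "(\<lambda>\<omega>. Max (energy L U \<Delta> ` set \<omega>)) ` paths L U \<Delta> \<beta> \<sigma> \<eta> \<subseteq> energy L U \<Delta> ` configs L"
  proof (rule image_subsetI)
    fix \<omega> assume "\<omega> \<in> paths L U \<Delta> \<beta> \<sigma> \<eta>"
    then have "energy L U \<Delta> ` set \<omega> \<noteq> {}" and sub: "set \<omega> \<subseteq> configs L" by (auto simp: paths_def)
    then have "Max (energy L U \<Delta> ` set \<omega>) \<in> energy L U \<Delta> ` set \<omega>" by (intro Max_in) auto
    then show "Max (energy L U \<Delta> ` set \<omega>) \<in> energy L U \<Delta> ` configs L" using sub by blast
  qed
qed (simp add: finite_configs)

lemma finite_lower_configs: "finite (lower_configs L U \<Delta> \<sigma>)"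
  using finite_configs[of L] by (auto simp: lower_configs_def)

lemma stability_level_le:
  assumes "(\<sigma>, \<eta>) \<in> (moves_below L U \<Delta> (energy L U \<Delta> \<sigma> + V))\<^sup>*" "\<sigma> \<in> configs L" "V \<ge> 0"
    and "\<eta> \<in> lower_configs L U \<Delta> \<sigma>"
  shows "stability_level L U \<Delta> \<beta> \<sigma> \<le> ereal V"
proof -
  have "energy L U \<Delta> \<sigma> \<le> energy L U \<Delta> \<sigma> + V" using assms(3) by simp
  from rtrancl_moves_path[OF assms(1,2) this] obtain \<omega> where
    \<omega>: "\<omega> \<in> paths L U \<Delta> \<beta> \<sigma> \<eta>" "\<forall>\<zeta>\<in>set \<omega>. energy L U \<Delta> \<zeta> \<le> energy L U \<Delta> \<sigma> + V" by blast
  have "comm_height_set L U \<Delta> \<beta> \<sigma> (lower_configs L U \<Delta> \<sigma>) \<le> comm_height L U \<Delta> \<beta> \<sigma> \<eta>"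
    unfolding comm_height_set_def using assms(4) finite_lower_configs by (intro Min_le) auto
  also have "\<dots> \<le> Max (energy L U \<Delta> ` set \<omega>)"
    unfolding comm_height_def using \<omega>(1) finite_path_heights by (intro Min_le) auto
  also have "\<dots> \<le> energy L U \<Delta> \<sigma> + V"
    using \<omega> by (intro Max.boundedI) (auto simp: paths_def)
  finally show ?thesis using assms(4) by (auto simp: stability_level_def)
qed

lemma stability_level_leD:
  assumes "stability_level L U \<Delta> \<beta> \<sigma> \<le> ereal V" "\<sigma> \<in> configs L"
  shows "\<exists>\<eta>\<in>lower_configs L U \<Delta> \<sigma>. (\<sigma>, \<eta>) \<in> (moves_below L U \<Delta> (energy L U \<Delta> \<sigma> + V))\<^sup>*"
proof -
  let ?lower = "lower_configs L U \<Delta> \<sigma>"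
  have ne: "?lower \<noteq> {}" and le: "comm_height_set L U \<Delta> \<beta> \<sigma> ?lower \<le> energy L U \<Delta> \<sigma> + V"
    using assms(1) by (auto simp: stability_level_def split: if_splits)
  have "comm_height_set L U \<Delta> \<beta> \<sigma> ?lower \<in> comm_height L U \<Delta> \<beta> \<sigma> ` ?lower"
    unfolding comm_height_set_def using ne finite_lower_configs by (intro Min_in) auto
  then obtain \<eta> where \<eta>: "\<eta> \<in> ?lower" "comm_height L U \<Delta> \<beta> \<sigma> \<eta> \<le> energy L U \<Delta> \<sigma> + V" using le by auto
  have "paths L U \<Delta> \<beta> \<sigma> \<eta> \<noteq> {}" using ex_path[OF assms(2)] \<eta>(1) by (auto simp: lower_configs_def)
  then have "comm_height L U \<Delta> \<beta> \<sigma> \<eta> \<in> (\<lambda>\<omega>. Max (energy L U \<Delta> ` set \<omega>)) ` paths L U \<Delta> \<beta> \<sigma> \<eta>"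
    unfolding comm_height_def using finite_path_heights by (intro Min_in) auto
  then obtain \<omega> where \<omega>: "\<omega> \<in> paths L U \<Delta> \<beta> \<sigma> \<eta>" "Max (energy L U \<Delta> ` set \<omega>) \<le> energy L U \<Delta> \<sigma> + V"
    using \<eta>(2) by auto
  have "energy L U \<Delta> \<zeta> \<le> energy L U \<Delta> \<sigma> + V" if "\<zeta> \<in> set \<omega>" for \<zeta>
  proof -
    have "energy L U \<Delta> \<zeta> \<le> Max (energy L U \<Delta> ` set \<omega>)" using that by (intro Max_ge) auto
    then show ?thesis using \<omega>(2) by linarith
  qed
  then show ?thesis using path_rtrancl_moves[OF \<omega>(1)] \<eta>(1) by blast
qed

text \<open>From a state that is not stable, a lower one is reached within V. The set of lower
  configurations shrinks each time, and since the energy falls, the later climbs stay below the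
  height allowed at the start.\<close>

lemma ex_moves_to_stable:
  assumes "\<eta> \<in> configs L"
  shows "\<exists>\<zeta>\<in>stable_configs L U \<Delta> \<beta> V. (\<eta>, \<zeta>) \<in> (moves_below L U \<Delta> (energy L U \<Delta> \<eta> + V))\<^sup>*"
  using assms
proof (induction "card (lower_configs L U \<Delta> \<eta>)" arbitrary: \<eta> rule: less_induct)
  case less
  show ?case
  proof (cases "\<eta> \<in> stable_configs L U \<Delta> \<beta> V")
    case True
    then show ?thesis by blast
  next
    case False
    then have "stability_level L U \<Delta> \<beta> \<eta> \<le> ereal V" using less.prems by (auto simp: stable_configs_def)
    from stability_level_leD[OF this less.prems] obtain \<xi> where
      \<xi>: "\<xi> \<in> configs L" "energy L U \<Delta> \<xi> < energy L U \<Delta> \<eta>"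
        "(\<eta>, \<xi>) \<in> (moves_below L U \<Delta> (energy L U \<Delta> \<eta> + V))\<^sup>*" by (auto simp: lower_configs_def)
    have "lower_configs L U \<Delta> \<xi> \<subset> lower_configs L U \<Delta> \<eta>" using \<xi> by (auto simp: lower_configs_def)
    then have "card (lower_configs L U \<Delta> \<xi>) < card (lower_configs L U \<Delta> \<eta>)"
      by (rule psubset_card_mono[OF finite_lower_configs])
    from less.hyps[OF this \<xi>(1)] obtain \<zeta> where \<zeta>: "\<zeta> \<in> stable_configs L U \<Delta> \<beta> V"
      "(\<xi>, \<zeta>) \<in> (moves_below L U \<Delta> (energy L U \<Delta> \<xi> + V))\<^sup>*" by blast
    have "moves_below L U \<Delta> (energy L U \<Delta> \<xi> + V) \<subseteq> moves_below L U \<Delta> (energy L U \<Delta> \<eta> + V)"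
      using \<xi>(2) by (intro moves_below_mono) simp
    from rtrancl_mono[OF this] have "(\<xi>, \<zeta>) \<in> (moves_below L U \<Delta> (energy L U \<Delta> \<eta> + V))\<^sup>*"
      using \<zeta>(2) by blast
    then show ?thesis using \<zeta>(1) \<xi>(3) by (blast intro: rtrancl_trans)
  qed
qed

section \<open>The recurrence estimate\<close>

lemma prob_hitting_le:
  assumes \<beta>: "\<beta> > 0" and \<sigma>: "\<sigma> \<in> configs L"
    and reach: "\<And>\<eta>. \<eta> \<in> configs L \<Longrightarrow> \<eta> \<notin> A \<Longrightarrow>
      \<exists>\<zeta>\<in>A. (\<eta>, \<zeta>) \<in> (moves_below L U \<Delta> (energy L U \<Delta> \<eta> + V))\<^sup>*"
    and E: "\<And>\<eta>. \<eta> \<in> configs L \<Longrightarrow> \<bar>energy L U \<Delta> \<eta>\<bar> \<le> E0" and V: "V \<ge> 0"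
  shows "\<P>(\<omega> in kawasaki_law L U \<Delta> \<beta> \<sigma>. ereal_of_enat (hitting_time A \<omega>) > ereal (exp (\<beta> * (V + \<epsilon>))))
    \<le> exp ((- (exp (\<beta> * \<epsilon>) - 1) / (2 * n_bonds * n_configs ^ 5) + ln n_configs + 2 * \<beta> * E0) / 2)"
proof -
  define M where "M = kawasaki_law L U \<Delta> \<beta> \<sigma>"
  interpret M: prob_space M unfolding M_def by (rule prob_space_kawasaki_law(1)[OF \<beta> \<sigma>])
  \<comment> \<open>Hitting after the real time forces avoidance at times 0, ..., \<open>n\<close>;
    rounding loses at most 1.\<close>
  define n where "n = nat \<lfloor>exp (\<beta> * (V + \<epsilon>))\<rfloor>"
  have n: "real n \<le> exp (\<beta> * (V + \<epsilon>))" "exp (\<beta> * (V + \<epsilon>)) - 1 \<le> real n"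
    unfolding n_def by simp_all
  have "\<omega> i \<notin> A" if h: "ereal_of_enat (hitting_time A \<omega>) > ereal (exp (\<beta> * (V + \<epsilon>)))" and i: "i \<le> n" for \<omega> i
  proof
    assume "\<omega> i \<in> A"
    then have "hitting_time A \<omega> \<le> enat i" unfolding hitting_time_def by (intro INF_lower) auto
    then have "ereal_of_enat (hitting_time A \<omega>) \<le> ereal_of_enat (enat i)" by (simp only: ereal_of_enat_le_iff)
    also have "\<dots> \<le> ereal (exp (\<beta> * (V + \<epsilon>)))" using i n(1) by (simp add: order_trans[of _ "real n"])
    finally show False using h by simp
  qed
  then have sub: "{\<omega> \<in> space M. ereal_of_enat (hitting_time A \<omega>) > ereal (exp (\<beta> * (V + \<epsilon>)))}
    \<subseteq> {\<omega> \<in> space M. \<forall>i\<le>n. \<omega> i \<notin> A}" by blast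
  have "measure M {\<omega> \<in> space M. ereal_of_enat (hitting_time A \<omega>) > ereal (exp (\<beta> * (V + \<epsilon>)))}
    \<le> measure M {\<omega> \<in> space M. \<forall>i\<le>n. \<omega> i \<notin> A}"
    by (rule M.finite_measure_mono[OF sub prob_avoid_le(1)[OF \<beta> \<sigma>, folded M_def]])
  also have "\<dots> \<le> exp ((- (exp (\<beta> * \<epsilon>) - 1) / (2 * n_bonds * n_configs ^ 5) + ln n_configs + 2 * \<beta> * E0) / 2)"
  proof (cases "\<sigma> \<in> A")
    case True
    have "measure M {\<omega> \<in> space M. \<forall>i\<le>n. \<omega> i \<notin> A} \<le> 0"
      using prob_avoid_le(2)[OF \<beta> \<sigma>, of n A, folded M_def] True by (simp only: if_True)
    also have "0 \<le> exp ((- (exp (\<beta> * \<epsilon>) - 1) / (2 * n_bonds * n_configs ^ 5) + ln n_configs + 2 * \<beta> * E0) / 2)"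
      by (rule exp_ge_zero)
    finally show ?thesis .
  next
    case False
    have "measure M {\<omega> \<in> space M. \<forall>i\<le>n. \<omega> i \<notin> A} \<le>
        reversible_chain.stay (configs L - A) (trans_prob L U \<Delta> \<beta>) n \<sigma>"
      using prob_avoid_le(2)[OF \<beta> \<sigma>, of n A, folded M_def] False by (simp only: if_False)
    also note stay_kawasaki_le[OF \<beta> \<sigma> False reach E n(2) V]
    finally show ?thesis .
  qed
  finally show ?thesis unfolding M_def .
qed

text \<open>The bound is uniform in \<sigma>, so it passes to the supremum. No geometry enters: the
  estimate holds at every level V \<ge> 0.\<close>

lemma SES_hitting_stable:
  assumes "V \<ge> 0" "\<epsilon> > 0"
  shows "SES (\<lambda>\<beta>. SUP \<sigma>\<in>configs L. \<P>(\<omega> in kawasaki_law L U \<Delta> \<beta> \<sigma>.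
    ereal_of_enat (hitting_time (stable_configs L U \<Delta> \<beta> V) \<omega>) > ereal (exp (\<beta> * (V + \<epsilon>)))))"
proof (rule SES_if_le)
  define E0 where "E0 = Max ((\<lambda>\<eta>. \<bar>energy L U \<Delta> \<eta>\<bar>) ` configs L)"
  have E: "\<bar>energy L U \<Delta> \<eta>\<bar> \<le> E0" if "\<eta> \<in> configs L" for \<eta>
    unfolding E0_def using that finite_configs by (intro Max_ge) auto
  have ne: "configs L \<noteq> {}" using cfg_configs by blast
  show "filterlim (\<lambda>\<beta>. ((- (exp (\<beta> * \<epsilon>) - 1) / (2 * n_bonds * n_configs ^ 5) + ln n_configs + 2 * \<beta> * E0) / 2) / \<beta>)
    at_bot at_top"
    using n_bonds_pos ne finite_configs[of L] assms(2) by (intro filterlim_stay_exponent) (auto simp: card_gt_0_iff)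
  fix \<beta> :: real
  assume \<beta>: "\<beta> > 0"
  let ?p = "\<lambda>\<sigma>. \<P>(\<omega> in kawasaki_law L U \<Delta> \<beta> \<sigma>.
    ereal_of_enat (hitting_time (stable_configs L U \<Delta> \<beta> V) \<omega>) > ereal (exp (\<beta> * (V + \<epsilon>))))"
  obtain \<sigma> where \<sigma>: "\<sigma> \<in> configs L" using ne by blast
  have "0 \<le> (SUP \<sigma>\<in>configs L. ?p \<sigma>)"
    by (rule cSUP_upper2[OF _ \<sigma>]) (auto simp: finite_configs)
  moreover have "(SUP \<sigma>\<in>configs L. ?p \<sigma>)
    \<le> exp ((- (exp (\<beta> * \<epsilon>) - 1) / (2 * n_bonds * n_configs ^ 5) + ln n_configs + 2 * \<beta> * E0) / 2)"
    by (rule cSUP_least[OF ne]) (rule prob_hitting_le[OF \<beta> _ ex_moves_to_stable E assms(1)])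
  ultimately show "0 \<le> (SUP \<sigma>\<in>configs L. ?p \<sigma>) \<and> (SUP \<sigma>\<in>configs L. ?p \<sigma>)
    \<le> exp ((- (exp (\<beta> * \<epsilon>) - 1) / (2 * n_bonds * n_configs ^ 5) + ln n_configs + 2 * \<beta> * E0) / 2)" ..
qed

end

lemma (in critical_model) stable_configs_subset:
  "stable_configs L U \<Delta> \<beta> (\<Delta> + U) \<subseteq> {empty_config L, full_config L}"
proof
  fix \<eta> assume \<eta>: "\<eta> \<in> stable_configs L U \<Delta> \<beta> (\<Delta> + U)"
  then have \<eta>_configs: "\<eta> \<in> configs L" by (simp add: stable_configs_def)
  define S where "S = {x \<in> Lam L. \<eta> x = 1}"
  have S: "S \<subseteq> Lam L" by (auto simp: S_def)
  have \<eta>_eq: "\<eta> = cfg L S" unfolding S_def by (rule configs_eq_cfg[OF \<eta>_configs])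
  show "\<eta> \<in> {empty_config L, full_config L}"
  proof (rule ccontr)
    assume "\<not> ?thesis"
    then have "S \<noteq> {}" "S \<noteq> hexagon L"
      using \<eta>_eq empty_config_eq full_config_eq[OF L_ge_1] by auto
    then obtain T where T: "T \<subseteq> Lam L" "H T < H S" "climb (H S + \<Delta> + U) S T"
      using reducible_unless_trivial[OF S] by (auto simp: reducible_def)
    have "stability_level L U \<Delta> \<beta> \<eta> \<le> ereal (\<Delta> + U)"
    proof (rule stability_level_le[OF _ \<eta>_configs])
      show "(\<eta>, cfg L T) \<in> (moves_below L U \<Delta> (energy L U \<Delta> \<eta> + (\<Delta> + U)))\<^sup>*"
        using T(3) unfolding climb_def H_def \<eta>_eq[symmetric] by (simp add: add.assoc)
      show "cfg L T \<in> lower_configs L U \<Delta> \<eta>"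
        using T(2) by (simp add: lower_configs_def cfg_configs H_def \<eta>_eq[symmetric])
    qed (use U_pos \<Delta>_gt in simp)
    then show False using \<eta> by (auto simp: stable_configs_def)
  qed
qed

theorem theorem2p4:
  fixes L :: nat and U \<Delta> :: real
  assumes "L \<ge> 1"
    and "U > 0"
    and "U < \<Delta>" and "\<Delta> < 3 / 2 * U"
    and "3 * U - 2 * \<Delta> \<le> U / 100"
    and "crit_ratio U \<Delta> \<notin> \<int>"
    and "frac (crit_ratio U \<Delta>) \<noteq> 1 / 2"
    and "int L > 2 * crit_radius U \<Delta> + 3"
  shows "(\<forall>\<beta>>0. stable_configs L U \<Delta> \<beta> (\<Delta> + U) \<subseteq> {empty_config L, full_config L}) \<and>
    (\<forall>\<epsilon>>0. SES (\<lambda>\<beta>. SUP \<sigma>\<in>configs L.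
       \<P>(\<omega> in kawasaki_law L U \<Delta> \<beta> \<sigma>.
          ereal_of_enat (hitting_time (stable_configs L U \<Delta> \<beta> (\<Delta> + U)) \<omega>)
            > ereal (exp (\<beta> * (\<Delta> + U + \<epsilon>))))))"
proof -
  define \<kappa> where "\<kappa> = 3 * U - 2 * \<Delta>"
  define c where "c = crit_ratio U \<Delta>"
  have \<kappa>: "0 < \<kappa>" "\<kappa> \<le> U / 100" using assms(4,5) by (auto simp: \<kappa>_def)
  \<comment> \<open>(U / (2 \<kappa>) - 1/2) \<kappa> = (U - \<kappa>) / 2, and this is \<Delta> -
    U.\<close>
  have c: "c * \<kappa> = \<Delta> - U"
  proof -
    have "c * \<kappa> = U / 2 - \<kappa> / 2"
      using \<kappa>(1) unfolding c_def crit_ratio_def \<kappa>_def[symmetric] by (simp add: left_diff_distrib)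
    then show ?thesis by (simp add: \<kappa>_def field_simps)
  qed
  \<comment> \<open>Otherwise (U - \<kappa>) / 2 \<le> \<kappa>, against \<kappa> \<le> U / 100.
    This gives \<open>r \<ge> 1\<close>.\<close>
  have "c > 1"
  proof (rule ccontr)
    assume "\<not> c > 1"
    then have "c * \<kappa> \<le> 1 * \<kappa>" using \<kappa>(1) by (intro mult_right_mono) auto
    then show False using c \<kappa> assms(2) by (simp add: \<kappa>_def)
  qed
  define r where "r = nat \<lfloor>c\<rfloor>"
  have r: "int r = \<lfloor>c\<rfloor>" "r \<ge> 1" using \<open>c > 1\<close> by (simp_all add: r_def le_nat_iff)
  have r_real: "real r = of_int \<lfloor>c\<rfloor>" using r(1) by (metis of_int_of_nat_eq)
  have "real r \<noteq> c" using assms(6) unfolding c_def[symmetric] r_real by (metis Ints_of_int)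
  then have r_less: "real r < c" "c < real r + 1" using r_real by linarith+
  have half: "2 * c \<noteq> 2 * real r + 1"
    using assms(7) unfolding c_def[symmetric] frac_def r_real by auto
  interpret critical_model L U \<Delta> r
  proof
    show "real r * (3 * U - 2 * \<Delta>) < \<Delta> - U"
      unfolding \<kappa>_def[symmetric] c[symmetric] using r_less \<kappa>(1) by simp
    show "\<Delta> - U < real (r + 1) * (3 * U - 2 * \<Delta>)"
      unfolding \<kappa>_def[symmetric] c[symmetric] using r_less \<kappa>(1) by simp
    have "2 * c * \<kappa> \<noteq> (2 * real r + 1) * \<kappa>" using half \<kappa>(1) by simp
    then show "2 * (\<Delta> - U) \<noteq> real (2 * r + 1) * (3 * U - 2 * \<Delta>)"
      unfolding \<kappa>_def[symmetric] c[symmetric] by simp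
    show "2 * r + 3 < L" using assms(8) r(1) unfolding crit_radius_def c_def by simp
  qed (use assms r in auto)
  show ?thesis using stable_configs_subset SES_hitting_stable[of "\<Delta> + U"] assms(2,3) by simp
qed

end
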